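(* If $\mu$ is attainable and $|\hat\mu(4)|>1/3$, then $$2\hat\mu(4)^2-1\le \hat\mu(8)\le M(\hat\mu(4)),\qquad M(x):=\max\big(x^4,(2|x|-1)^2\big).$$ Conversely, for all real $x,y$ with $|x|\le 1$ and $2x^2-1\le y\le M(x)$ there exists an attainable measure $\mu$ with $(\hat\mu(4),\hat\mu(8))=(x,y)$.
   Context: Let $S$ be the set of nonzero integers expressible as a sum of two integer squares. For $n\in S$ let $\Lambda_n=\{a+bi\in\mathbb{Z}[i]: a^2+b^2=n\}$, $r_2(n)=|\Lambda_n|$, and $\mu_n=\frac{1}{r_2(n)}\sum_{\lambda\in\Lambda_n}\delta_{\lambda/\sqrt n}$, a probability measure on $\mathcal{S}^1=\{z\in\mathbb{C}:|z|=1\}$. A probability measure $\mu$ on $\mathcal{S}^1$ is attainable if there is a sequence $(n_j)$ in $S$ with $\mu_{n_j}\to\mu$ weakly. The Fourier coefficients are $\hat\mu(k)=\int_{\mathcal{S}^1} z^{-k}\,d\mu(z)$ (these are real for attainable $\mu$). *)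

theory Defs
  imports "HOL-Probability.Probability"
begin

definition two_squares :: "int set" where
  "two_squares = {n. n \<noteq> 0 \<and> (\<exists>a b :: int. n = a\<^sup>2 + b\<^sup>2)}"

definition Lambda :: "int \<Rightarrow> complex set" where
  "Lambda n = {of_int a + \<i> * of_int b | a b :: int. a\<^sup>2 + b\<^sup>2 = n}"

definition r2 :: "int \<Rightarrow> nat" where
  "r2 n = card (Lambda n)"

text \<open>The measurable space \<open>S\<^sup>1\<close> with its Borel sets; its own measure is never used.\<close>

definition circle :: "complex measure" where
  "circle = restrict_space borel (sphere 0 1)"

definition mu :: "int \<Rightarrow> complex measure" where
  "mu n = measure_of (space circle) (sets circle)
     (\<lambda>A. (\<Sum>z\<in>Lambda n. emeasure (return circle (z / of_real (sqrt (of_int n)))) A)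
            / of_nat (r2 n))"

definition circle_prob :: "complex measure \<Rightarrow> bool" where
  "circle_prob \<mu> \<longleftrightarrow> prob_space \<mu> \<and> sets \<mu> = sets circle"

text \<open>The library's \<open>weak_conv_m\<close> is defined only for measures on the real line,
  through distribution functions. Since \<open>S\<^sup>1\<close> is compact, all continuous
  test functions are bounded.\<close>

definition circle_weak_conv :: "(nat \<Rightarrow> complex measure) \<Rightarrow> complex measure \<Rightarrow> bool" where
  "circle_weak_conv \<nu> \<mu> \<longleftrightarrow>
     (\<forall>f :: complex \<Rightarrow> real. continuous_on (sphere 0 1) f \<longrightarrow>
        (\<lambda>j. integral\<^sup>L (\<nu> j) f) \<longlonglongrightarrow> integral\<^sup>L \<mu> f)"

definition attainable :: "complex measure \<Rightarrow> bool" where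
  "attainable \<mu> \<longleftrightarrow> circle_prob \<mu> \<and>
     (\<exists>n :: nat \<Rightarrow> int. (\<forall>j. n j \<in> two_squares) \<and> circle_weak_conv (\<lambda>j. mu (n j)) \<mu>)"

definition fourier :: "complex measure \<Rightarrow> int \<Rightarrow> complex" where
  "fourier \<mu> k = (\<integral>z. z powi (- k) \<partial>\<mu>)"

definition M_bound :: "real \<Rightarrow> real" where
  "M_bound x = max (x ^ 4) ((2 * \<bar>x\<bar> - 1)\<^sup>2)"

lemma space_circle: "space circle = sphere 0 1"
  by (simp add: circle_def space_restrict_space)

lemma sets_mu: "sets (mu n) = sets circle"
  by (simp add: mu_def sets.sigma_sets_eq sets.space_closed)

lemma emeasure_mu:
  assumes "A \<in> sets circle"
  shows "emeasure (mu n) A =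
     (\<Sum>z\<in>Lambda n. emeasure (return circle (z / of_real (sqrt (of_int n)))) A) / of_nat (r2 n)"
  unfolding mu_def
proof (rule emeasure_measure_of_sigma)
  show "sigma_algebra (space circle) (sets circle)" ..
  let ?e = "\<lambda>z. emeasure (return circle (z / of_real (sqrt (of_int n))))"
  let ?f = "\<lambda>A. (\<Sum>z\<in>Lambda n. ?e z A) / of_nat (r2 n)"
  show "positive (sets circle) ?f"
    by (simp add: positive_def)
  show "countably_additive (sets circle) ?f"
    unfolding countably_additive_def
  proof (intro allI impI)
    fix B :: "nat \<Rightarrow> complex set"
    assume B: "range B \<subseteq> sets circle" "disjoint_family B"
    have "(\<Sum>i. ?f (B i)) = (\<Sum>i. \<Sum>z\<in>Lambda n. ?e z (B i)) / of_nat (r2 n)"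
      by (rule ennreal_suminf_divide)
    also have "(\<Sum>i. \<Sum>z\<in>Lambda n. ?e z (B i)) = (\<Sum>z\<in>Lambda n. \<Sum>i. ?e z (B i))"
      by (rule suminf_sum) simp
    also have "\<dots> = (\<Sum>z\<in>Lambda n. ?e z (\<Union>i. B i))"
      using B by (intro sum.cong refl suminf_emeasure) auto
    finally show "(\<Sum>i. ?f (B i)) = ?f (\<Union>i. B i)" .
  qed
qed (fact assms)

lemma finite_Lambda: "finite (Lambda n)"
proof (rule finite_subset)
  let ?R = "{-\<bar>n\<bar>..\<bar>n\<bar>}"
  show "Lambda n \<subseteq> (\<lambda>(a, b). of_int a + \<i> * of_int b) ` (?R \<times> ?R)"
  proof
    fix z assume "z \<in> Lambda n"
    then obtain a b :: int where z: "z = of_int a + \<i> * of_int b" and ab: "a\<^sup>2 + b\<^sup>2 = n"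
      by (auto simp: Lambda_def)
    have *: "\<bar>x\<bar> \<le> x\<^sup>2" for x :: int
      using mult_left_mono[of 1 "\<bar>x\<bar>" "\<bar>x\<bar>"]
      by (cases "x = 0") (auto simp: power2_eq_square)
    have "\<bar>a\<bar> \<le> n" "\<bar>b\<bar> \<le> n"
      using *[of a] *[of b] ab zero_le_power2[of a] zero_le_power2[of b] by linarith+
    then show "z \<in> (\<lambda>(a, b). of_int a + \<i> * of_int b) ` (?R \<times> ?R)"
      using z by (auto intro!: image_eqI[of _ _ "(a, b)"])
  qed
qed auto

lemma circle_prob_mu:
  assumes "n \<in> two_squares"
  shows "circle_prob (mu n)"
proof -
  obtain a b :: int where ab: "n = a\<^sup>2 + b\<^sup>2" and "n \<noteq> 0"
    using assms by (auto simp: two_squares_def)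
  have "n > 0"
    using ab \<open>n \<noteq> 0\<close> by (smt (verit) zero_le_power2)
  have "of_int a + \<i> * of_int b \<in> Lambda n"
    unfolding Lambda_def using ab by blast
  then have r: "r2 n > 0"
    unfolding r2_def using finite_Lambda card_gt_0_iff by blast
  have nz: "norm z = sqrt (of_int n)" if "z \<in> Lambda n" for z
  proof -
    from that obtain c d :: int where "z = of_int c + \<i> * of_int d" and "c\<^sup>2 + d\<^sup>2 = n"
      by (auto simp: Lambda_def)
    then show ?thesis
      by (auto simp: cmod_def)
  qed
  have sp: "space (mu n) = space circle"
    using sets_mu by (rule sets_eq_imp_space_eq)
  have "emeasure (return circle (z / of_real (sqrt (of_int n)))) (space circle) = 1"
    if "z \<in> Lambda n" for z
  proof -
    have "z / of_real (sqrt (of_int n)) \<in> space circle"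
      using nz[OF that] \<open>n > 0\<close> by (simp add: space_circle norm_divide)
    then show ?thesis
      by (simp add: emeasure_return)
  qed
  then have "emeasure (mu n) (space (mu n)) = of_nat (card (Lambda n)) / of_nat (r2 n)"
    by (simp add: sp emeasure_mu)
  also have "\<dots> = 1"
    using r unfolding r2_def
    by (intro ennreal_divide_self) (auto simp: card_gt_0_iff of_nat_less_top)
  finally show ?thesis
    by (simp add: circle_prob_def sets_mu prob_spaceI)
qed

end

theory Submission
  imports Defs "HOL-Real_Asymp.Real_Asymp"
begin

text \<open>
  The coefficients \<open>\<mu>\<^sub>n(4k)\<close> are real and multiplicative in \<open>n\<close>, and at a prime power \<open>p ^ e\<close> with
  \<open>p = x\<^sup>2 + y\<^sup>2\<close> odd they equal \<open>sin (N k \<phi>) / (N sin (k \<phi>))\<close>, where \<open>N = e + 1\<close> and \<open>\<phi>\<close> is four times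
  the angle of \<open>x + i y\<close>. The lower bound is the nonnegativity of a variance. For the upper bound,
  at a prime power the hypothesis \<open>\<bar>\<mu>\<^sub>n(4)\<bar> > 1/3\<close> forces \<open>\<phi>\<close> into the main lobe of the Dirichlet
  kernel, where \<open>\<mu>\<^sub>n(8) \<le> \<mu>\<^sub>n(4) ^ 4\<close> amounts to \<open>t\<^sup>3 cos t / sin\<^sup>3 t\<close> being decreasing; the bound
  \<open>M\<close> then survives multiplication.

  For the converse, squarefree products of split primes realise the points
  \<open>(\<Prod> cos \<phi>\<^sub>i, \<Prod> cos 2\<phi>\<^sub>i)\<close>, and Helly's selection theorem turns a limit of such points into an attainable
  measure. Hence it suffices that the angles \<open>\<phi>\<close> of the split primes be dense. This follows from
  Hecke's L-series \<open>L\<^sub>k(s) = \<Sum> (z/\<bar>z\<bar>) ^ (4k) \<bar>z\<bar> powr (-2s)\<close> over the Gaussian integers. Comparing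
  the residue classes modulo \<open>2 + i\<close> shows that \<open>L\<^sub>k\<close> is Lipschitz at \<open>s = 1\<close> for \<open>k \<ge> 1\<close> and has at most a
  simple pole there for \<open>k = 0\<close>. If \<open>L\<^sub>k(1) = 0\<close>, then \<open>cos (k \<phi>)\<close> is close to \<open>-1\<close> for most primes, so
  \<open>cos (2k \<phi>)\<close> is close to \<open>1\<close> and \<open>L\<^bsub>2k\<^esub>\<close> has a pole, which is impossible. So \<open>\<Sum> cos (k \<phi>) p powr (-s)\<close>
  stays bounded as \<open>s\<close> tends to \<open>1\<close>, and a Fejer kernel yields the density.
\<close>

section \<open>Measures on the circle\<close>

text \<open>The two branches of M come from products of equal cosines. If m primes all have cosine
  x^(1/m), the second coordinate is (2 x^(2/m) - 1)^m: two primes give (2x - 1)^2, and m tending to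
  infinity gives x^4, because doubling a small angle turns a cosine 1 - d into about 1 - 4d. The
  threshold 1/3 is where the bound breaks: at p^2 with phi close to pi/2 the point is close to
  (-1/3, 1), while M(1/3) = 1/9. The modulus 2 + i is chosen because its nonzero residue classes are
  represented by the four units, so they all carry the same partial series. Comparing these with the
  class of 0 writes L_k as a numerator that still converges at s = 1, divided by 1 - xi_k(2 + i)
  5^(1-s), and for s = 1 this denominator vanishes only when k = 0. A Lipschitz numerator replaces
  analyticity: a zero at 1 is automatically of order s - 1, which is enough to cancel the simple
  pole of L_0 in the sum of the logarithms. Hence only real s occur, and no prime number theorem is
  used.\<close>

lemma Lambda_memD:
  assumes "z \<in> Lambda n"
  shows "(cmod z)\<^sup>2 = of_int n" "cmod z = sqrt (of_int n)" "n \<ge> 0"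
proof -
  obtain a b :: int where z: "z = of_int a + \<i> * of_int b" and ab: "a\<^sup>2 + b\<^sup>2 = n"
    using assms by (auto simp: Lambda_def)
  have "(cmod z)\<^sup>2 = of_int (a\<^sup>2 + b\<^sup>2)"
    unfolding cmod_power2 by (simp add: z)
  with ab show 1: "(cmod z)\<^sup>2 = of_int n" by simp
  show "cmod z = sqrt (of_int n)" using 1 by (metis norm_ge_zero real_sqrt_unique)
  show "n \<ge> 0" using ab by (smt (verit) zero_le_power2)
qed

lemma two_squares_pos:
  assumes "n \<in> two_squares"
  shows "n > 0"
  using assms unfolding two_squares_def
  by (smt (verit) mem_Collect_eq zero_le_power2)

lemma two_squares_iff: "n \<in> two_squares \<longleftrightarrow> n \<noteq> 0 \<and> Lambda n \<noteq> {}"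
  by (auto simp: two_squares_def Lambda_def)

text \<open>Normalising by \<open>cis (Arg z)\<close> makes the map independent of \<open>n\<close>
  and total into the circle (the origin goes to 1), so \<open>mu n\<close> is the push-forward of a
  pmf and its integrals become finite sums.\<close>

lemma mu_eq_distr:
  assumes "n \<in> two_squares"
  shows "mu n = distr (measure_pmf (pmf_of_set (Lambda n))) circle (\<lambda>z. cis (Arg z))"
    (is "_ = distr ?P circle ?g")
proof (rule measure_eqI)
  show "sets (mu n) = sets (distr ?P circle ?g)"
    by (simp add: sets_mu)
next
  fix A assume "A \<in> sets (mu n)"
  then have A: "A \<in> sets circle" by (simp add: sets_mu)
  have ne: "Lambda n \<noteq> {}" using assms two_squares_iff by auto
  have npos: "n > 0" using assms by (rule two_squares_pos)
  have g: "?g \<in> measurable ?P circle"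
    by (auto simp: space_circle)
  have geq: "?g z = z / of_real (sqrt (of_int n))" if "z \<in> Lambda n" for z
  proof -
    have "z \<noteq> 0" using Lambda_memD[OF that] npos by auto
    then show ?thesis using Lambda_memD(2)[OF that] cis_Arg[of z] by (simp add: sgn_eq)
  qed
  have "emeasure (distr ?P circle ?g) A = emeasure ?P (?g -` A)"
    by (subst emeasure_distr[OF g A]) simp
  also have "\<dots> = card (Lambda n \<inter> ?g -` A) / card (Lambda n)"
    by (rule emeasure_pmf_of_set[OF ne finite_Lambda])
  also have "card (Lambda n \<inter> ?g -` A) = (\<Sum>z\<in>Lambda n. indicator A (?g z))"
    by (simp add: sum_indicator_eq_card[OF finite_Lambda, symmetric] indicator_vimage)
  also have "ennreal (real (\<Sum>z\<in>Lambda n. indicator A (?g z)) / real (card (Lambda n)))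
      = ennreal (real (\<Sum>z\<in>Lambda n. indicator A (?g z))) / ennreal (real (card (Lambda n)))"
    using ne finite_Lambda[of n] by (intro divide_ennreal[symmetric]) (simp_all add: card_gt_0_iff del: of_nat_sum)
  also have "\<dots> = of_nat (\<Sum>z\<in>Lambda n. indicator A (?g z)) / of_nat (card (Lambda n))"
    by (simp only: ennreal_of_nat_eq_real_of_nat)
  also have "of_nat (\<Sum>z\<in>Lambda n. indicator A (?g z)) = (\<Sum>z\<in>Lambda n. indicator A (?g z) :: ennreal)"
    unfolding of_nat_sum by (intro sum.cong refl) (simp split: split_indicator)
  also have "(\<Sum>z\<in>Lambda n. indicator A (?g z)) = (\<Sum>z\<in>Lambda n. emeasure (return circle (z / of_real (sqrt (of_int n)))) A)"
    using A by (intro sum.cong) (auto simp: geq)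
  also have "\<dots> / of_nat (card (Lambda n)) = emeasure (mu n) A"
    using A by (simp add: emeasure_mu r2_def)
  finally show "emeasure (mu n) A = emeasure (distr ?P circle ?g) A" ..
qed

lemma borel_measurable_circle:
  fixes f :: "complex \<Rightarrow> 'b :: topological_space"
  assumes "continuous_on (sphere 0 1) f"
  shows "f \<in> borel_measurable circle"
  unfolding circle_def by (rule borel_measurable_continuous_on_restrict[OF assms])

lemma integral_mu:
  fixes f :: "complex \<Rightarrow> 'b :: {banach, second_countable_topology}"
  assumes "n \<in> two_squares" "continuous_on (sphere 0 1) f"
  shows "integral\<^sup>L (mu n) f = (\<Sum>z\<in>Lambda n. f (cis (Arg z))) /\<^sub>R real (card (Lambda n))"
proof -
  have ne: "Lambda n \<noteq> {}" using assms two_squares_iff by auto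
  have "integral\<^sup>L (mu n) f = measure_pmf.expectation (pmf_of_set (Lambda n)) (\<lambda>z. f (cis (Arg z)))"
    unfolding mu_eq_distr[OF assms(1)] using assms(2)
    by (intro integral_distr borel_measurable_circle) (auto simp: space_circle)
  also have "\<dots> = (\<Sum>z\<in>Lambda n. pmf (pmf_of_set (Lambda n)) z *\<^sub>R f (cis (Arg z)))"
    using ne by (intro integral_measure_pmf) (auto simp: finite_Lambda)
  finally show ?thesis
    using ne finite_Lambda by (simp add: sum_divide_distrib scaleR_right.sum divide_inverse)
qed

text \<open>Compactness is borrowed from the real line: the laws of \<open>Arg\<close> live on a
  bounded interval, hence are tight, and the Helly limit is pushed back by \<open>cis\<close>. The
  jump of \<open>Arg\<close> at -1 is harmless because a test function composed with
  \<open>cis\<close> is continuous on the line.\<close>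

lemma mu_subsequence_converges:
  assumes n: "\<And>j. n j \<in> two_squares"
  obtains r \<mu> where "strict_mono (r :: nat \<Rightarrow> nat)" "circle_prob \<mu>" "circle_weak_conv (\<lambda>j. mu (n (r j))) \<mu>"
proof -
  define \<rho> where "\<rho> = (\<lambda>j. distr (measure_pmf (pmf_of_set (Lambda (n j)))) borel Arg)"
  have rd: "real_distribution (\<rho> j)" for j
    unfolding \<rho>_def by (intro prob_space.real_distribution_distr measure_pmf.prob_space_axioms) auto
  have "tight \<rho>" unfolding tight_def
  proof (intro conjI allI impI rd)
    fix e :: real assume "e > 0"
    have "measure (\<rho> j) {-4<..4} = 1" for j
    proof -
      have "Arg z > -4" "Arg z \<le> 4" for z
        using Arg_bounded[of z] pi_less_4 by auto
      then have "Arg -` {-4<..4} = UNIV" by auto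
      then show ?thesis unfolding \<rho>_def by (subst measure_distr) auto
    qed
    then show "\<exists>a b. a < b \<and> (\<forall>j. 1 - e < measure (\<rho> j) {a<..b})"
      using \<open>e > 0\<close> by (intro exI[of _ "-4"] exI[of _ 4]) auto
  qed
  from tight_imp_convergent_subsubsequence[OF this strict_mono_id]
  obtain r M where r: "strict_mono (r :: nat \<Rightarrow> nat)" and M: "real_distribution M" 
    and w: "weak_conv_m (\<lambda>j. \<rho> (r j)) M"
    by (auto simp: o_def)
  interpret M: real_distribution M by fact
  define \<mu> where "\<mu> = distr M circle cis"
  have cis: "cis \<in> measurable M circle"
    unfolding circle_def 
    by (intro measurable_restrict_space2) 
       (auto intro!: borel_measurable_continuous_onI continuous_intros 
             simp: measurable_cong_sets[OF M.events_eq_borel refl])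
  have "circle_prob \<mu>"
    unfolding circle_prob_def \<mu>_def using M.prob_space_distr[OF cis] by simp
  moreover have "circle_weak_conv (\<lambda>j. mu (n (r j))) \<mu>"
    unfolding circle_weak_conv_def
  proof (intro allI impI)
    fix f :: "complex \<Rightarrow> real" assume f: "continuous_on (sphere 0 1) f"
    have "compact (f ` sphere 0 1)" using f by (intro compact_continuous_image) auto
    then obtain B where B: "\<And>x. x \<in> sphere 0 1 \<Longrightarrow> norm (f x) \<le> B"
      by (metis compact_imp_bounded bounded_iff image_eqI)
    have c: "continuous_on UNIV (\<lambda>x. f (cis x))"
      using f by (rule continuous_on_compose2) (auto intro!: continuous_intros)
    have "(\<lambda>j. integral\<^sup>L (\<rho> (r j)) (\<lambda>x. f (cis x))) \<longlonglongrightarrow> integral\<^sup>L M (\<lambda>x. f (cis x))"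
      by (rule weak_conv_imp_integral_bdd_continuous_conv[OF rd M w, of _ B])
         (use c B in \<open>auto simp: continuous_on_eq_continuous_at\<close>)
    moreover have "integral\<^sup>L M (\<lambda>x. f (cis x)) = integral\<^sup>L \<mu> f"
      unfolding \<mu>_def by (rule integral_distr[symmetric, OF cis borel_measurable_circle[OF f]])
    moreover have "integral\<^sup>L (\<rho> (r j)) (\<lambda>x. f (cis x)) = integral\<^sup>L (mu (n (r j))) f" for j
    proof -
      have "integral\<^sup>L (\<rho> (r j)) (\<lambda>x. f (cis x)) = measure_pmf.expectation (pmf_of_set (Lambda (n (r j)))) (\<lambda>z. f (cis (Arg z)))"
        unfolding \<rho>_def using c by (intro integral_distr borel_measurable_continuous_onI) auto
      also have "\<dots> = integral\<^sup>L (mu (n (r j))) f"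
        unfolding mu_eq_distr[OF n] 
        by (intro integral_distr[symmetric] borel_measurable_circle f) (auto simp: space_circle)
      finally show ?thesis .
    qed
    ultimately show "(\<lambda>j. integral\<^sup>L (mu (n (r j))) f) \<longlonglongrightarrow> integral\<^sup>L \<mu> f" by simp
  qed
  ultimately show ?thesis using r that by blast
qed

lemma continuous_on_powi_sphere:
  "continuous_on (sphere 0 1) (\<lambda>z::complex. z powi k)"
  by (intro continuous_intros) auto

lemma circle_weak_conv_fourier:
  assumes "circle_weak_conv \<nu> \<mu>" "circle_prob \<mu>" "\<And>j. circle_prob (\<nu> j)"
  shows "(\<lambda>j. fourier (\<nu> j) k) \<longlonglongrightarrow> fourier \<mu> k"
proof -
  have int: "integrable M (\<lambda>z. z powi (-k))" if "circle_prob M" for M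
  proof -
    interpret prob_space M using that by (simp add: circle_prob_def)
    have s: "sets M = sets circle" using that by (simp add: circle_prob_def)
    have sp: "space M = sphere 0 1" using sets_eq_imp_space_eq[OF s] by (simp add: space_circle)
    show ?thesis
    proof (rule integrable_const_bound[of _ 1])
      show "AE x in M. norm (x powi - k) \<le> 1"
        by (rule AE_I2) (auto simp: sp norm_power_int)
      show "(\<lambda>z. z powi (-k)) \<in> borel_measurable M"
        using borel_measurable_circle[OF continuous_on_powi_sphere[of "-k"]] s
        by (simp cong: measurable_cong_sets)
    qed
  qed
  \<comment> \<open>Weak convergence is stated for real test functions, so real and imaginary parts
    pass to the limit separately.\<close>
  have c: "continuous_on (sphere 0 1) (\<lambda>z::complex. Re (z powi (-k)))"
     "continuous_on (sphere 0 1) (\<lambda>z::complex. Im (z powi (-k)))"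
    by (intro continuous_intros continuous_on_powi_sphere)+
  have "(\<lambda>j. Re (fourier (\<nu> j) k)) \<longlonglongrightarrow> Re (fourier \<mu> k)"
    "(\<lambda>j. Im (fourier (\<nu> j) k)) \<longlonglongrightarrow> Im (fourier \<mu> k)"
    using assms(1) c int[OF assms(2)] int[OF assms(3)]
    by (auto simp: circle_weak_conv_def fourier_def simp flip: integral_Re integral_Im)
  then show ?thesis by (simp add: tendsto_complex_iff)
qed

lemma attainable_if_fourier_limit:
  assumes n: "\<And>j. n j \<in> two_squares"
    and X: "(\<lambda>j. fourier (mu (n j)) 4) \<longlonglongrightarrow> X" and Y: "(\<lambda>j. fourier (mu (n j)) 8) \<longlonglongrightarrow> Y"
  shows "\<exists>\<mu>. attainable \<mu> \<and> fourier \<mu> 4 = X \<and> fourier \<mu> 8 = Y"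
proof -
  obtain r \<mu> where r: "strict_mono (r :: nat \<Rightarrow> nat)" "circle_prob \<mu>" "circle_weak_conv (\<lambda>j. mu (n (r j))) \<mu>"
    using mu_subsequence_converges[of n] n by blast
  have lim: "(\<lambda>j. fourier (mu (n (r j))) k) \<longlonglongrightarrow> fourier \<mu> k" for k
    using circle_weak_conv_fourier[OF r(3,2)] circle_prob_mu[OF n] by blast
  have "fourier \<mu> 4 = X" "fourier \<mu> 8 = Y"
    using LIMSEQ_unique[OF lim LIMSEQ_subseq_LIMSEQ[OF X r(1), unfolded o_def]]
      LIMSEQ_unique[OF lim LIMSEQ_subseq_LIMSEQ[OF Y r(1), unfolded o_def]] by auto
  moreover have "attainable \<mu>"
    unfolding attainable_def using r n by (intro conjI exI[of _ "\<lambda>j. n (r j)"]) auto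
  ultimately show ?thesis by blast
qed

section \<open>Gaussian integers and Hecke relations\<close>

definition gauss :: "complex set" where
  "gauss = {of_int a + \<i> * of_int b | a b. True}"

lemma gaussI: "of_int a + \<i> * of_int b \<in> gauss"
  by (auto simp: gauss_def)

lemma gaussE:
  assumes "z \<in> gauss"
  obtains a b where "z = of_int a + \<i> * of_int b"
  using assms by (auto simp: gauss_def)

lemma gauss_iff: "z \<in> gauss \<longleftrightarrow> Re z \<in> \<int> \<and> Im z \<in> \<int>"
proof
  assume "Re z \<in> \<int> \<and> Im z \<in> \<int>"
  then obtain a b where "Re z = of_int a" "Im z = of_int b" by (auto elim!: Ints_cases)
  then have "z = of_int a + \<i> * of_int b" by (simp add: complex_eq_iff)
  then show "z \<in> gauss" using gaussI by metis
qed (auto elim!: gaussE)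

lemma gauss_closed:
  assumes "z \<in> gauss" "w \<in> gauss"
  shows "z * w \<in> gauss" "z + w \<in> gauss" "z - w \<in> gauss" "cnj z \<in> gauss" "- z \<in> gauss"
  using assms by (auto simp: gauss_iff)

lemma Lambda_iff: "z \<in> Lambda n \<longleftrightarrow> z \<in> gauss \<and> (cmod z)\<^sup>2 = of_int n"
proof
  assume "z \<in> Lambda n"
  then show "z \<in> gauss \<and> (cmod z)\<^sup>2 = of_int n"
    using Lambda_memD[of z n] by (auto simp: Lambda_def gauss_def)
next
  assume z: "z \<in> gauss \<and> (cmod z)\<^sup>2 = of_int n"
  then obtain a b where ab: "z = of_int a + \<i> * of_int b" by (auto elim: gaussE)
  have "real_of_int (a\<^sup>2 + b\<^sup>2) = of_int n" using z by (simp add: ab cmod_power2)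
  then have "a\<^sup>2 + b\<^sup>2 = n" by linarith
  then show "z \<in> Lambda n" by (auto simp: Lambda_def ab)
qed

lemma cnj_Lambda: "cnj z \<in> Lambda n \<longleftrightarrow> z \<in> Lambda n"
  by (simp add: Lambda_iff gauss_iff)

text \<open>Hecke's Groessencharakter; exponents divisible by 4 make it trivial on the
  units.\<close>

definition xi :: "nat \<Rightarrow> complex \<Rightarrow> complex" where
  "xi k z = sgn z ^ (4 * k)"

text \<open>Division by the number of units makes \<open>hcoeff k\<close> multiplicative.\<close>

definition hcoeff :: "nat \<Rightarrow> nat \<Rightarrow> real" where
  "hcoeff k n = Re (\<Sum>z\<in>Lambda (int n). xi k z) / 4"

lemma xi_mult: "xi k (z * w) = xi k z * xi k w"
  by (simp add: xi_def sgn_mult power_mult_distrib)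

lemma xi_cnj: "xi k (cnj z) = cnj (xi k z)"
  by (simp add: xi_def sgn_eq)

lemma norm_xi: "z \<noteq> 0 \<Longrightarrow> cmod (xi k z) = 1"
  by (simp add: xi_def norm_power norm_sgn)

lemma xi_of_nat: "p > 0 \<Longrightarrow> xi k (of_nat p) = 1"
  by (simp add: xi_def sgn_eq)

lemma xi_eq_cis:
  assumes "z \<noteq> 0"
  shows "xi k z = cis (real k * (4 * Arg z))"
proof -
  have "xi k z = cis (Arg z) ^ (4 * k)" using assms by (simp add: xi_def cis_Arg)
  also have "\<dots> = cis (real (4 * k) * Arg z)" by (rule Complex.DeMoivre)
  finally show ?thesis by (simp add: mult_ac)
qed

text \<open>Conjugation permutes the lattice points and conjugates \<open>xi\<close>, so the sum is
  real. This is the source of the reality of the Fourier coefficients.\<close>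

lemma sum_xi_Lambda: "(\<Sum>z\<in>Lambda (int n). xi k z) = of_real (4 * hcoeff k n)"
proof -
  let ?S = "\<Sum>z\<in>Lambda (int n). xi k z"
  have "cnj ?S = (\<Sum>z\<in>Lambda (int n). xi k (cnj z))" by (simp add: xi_cnj)
  also have "\<dots> = ?S"
    by (rule sum.reindex_bij_witness[of _ cnj cnj]) (auto simp: cnj_Lambda)
  finally have "?S \<in> \<real>" by (simp add: Reals_cnj_iff)
  then show ?thesis by (simp add: hcoeff_def of_real_Re del: of_real_sum Re_sum)
qed

lemma hcoeff_0: "n > 0 \<Longrightarrow> hcoeff 0 n = real (card (Lambda (int n))) / 4"
  by (simp add: hcoeff_def xi_def)

lemma abs_hcoeff_le: "n > 0 \<Longrightarrow> \<bar>hcoeff k n\<bar> \<le> hcoeff 0 n"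
proof -
  assume n: "n > 0"
  have "cmod (\<Sum>z\<in>Lambda (int n). xi k z) \<le> (\<Sum>z\<in>Lambda (int n). 1)"
  proof (rule sum_norm_le)
    fix z assume "z \<in> Lambda (int n)"
    then have "z \<noteq> 0" using n Lambda_memD(1)[of z "int n"] by auto
    then show "cmod (xi k z) \<le> 1" by (simp add: norm_xi)
  qed
  then show ?thesis using n
    by (simp add: sum_xi_Lambda hcoeff_0 abs_mult del: of_real_mult)
qed

lemma hcoeff_0_nonneg: "n > 0 \<Longrightarrow> hcoeff 0 n \<ge> 0"
  by (simp add: hcoeff_0)

lemma two_squares_iff_hcoeff:
  "n > 0 \<Longrightarrow> int n \<in> two_squares \<longleftrightarrow> hcoeff 0 n > 0"
  using finite_Lambda[of "int n"] by (simp add: two_squares_iff hcoeff_0 card_gt_0_iff)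

lemma fourier_mu:
  assumes "int n \<in> two_squares"
  shows "fourier (mu (int n)) (4 * int k) = of_real (hcoeff k n / hcoeff 0 n)"
proof -
  have n: "n > 0" using two_squares_pos[OF assms] by simp
  have *: "cis (Arg z) powi (- (4 * int k)) = xi k (cnj z)" if "z \<in> Lambda (int n)" for z
  proof -
    have z: "z \<noteq> 0" using n Lambda_memD(1)[OF that] by auto
    have "cis (Arg z) powi (- (4 * int k)) = inverse (cis (Arg z) ^ (4 * k))"
    proof -
      have "4 * int k = int (4 * k)" by simp
      then show ?thesis by (simp only: power_int_minus power_int_of_nat)
    qed
    also have "cis (Arg z) ^ (4 * k) = cis (real k * (4 * Arg z))"
      unfolding Complex.DeMoivre by (simp add: mult_ac)
    also have "inverse (cis (real k * (4 * Arg z))) = cnj (xi k z)"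
      by (simp add: xi_eq_cis[OF z] cis_cnj)
    finally show ?thesis by (simp add: xi_cnj)
  qed
  have "fourier (mu (int n)) (4 * int k) = (\<Sum>z\<in>Lambda (int n). cis (Arg z) powi (- (4 * int k))) /\<^sub>R real (card (Lambda (int n)))"
    unfolding fourier_def by (rule integral_mu[OF assms continuous_on_powi_sphere])
  also have "(\<Sum>z\<in>Lambda (int n). cis (Arg z) powi (- (4 * int k))) = (\<Sum>z\<in>Lambda (int n). xi k (cnj z))"
    by (intro sum.cong * refl)
  \<comment> \<open>The negative exponent in \<open>fourier\<close> produced conjugates; the
    conjugation symmetry of the lattice points removes them.\<close>
  also have "\<dots> = (\<Sum>z\<in>Lambda (int n). xi k z)"
    by (rule sum.reindex_bij_witness[of _ cnj cnj]) (auto simp: cnj_Lambda)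
  finally show ?thesis
    unfolding sum_xi_Lambda hcoeff_0[OF n] scaleR_conv_of_real by (simp add: field_simps)
qed

lemma Lambda_1: "Lambda 1 = {1, -1, \<i>, -\<i>}"
proof (intro set_eqI iffI)
  fix z assume "z \<in> Lambda 1"
  then obtain a b :: int where ab: "z = of_int a + \<i> * of_int b" "a\<^sup>2 + b\<^sup>2 = 1"
    by (auto simp: Lambda_def)
  have "a\<^sup>2 \<le> 1" "b\<^sup>2 \<le> 1" using ab(2) zero_le_power2[of a] zero_le_power2[of b] by linarith+
  then have "\<bar>a\<bar> \<le> 1" "\<bar>b\<bar> \<le> 1" by (auto simp: abs_square_le_1)
  then have "a \<in> {-1,0,1}" "b \<in> {-1,0,1}" by auto
  then show "z \<in> {1, -1, \<i>, -\<i>}" using ab by auto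
qed (auto simp: Lambda_iff gauss_iff)

lemma hcoeff_1 [simp]: "hcoeff k (Suc 0) = 1"
  by (simp add: hcoeff_def Lambda_1 xi_def complex_eq_iff sgn_eq power_mult)

section \<open>Factorisation of rational primes in the Gaussian integers\<close>

lemma split_prime_factor:
  fixes a b c d p :: int
  assumes p: "prime p" "p = a\<^sup>2 + b\<^sup>2" and dvd: "p dvd c\<^sup>2 + d\<^sup>2"
  shows "(\<exists>x y. c = a * x - b * y \<and> d = a * y + b * x) \<or>
         (\<exists>x y. c = a * x + b * y \<and> d = a * y - b * x)"
proof -
  have p0: "p \<noteq> 0" using p by auto
  have main: "\<exists>x y. c = a * x - b * y \<and> d = a * y + b * x"
    if pab: "p = a\<^sup>2 + b\<^sup>2" and 1: "p dvd a * c + b * d" for a b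
  proof -
    \<comment> \<open>Brahmagupta's identity for the norm of conj(pi) z, where pi = a + ib and z = c
      + id. Once p divides both parts of conj(pi) z, the quotient w = x + iy by p satisfies z = pi
      w.\<close>
    have "(a * d - b * c)\<^sup>2 = p * (c\<^sup>2 + d\<^sup>2) - (a * c + b * d)\<^sup>2"
      unfolding pab by (simp add: power2_eq_square algebra_simps)
    then have "p dvd (a * d - b * c)\<^sup>2"
      using 1 by (metis dvd_diff dvd_mult2 dvd_refl power2_eq_square)
    then have "p dvd a * d - b * c" using p(1) prime_dvd_power by blast
    then obtain x y where x: "a * c + b * d = p * x" and y: "a * d - b * c = p * y"
      using 1 by (auto elim!: dvdE)
    have "p * (a * x - b * y) = a * (p * x) - b * (p * y)" by (simp add: algebra_simps)
    also have "\<dots> = p * c" 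
      by (simp only: x[symmetric] y[symmetric]) (simp add: pab power2_eq_square algebra_simps)
    finally have c: "c = a * x - b * y" using p0 by simp
    have "p * (a * y + b * x) = a * (p * y) + b * (p * x)" by (simp add: algebra_simps)
    also have "\<dots> = p * d" 
      by (simp only: x[symmetric] y[symmetric]) (simp add: pab power2_eq_square algebra_simps)
    finally have "d = a * y + b * x" using p0 by simp
    with c show ?thesis by blast
  qed
  have "(a * c + b * d) * (a * c - b * d) = a\<^sup>2 * (c\<^sup>2 + d\<^sup>2) - d\<^sup>2 * p"
    unfolding p(2) by (simp add: power2_eq_square algebra_simps)
  then have "p dvd (a * c + b * d) * (a * c - b * d)" using dvd by simp
  then consider "p dvd a * c + b * d" | "p dvd a * c - b * d"
    using p(1) by (metis prime_dvd_mult_iff)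
  then show ?thesis
  proof cases
    case 1 then show ?thesis using main[OF p(2)] by blast
  next
    case 2 then show ?thesis using main[of a "-b"] p(2) by auto
  qed
qed

text \<open>Thue's argument.\<close>

lemma inert_prime_dvd:
  fixes c d p :: int
  assumes p: "prime p" and ns: "\<not> (\<exists>a b :: int. p = a\<^sup>2 + b\<^sup>2)" and dvd: "p dvd c\<^sup>2 + d\<^sup>2"
  shows "p dvd c"
proof (rule ccontr)
  assume c: "\<not> p dvd c"
  have p1: "p > 1" using p prime_gt_1_int by blast
  define s where "s = \<lfloor>sqrt (of_int p)\<rfloor>"
  have s0: "s \<ge> 0" unfolding s_def using p1 by simp
  have "of_int s \<le> sqrt (of_int p)" unfolding s_def by simp
  then have "(of_int s)\<^sup>2 \<le> (of_int p :: real)" using s0 p1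
    by (metis of_int_0_le_iff power_mono real_sqrt_pow2 less_imp_le less_trans zero_less_one)
  then have "s\<^sup>2 \<le> p" by (metis of_int_le_iff of_int_power)
  moreover have "s\<^sup>2 \<noteq> p" using ns by (metis add.right_neutral zero_power2)
  ultimately have s1: "s\<^sup>2 < p" by simp
  have "sqrt (of_int p) < of_int (s + 1)" unfolding s_def by linarith
  then have "of_int p < (of_int (s + 1) :: real)\<^sup>2" using s0 p1
    by (metis (no_types, opaque_lifting) of_int_0_le_iff real_sqrt_ge_0_iff power_strict_mono pos2 real_sqrt_pow2 less_imp_le less_trans zero_less_one)
  then have s2: "p < (s + 1)\<^sup>2" by (metis of_int_less_iff of_int_power)
  let ?f = "\<lambda>(u, v). (u * c - v * d) mod p"
  have "\<not> inj_on ?f ({0..s} \<times> {0..s})"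
  proof (rule pigeonhole)
    have "card (?f ` ({0..s} \<times> {0..s})) \<le> card {0..<p}"
      using p1 by (intro card_mono) auto
    also have "\<dots> < card ({0..s} \<times> {0..s})"
      using s2 s0 p1 by (simp add: card_cartesian_product power2_eq_square nat_mult_distrib[symmetric] nat_less_iff)
    finally show "card ({0..s} \<times> {0..s}) > card (?f ` ({0..s} \<times> {0..s}))" .
  qed
  then obtain u v u' v' where uv: "u \<in> {0..s}" "v \<in> {0..s}" "u' \<in> {0..s}" "v' \<in> {0..s}" "(u, v) \<noteq> (u', v')"
    and eq: "(u * c - v * d) mod p = (u' * c - v' * d) mod p"
    unfolding inj_on_def by auto
  define x y where "x = u - u'" and "y = v - v'"
  have "p dvd (u * c - v * d) - (u' * c - v' * d)" using eq by (simp add: mod_eq_dvd_iff)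
  then have 1: "p dvd x * c - y * d" by (simp add: x_def y_def algebra_simps)
  \<comment> \<open>Modulo p one has xc = yd and d^2 = -c^2, so p divides x^2 + y^2. As this sum
    lies strictly between 0 and 2p, it is p itself.\<close>
  have "c\<^sup>2 * (x\<^sup>2 + y\<^sup>2) = (x * c - y * d) * (x * c + y * d) + y\<^sup>2 * (c\<^sup>2 + d\<^sup>2)"
    by (simp add: power2_eq_square algebra_simps)
  then have "p dvd c\<^sup>2 * (x\<^sup>2 + y\<^sup>2)" using 1 dvd by simp
  then have 2: "p dvd x\<^sup>2 + y\<^sup>2" using c p by (metis prime_dvd_mult_iff prime_dvd_power_iff pos2)
  have "\<bar>x\<bar> \<le> s" "\<bar>y\<bar> \<le> s" using uv by (auto simp: x_def y_def)
  then have "x\<^sup>2 \<le> s\<^sup>2" "y\<^sup>2 \<le> s\<^sup>2" by (metis abs_ge_zero power2_abs power_mono)+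
  then have 3: "x\<^sup>2 + y\<^sup>2 < 2 * p" using s1 by linarith
  have "x \<noteq> 0 \<or> y \<noteq> 0" using uv(5) by (auto simp: x_def y_def)
  then have 4: "x\<^sup>2 + y\<^sup>2 > 0" by (simp add: sum_power2_gt_zero_iff)
  obtain q where q: "x\<^sup>2 + y\<^sup>2 = p * q" using 2 by (elim dvdE)
  have "q > 0" using 4 q p1 by (metis zero_less_mult_pos less_trans zero_less_one)
  moreover have "q < 2" using 3 q p1 by simp
  ultimately have "q = 1" by simp
  then show False using q ns by (metis mult.right_neutral)
qed

definition split_prime :: "nat \<Rightarrow> bool" where
  "split_prime p \<longleftrightarrow> prime p \<and> p \<noteq> 2 \<and> Lambda (int p) \<noteq> {}"

lemma Lambda_mult:
  assumes "z \<in> Lambda m" "w \<in> Lambda n"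
  shows "z * w \<in> Lambda (m * n)"
  using assms by (simp add: Lambda_iff gauss_closed norm_mult power_mult_distrib)

lemma Lambda_mult_cancel:
  assumes "z * w \<in> Lambda (m * n)" "z \<in> Lambda m" "w \<in> gauss" "m \<noteq> 0"
  shows "w \<in> Lambda n"
  using assms by (simp add: Lambda_iff norm_mult power_mult_distrib)

text \<open>An element of norm \<open>p * m\<close> is divisible by one of the two Gaussian primes
  above p. The case p = 2 is included; there the two images coincide, which
  \<open>hcoeff_2_mult\<close> exploits.\<close>

lemma Lambda_prime_mult:
  fixes p m :: nat
  assumes p: "prime p" and pi: "\<pi> \<in> Lambda (int p)"
  shows "Lambda (int (p * m)) = (*) \<pi> ` Lambda (int m) \<union> (*) (cnj \<pi>) ` Lambda (int m)"
proof
  have "(*) \<pi> ` Lambda (int m) \<subseteq> Lambda (int p * int m)"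
    using pi Lambda_mult by auto
  moreover have "(*) (cnj \<pi>) ` Lambda (int m) \<subseteq> Lambda (int p * int m)"
    using pi Lambda_mult cnj_Lambda by auto
  ultimately show "(*) \<pi> ` Lambda (int m) \<union> (*) (cnj \<pi>) ` Lambda (int m) \<subseteq> Lambda (int (p * m))"
    by simp
next
  show "Lambda (int (p * m)) \<subseteq> (*) \<pi> ` Lambda (int m) \<union> (*) (cnj \<pi>) ` Lambda (int m)"
  proof
    fix z assume z: "z \<in> Lambda (int (p * m))"
    obtain a b :: int where ab: "\<pi> = of_int a + \<i> * of_int b" "a\<^sup>2 + b\<^sup>2 = int p"
      using pi by (auto simp: Lambda_def)
    obtain c d :: int where cd: "z = of_int c + \<i> * of_int d" "c\<^sup>2 + d\<^sup>2 = int (p * m)"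
      using z by (auto simp: Lambda_def)
    have pr: "prime (int p)" using p by simp
    have "int p dvd c\<^sup>2 + d\<^sup>2" using cd by simp
    from split_prime_factor[OF pr ab(2)[symmetric] this]
    consider x y where "c = a * x - b * y" "d = a * y + b * x" | x y where "c = a * x + b * y" "d = a * y - b * x"
      by blast
    then have "\<exists>w\<in>gauss. z = \<pi> * w \<or> z = cnj \<pi> * w"
    proof cases
      case 1
      then have "z = \<pi> * (of_int x + \<i> * of_int y)" by (simp add: ab cd complex_eq_iff)
      then show ?thesis using gaussI by blast
    next
      case 2
      then have "z = cnj \<pi> * (of_int x + \<i> * of_int y)" by (simp add: ab cd complex_eq_iff)
      then show ?thesis using gaussI by blast
    qed
    then obtain w where w: "w \<in> gauss" "z = \<pi> * w \<or> z = cnj \<pi> * w" by blast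
    have "w \<in> Lambda (int m)"
      using w z pi p Lambda_mult_cancel[of _ w "int p" "int m"] cnj_Lambda by (auto simp: prime_gt_0_nat)
    then show "z \<in> (*) \<pi> ` Lambda (int m) \<union> (*) (cnj \<pi>) ` Lambda (int m)"
      using w by blast
  qed
qed

text \<open>A multiple p w has norm p^2 times that of w, so p must divide m. This set is the
  correction term in the recursions: the overlap of the two images at a split prime, and everything
  at an inert prime.\<close>

lemma Lambda_dvd:
  fixes p m :: nat
  assumes p: "p > 0" 
  shows "{z \<in> Lambda (int (p * m)). \<exists>w\<in>gauss. z = of_nat p * w} =
    (if p dvd m then (*) (of_nat p) ` Lambda (int (m div p)) else {})" (is "?L = ?R")
proof -
  have *: "p * m = p\<^sup>2 * n \<and> w \<in> Lambda (int n)" if w1: "of_nat p * w \<in> Lambda (int (p * m))" and w2: "w \<in> gauss" 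
    and w3: "n = nat \<lfloor>(cmod w)\<^sup>2\<rfloor>" for w n
  proof -
    obtain a b where ab: "w = of_int a + \<i> * of_int b" using w2 by (auto elim: gaussE)
    have "(cmod w)\<^sup>2 = of_int (a\<^sup>2 + b\<^sup>2)" unfolding cmod_power2 by (simp add: ab)
    then have w: "(cmod w)\<^sup>2 = real n" using w3 by simp
    have "real (p * m) = (real p)\<^sup>2 * (cmod w)\<^sup>2"
      using w1 by (simp add: Lambda_iff norm_mult power_mult_distrib)
    then have "real (p * m) = real (p\<^sup>2 * n)" using w by simp
    then have "p * m = p\<^sup>2 * n" by (rule of_nat_eq_iff[THEN iffD1])
    then show ?thesis using w w2 by (simp add: Lambda_iff)
  qed
  have **: "m = p * n" if "p * m = p\<^sup>2 * n" for n
    using that p by (simp add: power2_eq_square)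
  show ?thesis
  proof (intro set_eqI iffI)
    fix z assume "z \<in> ?L"
    then obtain w where z: "z = of_nat p * w" "w \<in> gauss" "of_nat p * w \<in> Lambda (int (p * m))" by auto
    from *[OF z(3,2) refl] ** obtain n where n: "m = p * n" "w \<in> Lambda (int n)" by blast
    then show "z \<in> ?R" using z p by auto
  next
    fix z assume "z \<in> ?R"
    then obtain w where w: "p dvd m" "w \<in> Lambda (int (m div p))" "z = of_nat p * w"
      by (auto split: if_splits)
    then show "z \<in> ?L"
      using p by (auto simp: Lambda_iff norm_mult power_mult_distrib gauss_iff power2_eq_square elim!: dvdE)
  qed
qed

lemma sum_xi_times:
  assumes "c \<noteq> 0"
  shows "(\<Sum>z\<in>(*) c ` Lambda n. xi k z) = xi k c * (\<Sum>z\<in>Lambda n. xi k z)"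
  using assms by (subst sum.reindex) (auto simp: inj_on_def xi_mult sum_distrib_left)

text \<open>For odd p the factors pi and conj(pi) are coprime, so common multiples are multiples of
  p. Concretely, p divides z conj(pi) and z pi, hence 2a times each coordinate of z, where a = Re pi
  and p does not divide 2a.\<close>

lemma split_prime_coprime_conj:
  assumes "split_prime p" and pi: "\<pi> \<in> Lambda (int p)"
  shows "(*) \<pi> ` Lambda (int m) \<inter> (*) (cnj \<pi>) ` Lambda (int m) =
    (if p dvd m then (*) (of_nat p) ` Lambda (int (m div p)) else {})"
proof -
  have p: "prime p" "p \<noteq> 2" using assms(1) by (auto simp: split_prime_def)
  have p0: "p > 0" using p prime_gt_0_nat by blast
  have pr: "prime (int p)" using p by simp
  have pp: "\<pi> * cnj \<pi> = of_nat p" 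
    using pi complex_norm_square[of \<pi>] by (simp add: Lambda_iff)
  have "(*) \<pi> ` Lambda (int m) \<inter> (*) (cnj \<pi>) ` Lambda (int m) =
     {z \<in> Lambda (int (p * m)). \<exists>w\<in>gauss. z = of_nat p * w}"
  proof (intro set_eqI iffI)
    fix z assume "z \<in> {z \<in> Lambda (int (p * m)). \<exists>w\<in>gauss. z = of_nat p * w}"
    then obtain w where z: "z \<in> Lambda (int p * int m)" "w \<in> gauss" "z = of_nat p * w" by auto
    have "z = \<pi> * (cnj \<pi> * w)" "z = cnj \<pi> * (\<pi> * w)" using pp z(3) by (auto simp: mult_ac)
    moreover have "cnj \<pi> * w \<in> gauss" "\<pi> * w \<in> gauss" using pi z by (auto simp: Lambda_iff gauss_closed)
    moreover have "\<pi> * (cnj \<pi> * w) \<in> Lambda (int p * int m)" "cnj \<pi> * (\<pi> * w) \<in> Lambda (int p * int m)"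
      using z(1) calculation by metis+
    moreover have "cnj \<pi> \<in> Lambda (int p)" using pi by (simp add: cnj_Lambda)
    ultimately have "cnj \<pi> * w \<in> Lambda (int m)" "\<pi> * w \<in> Lambda (int m)"
      using Lambda_mult_cancel[OF _ pi] Lambda_mult_cancel[of "cnj \<pi>"] p0 by (metis of_nat_0_less_iff less_irrefl)+
    then show "z \<in> (*) \<pi> ` Lambda (int m) \<inter> (*) (cnj \<pi>) ` Lambda (int m)"
      using \<open>z = \<pi> * (cnj \<pi> * w)\<close> \<open>z = cnj \<pi> * (\<pi> * w)\<close> by blast
  next
    fix z assume z: "z \<in> (*) \<pi> ` Lambda (int m) \<inter> (*) (cnj \<pi>) ` Lambda (int m)"
    then have zL: "z \<in> Lambda (int (p * m))" using Lambda_prime_mult[OF p(1) pi] by blast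
    obtain w w' where w: "w \<in> gauss" "w' \<in> gauss" "z = \<pi> * w" "z = cnj \<pi> * w'"
      using z by (auto simp: Lambda_iff)
    have e1: "z * cnj \<pi> = of_nat p * w" "z * \<pi> = of_nat p * w'"
    proof -
      have "z * cnj \<pi> = \<pi> * cnj \<pi> * w" by (simp only: w(3) mult_ac)
      then show "z * cnj \<pi> = of_nat p * w" by (simp only: pp)
      have "z * \<pi> = \<pi> * cnj \<pi> * w'" by (simp only: w(4) mult_ac)
      then show "z * \<pi> = of_nat p * w'" by (simp only: pp)
    qed
    obtain a b :: int where ab: "\<pi> = of_int a + \<i> * of_int b" "a\<^sup>2 + b\<^sup>2 = int p"
      using pi by (auto simp: Lambda_def)
    obtain c d :: int where cd: "z = of_int c + \<i> * of_int d" 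
      using zL by (auto simp: Lambda_def)
    obtain x y :: int where xy: "w = of_int x + \<i> * of_int y" using w by (auto elim: gaussE)
    obtain x' y' :: int where xy': "w' = of_int x' + \<i> * of_int y'" using w by (auto elim: gaussE)
    have "Re (z * cnj \<pi>) = Re (of_nat p * w)" "Im (z * cnj \<pi>) = Im (of_nat p * w)" 
      "Re (z * \<pi>) = Re (of_nat p * w')" "Im (z * \<pi>) = Im (of_nat p * w')" using e1 by simp_all
    then have "real_of_int (c * a + d * b) = real_of_int (int p * x)" 
      "real_of_int (d * a - c * b) = real_of_int (int p * y)"
      "real_of_int (c * a - d * b) = real_of_int (int p * x')"
      "real_of_int (d * a + c * b) = real_of_int (int p * y')"
      by (simp_all add: ab cd xy xy' algebra_simps)
    then have eqs: "c * a + d * b = int p * x" "d * a - c * b = int p * y"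
      "c * a - d * b = int p * x'" "d * a + c * b = int p * y'"
      by (simp_all only: of_int_eq_iff)
    have "2 * c * a = int p * (x + x')" "2 * d * a = int p * (y + y')"
      using eqs by (simp_all add: algebra_simps)
    then have dv: "int p dvd 2 * c * a" "int p dvd 2 * d * a" by auto
    have n2: "\<not> int p dvd 2" 
      using p by (metis int_dvd_int_iff of_nat_numeral primes_dvd_imp_eq two_is_prime_nat)
    have na: "\<not> int p dvd a"
    proof
      assume da: "int p dvd a"
      then have "int p dvd a\<^sup>2" by (simp add: power2_eq_square)
      then have "int p dvd b\<^sup>2" using ab(2) by (metis dvd_add_right_iff dvd_refl)
      then have "int p dvd b" using pr prime_dvd_power by blast
      then have "(int p)\<^sup>2 dvd a\<^sup>2 + b\<^sup>2" using da by (simp add: dvd_add)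
      then have "p\<^sup>2 dvd p" unfolding ab(2) by (metis int_dvd_int_iff of_nat_power)
      then have "p dvd 1" using p0 by (simp add: power2_eq_square)
      then show False using p by simp
    qed
    have "int p dvd c" "int p dvd d"
      using dv n2 na pr by (auto simp: prime_dvd_mult_iff)
    then obtain u v where "c = int p * u" "d = int p * v" by (auto elim!: dvdE)
    then have "z = of_nat p * (of_int u + \<i> * of_int v)" by (simp add: cd algebra_simps)
    then show "z \<in> {z \<in> Lambda (int (p * m)). \<exists>w\<in>gauss. z = of_nat p * w}"
      using zL gaussI by blast
  qed
  then show ?thesis using Lambda_dvd[OF p0, of m] by simp
qed

text \<open>Inclusion-exclusion over the two images in \<open>Lambda_prime_mult\<close>.\<close>

lemma hcoeff_split_prime_mult:
  assumes sp: "split_prime p" and pi: "\<pi> \<in> Lambda (int p)"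
  shows "hcoeff k (p * m) = 2 * Re (xi k \<pi>) * hcoeff k m - (if p dvd m then hcoeff k (m div p) else 0)"
proof -
  have p: "prime p" using sp by (simp add: split_prime_def)
  have p0: "p > 0" using p prime_gt_0_nat by blast
  have nz: "\<pi> \<noteq> 0" using pi p0 by (auto simp: Lambda_iff)
  let ?S = "\<lambda>A. \<Sum>z\<in>A. xi k z"
  have "?S (Lambda (int (p * m))) = ?S ((*) \<pi> ` Lambda (int m)) + ?S ((*) (cnj \<pi>) ` Lambda (int m))
    - ?S ((*) \<pi> ` Lambda (int m) \<inter> (*) (cnj \<pi>) ` Lambda (int m))"
    unfolding Lambda_prime_mult[OF p pi] by (rule sum_Un) (auto simp: finite_Lambda)
  also have "\<dots> = (xi k \<pi> + cnj (xi k \<pi>)) * ?S (Lambda (int m)) - (if p dvd m then ?S (Lambda (int (m div p))) else 0)"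
    unfolding split_prime_coprime_conj[OF sp pi] using nz p0
    by (simp add: sum_xi_times xi_cnj xi_of_nat ring_distribs)
  finally have "complex_of_real (4 * hcoeff k (p * m)) = of_real (2 * Re (xi k \<pi>) * (4 * hcoeff k m) 
      - (if p dvd m then 4 * hcoeff k (m div p) else 0))"
    unfolding complex_add_cnj sum_xi_Lambda by (simp split: if_splits)
  then have "4 * hcoeff k (p * m) = 2 * Re (xi k \<pi>) * (4 * hcoeff k m) 
      - (if p dvd m then 4 * hcoeff k (m div p) else 0)" by (simp only: of_real_eq_iff)
  then show ?thesis by (simp split: if_splits)
qed

lemma hcoeff_inert_prime_mult:
  assumes p: "prime p" and L: "Lambda (int p) = {}"
  shows "hcoeff k (p * m) = (if p dvd m then hcoeff k (m div p) else 0)"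
proof -
  have p0: "p > 0" using p prime_gt_0_nat by blast
  have ns: "\<not> (\<exists>a b :: int. int p = a\<^sup>2 + b\<^sup>2)" 
  proof
    assume "\<exists>a b :: int. int p = a\<^sup>2 + b\<^sup>2"
    then obtain a b :: int where "int p = a\<^sup>2 + b\<^sup>2" by blast
    then have "of_int a + \<i> * of_int b \<in> Lambda (int p)" by (auto simp: Lambda_def)
    then show False using L by simp
  qed
  have "Lambda (int (p * m)) \<subseteq> {z \<in> Lambda (int (p * m)). \<exists>w\<in>gauss. z = of_nat p * w}"
  proof
    fix z assume z: "z \<in> Lambda (int (p * m))"
    obtain c d :: int where cd: "z = of_int c + \<i> * of_int d" "c\<^sup>2 + d\<^sup>2 = int (p * m)"
      using z by (auto simp: Lambda_def)
    have "int p dvd c" "int p dvd d"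
      using inert_prime_dvd[of "int p" c d] inert_prime_dvd[of "int p" d c] p ns cd(2)
      by (auto simp: add.commute)
    then obtain u v where "c = int p * u" "d = int p * v" by (auto elim!: dvdE)
    then have "z = of_nat p * (of_int u + \<i> * of_int v)" by (simp add: cd algebra_simps)
    then show "z \<in> {z \<in> Lambda (int (p * m)). \<exists>w\<in>gauss. z = of_nat p * w}"
      using z gaussI by blast
  qed
  then have "Lambda (int (p * m)) = {z \<in> Lambda (int (p * m)). \<exists>w\<in>gauss. z = of_nat p * w}"
    by blast
  also have "\<dots> = (if p dvd m then (*) (of_nat p) ` Lambda (int (m div p)) else {})"
    by (rule Lambda_dvd[OF p0])
  finally have "(\<Sum>z\<in>Lambda (int (p * m)). xi k z) = (if p dvd m then \<Sum>z\<in>Lambda (int (m div p)). xi k z else 0)"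
    using p0 by (simp add: sum_xi_times xi_of_nat)
  then show ?thesis by (simp add: hcoeff_def del: Re_sum)
qed

text \<open>The prime 2 is ramified: 1 - i is a unit times 1 + i, so multiplication by 1 + i is a
  bijection of lattice points. It turns them by pi/4, which contributes the sign.\<close>

lemma hcoeff_2_mult: "hcoeff k (2 * m) = (-1) ^ k * hcoeff k m"
proof -
  have pi: "1 + \<i> \<in> Lambda (int 2)" 
    by (auto simp: Lambda_def intro!: exI[of _ 1])
  have c: "cnj (1 + \<i>) = - \<i> * (1 + \<i>)" by (simp add: complex_eq_iff)
  have "(*) (cnj (1 + \<i>)) ` Lambda (int m) \<subseteq> (*) (1 + \<i>) ` Lambda (int m)"
  proof
    fix z assume "z \<in> (*) (cnj (1 + \<i>)) ` Lambda (int m)"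
    then obtain w where w: "w \<in> Lambda (int m)" "z = cnj (1 + \<i>) * w" by auto
    then have "z = (1 + \<i>) * (- \<i> * w)" by (simp only: c mult_ac)
    moreover have "- \<i> * w \<in> Lambda (int m)"
      using w by (auto simp: Lambda_iff gauss_iff norm_mult)
    ultimately show "z \<in> (*) (1 + \<i>) ` Lambda (int m)" by blast
  qed
  then have "Lambda (int (2 * m)) = (*) (1 + \<i>) ` Lambda (int m)"
    using Lambda_prime_mult[OF two_is_prime_nat pi, of m] by blast
  then have "(\<Sum>z\<in>Lambda (int (2 * m)). xi k z) = xi k (1 + \<i>) * (\<Sum>z\<in>Lambda (int m). xi k z)"
    by (simp only:) (rule sum_xi_times, simp add: complex_eq_iff)
  moreover have "xi k (1 + \<i>) = (-1) ^ k"
  proof -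
    have "(1 + \<i>) ^ 4 = -4" by (simp add: eval_nat_numeral algebra_simps)
    moreover have "cmod (1 + \<i>) ^ 4 = 4" 
    proof -
      have "(cmod (1 + \<i>))\<^sup>2 = 2" by (simp add: cmod_power2)
      then have "((cmod (1 + \<i>))\<^sup>2)\<^sup>2 = 4" by simp
      then show ?thesis by (simp flip: power_mult)
    qed
    then have "complex_of_real (cmod (1 + \<i>)) ^ 4 = 4" by (metis of_real_numeral of_real_power)
    ultimately have "sgn (1 + \<i>) ^ 4 = -1" by (simp add: sgn_eq power_divide)
    then show ?thesis by (simp add: xi_def power_mult)
  qed
  ultimately have "complex_of_real (4 * hcoeff k (2 * m)) = of_real ((-1) ^ k * (4 * hcoeff k m))"
    by (simp only: sum_xi_Lambda of_real_mult of_real_power of_real_minus of_real_1)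
  then show ?thesis by (simp only: of_real_eq_iff)
qed

section \<open>Hecke recursions at split, inert and ramified primes\<close>

definition heckeB :: "nat \<Rightarrow> real" where
  "heckeB p = (if p = 2 then 0 else if split_prime p then 1 else -1)"

lemma hcoeff_split_prime:
  assumes "split_prime p"
  obtains \<phi> where "\<And>k. hcoeff k p = 2 * cos (real k * \<phi>)"
     "\<And>k m. hcoeff k (p * m) = 2 * cos (real k * \<phi>) * hcoeff k m - (if p dvd m then hcoeff k (m div p) else 0)"
proof -
  have p: "prime p" using assms by (simp add: split_prime_def)
  obtain z where z: "z \<in> Lambda (int p)" using assms by (auto simp: split_prime_def)
  have "z \<noteq> 0" using z p prime_gt_0_nat[OF p] by (auto simp: Lambda_iff)
  then have re: "Re (xi k z) = cos (real k * (4 * Arg z))" for k by (simp add: xi_eq_cis)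
  have 2: "hcoeff k (p * m) = 2 * cos (real k * (4 * Arg z)) * hcoeff k m - (if p dvd m then hcoeff k (m div p) else 0)" for k m
    using hcoeff_split_prime_mult[OF assms z, of k m] by (simp add: re)
  have "\<not> p dvd 1" using p not_prime_unit by blast
  then have "hcoeff k p = 2 * cos (real k * (4 * Arg z))" for k
    using 2[of k 1] by (simp add: hcoeff_1)
  then show ?thesis using 2 that by blast
qed

lemma hcoeff_2: "hcoeff k 2 = (-1) ^ k"
  using hcoeff_2_mult[of k 1] by (simp add: hcoeff_1)

lemma hcoeff_inert:
  assumes "prime p" "p \<noteq> 2" "\<not> split_prime p"
  shows "hcoeff k p = 0"
proof -
  have "Lambda (int p) = {}" using assms by (auto simp: split_prime_def)
  then show ?thesis using hcoeff_inert_prime_mult[OF assms(1), of k 1] not_prime_unit assms by auto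
qed

lemma prime_trichotomy:
  assumes "prime p"
  obtains (two) "p = 2" "\<And>k. hcoeff k p = (-1) ^ k" "heckeB p = 0"
  | (split) \<phi> where "split_prime p" "p \<noteq> 2" "\<And>k. hcoeff k p = 2 * cos (real k * \<phi>)" "heckeB p = 1"
  | (inert) "\<not> split_prime p" "p \<noteq> 2" "\<And>k. hcoeff k p = 0" "heckeB p = -1"
proof (cases "p = 2")
  case True then show ?thesis using two hcoeff_2 by (simp add: heckeB_def)
next
  case False
  show ?thesis
  proof (cases "split_prime p")
    case True then show ?thesis using split hcoeff_split_prime[OF True] False
      by (metis heckeB_def)
  next
    case F: False then show ?thesis using inert hcoeff_inert[OF assms False F] False
      by (simp add: heckeB_def)
  qed
qed

text \<open>The three kinds of primes share one recursion because \<open>heckeB\<close> is, on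
  primes, the nontrivial character modulo 4. It returns as the quadratic coefficient of the Euler
  factor.\<close>

lemma hcoeff_prime_mult:
  assumes p: "prime p"
  shows "hcoeff k (p * m) = hcoeff k p * hcoeff k m - heckeB p * (if p dvd m then hcoeff k (m div p) else 0)"
proof (cases "p = 2")
  case True then show ?thesis by (simp add: heckeB_def hcoeff_2 hcoeff_2_mult)
next
  case False
  show ?thesis
  proof (cases "split_prime p")
    case True
    show ?thesis using hcoeff_split_prime[OF True] True False by (metis heckeB_def mult_1)
  next
    case F: False
    then have "Lambda (int p) = {}" using assms False by (auto simp: split_prime_def)
    then show ?thesis using hcoeff_inert_prime_mult[OF p, of k m] hcoeff_inert[OF p False F] F False
      by (simp add: heckeB_def)
  qed
qed

lemma hcoeff_prime_power_rec:
  assumes p: "prime p"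
  shows "hcoeff k (p ^ Suc (Suc e)) = hcoeff k p * hcoeff k (p ^ Suc e) - heckeB p * hcoeff k (p ^ e)"
  using hcoeff_prime_mult[OF p, of k "p ^ Suc e"] prime_gt_0_nat[OF p] by simp

text \<open>As functions of \<open>e\<close> both sides satisfy the same second-order recursion and
  agree at 0 and 1; hence the strong induction with two base cases.\<close>

lemma hcoeff_prime_power_mult:
  assumes p: "prime p" and m: "\<not> p dvd m"
  shows "hcoeff k (p ^ e * m) = hcoeff k (p ^ e) * hcoeff k m"
proof (induction e rule: less_induct)
  case (less e)
  show ?case
  proof (cases e)
    case 0 then show ?thesis using hcoeff_1 by simp
  next
    case (Suc d)
    show ?thesis
    proof (cases d)
      case 0
      then show ?thesis using Suc hcoeff_prime_mult[OF p, of k m] m by simp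
    next
      case (Suc c)
      have e: "e = Suc (Suc c)" using Suc \<open>e = Suc d\<close> by simp
      have "hcoeff k (p ^ e * m) = hcoeff k p * hcoeff k (p ^ Suc c * m) - heckeB p * hcoeff k (p ^ c * m)"
        using hcoeff_prime_mult[OF p, of k "p ^ Suc c * m"] prime_gt_0_nat[OF p] by (simp add: e mult_ac)
      also have "\<dots> = hcoeff k (p ^ e) * hcoeff k m"
        using less.IH[of "Suc c"] less.IH[of c] by (simp only: hcoeff_prime_power_rec[OF p] e) (simp add: algebra_simps)
      finally show ?thesis .
    qed
  qed
qed

lemma hcoeff_two_power: "hcoeff k (2 ^ e) = (-1) ^ (k * e)"
proof (induction e)
  case (Suc e) then show ?case using hcoeff_2_mult[of k "2 ^ e"] by (simp add: power_add)
qed (use hcoeff_1[of k] in simp)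

text \<open>The Chebyshev polynomials of the second kind. As polynomials in the cosine they remain
  meaningful where the sine in the denominator vanishes.\<close>

fun chebU :: "real \<Rightarrow> nat \<Rightarrow> real" where
  "chebU c 0 = 1"
| "chebU c (Suc 0) = 2 * c"
| "chebU c (Suc (Suc e)) = 2 * c * chebU c (Suc e) - chebU c e"

lemma chebU_cos: "chebU (cos x) e * sin x = sin (real (e + 1) * x)"
proof (induction e rule: induct_nat_012)
  case 1 then show ?case by (simp add: sin_double)
next
  case (ge2 e)
  have "chebU (cos x) (Suc (Suc e)) * sin x = 2 * cos x * (chebU (cos x) (Suc e) * sin x) - chebU (cos x) e * sin x"
    by (simp add: algebra_simps)
  also have "\<dots> = 2 * cos x * sin (real (Suc e + 1) * x) - sin (real (e + 1) * x)"
    using ge2 by simp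
  also have "real (e + 1) * x = real (Suc e + 1) * x - x" by (simp add: algebra_simps)
  also have "2 * cos x * sin (real (Suc e + 1) * x) - sin (real (Suc e + 1) * x - x) = sin (real (Suc e + 1) * x + x)"
    by (simp only: sin_add sin_diff) (simp add: algebra_simps)
  also have "real (Suc e + 1) * x + x = real (Suc (Suc e) + 1) * x" by (simp add: algebra_simps)
  finally show ?case .
qed simp

lemma chebU_1: "chebU 1 e = real (e + 1)"
  by (induction e rule: induct_nat_012) auto

lemma chebU_uminus: "chebU (- c) e = (-1) ^ e * chebU c e"
  by (induction e rule: induct_nat_012) (auto simp: algebra_simps)

lemma hcoeff_split_power:
  assumes "split_prime p" "\<And>k. hcoeff k p = 2 * cos (real k * \<phi>)"
  shows "hcoeff k (p ^ e) = chebU (cos (real k * \<phi>)) e"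
proof -
  have p: "prime p" "p \<noteq> 2" using assms(1) by (auto simp: split_prime_def)
  have B: "heckeB p = 1" using assms p by (simp add: heckeB_def)
  show ?thesis
    by (induction e rule: induct_nat_012)
       (simp_all add: assms(2) B hcoeff_prime_power_rec[OF p(1), unfolded power_Suc])
qed

lemma hcoeff_inert_power:
  assumes "prime p" "p \<noteq> 2" "\<not> split_prime p"
  shows "hcoeff k (p ^ e) = (if even e then 1 else 0)"
proof (induction e rule: induct_nat_012)
  case 0 then show ?case using hcoeff_1[of k] by simp
next
  case 1 then show ?case using hcoeff_inert[OF assms] by simp
next
  case (ge2 e)
  then show ?case
    unfolding hcoeff_prime_power_rec[OF assms(1)] using hcoeff_inert[OF assms] assms by (simp add: heckeB_def)
qed

section \<open>The upper bound\<close>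

text \<open>If both \<open>y\<^sub>1\<close> and \<open>y\<^sub>2\<close> are negative, the lower bounds and AM-GM give \<open>(2\<bar>x\<^sub>1 x\<^sub>2\<bar> - 1)\<^sup>2\<close>.\<close>

lemma M_bound_mult:
  fixes x\<^sub>1 x\<^sub>2 y\<^sub>1 y\<^sub>2 :: real
  assumes x: "\<bar>x\<^sub>1\<bar> \<le> 1" "\<bar>x\<^sub>2\<bar> \<le> 1"
    and y: "2 * x\<^sub>1\<^sup>2 - 1 \<le> y\<^sub>1" "y\<^sub>1 \<le> M_bound x\<^sub>1" "2 * x\<^sub>2\<^sup>2 - 1 \<le> y\<^sub>2" "y\<^sub>2 \<le> M_bound x\<^sub>2"
  shows "y\<^sub>1 * y\<^sub>2 \<le> M_bound (x\<^sub>1 * x\<^sub>2)"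
proof -
  define a b where "a = \<bar>x\<^sub>1\<bar>" and "b = \<bar>x\<^sub>2\<bar>"
  have ab: "0 \<le> a" "a \<le> 1" "0 \<le> b" "b \<le> 1" using x by (auto simp: a_def b_def)
  have M: "M_bound x\<^sub>1 = max (a ^ 4) ((2 * a - 1)\<^sup>2)" "M_bound x\<^sub>2 = max (b ^ 4) ((2 * b - 1)\<^sup>2)"
    "M_bound (x\<^sub>1 * x\<^sub>2) = max ((a * b) ^ 4) ((2 * (a * b) - 1)\<^sup>2)"
    by (simp_all add: M_bound_def a_def b_def abs_mult power_mult_distrib)
  have yb: "2 * a\<^sup>2 - 1 \<le> y\<^sub>1" "2 * b\<^sup>2 - 1 \<le> y\<^sub>2" using y by (simp_all add: a_def b_def)
  have nn: "0 \<le> M_bound x" for x by (simp add: M_bound_def max_def)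
  consider "y\<^sub>1 \<ge> 0" "y\<^sub>2 \<ge> 0" | "y\<^sub>1 < 0" "y\<^sub>2 < 0" | "y\<^sub>1 * y\<^sub>2 \<le> 0"
    by (metis linorder_not_le mult_nonneg_nonpos mult_nonpos_nonneg less_imp_le)
  then show ?thesis
  proof cases
    case 1
    have cases: "M_bound x\<^sub>1 = (a\<^sup>2)\<^sup>2 \<or> (M_bound x\<^sub>1 = (1 - 2 * a)\<^sup>2 \<and> a \<le> 1/2)"
      "M_bound x\<^sub>2 = (b\<^sup>2)\<^sup>2 \<or> (M_bound x\<^sub>2 = (1 - 2 * b)\<^sup>2 \<and> b \<le> 1/2)"
    proof -
      have *: "max (a ^ 4) ((2 * a - 1)\<^sup>2) = (a\<^sup>2)\<^sup>2 \<or> (max (a ^ 4) ((2 * a - 1)\<^sup>2) = (1 - 2 * a)\<^sup>2 \<and> a \<le> 1/2)" for a :: real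
      proof (cases "a \<le> 1/2")
        case True then show ?thesis by (auto simp: max_def power2_commute)
      next
        case False
        \<comment> \<open>Beyond 1/2 the quartic dominates, so the other branch only matters for a
          <= 1/2, where it is the square of the nonnegative number 1 - 2a.\<close>
        have "0 \<le> (a - 1)\<^sup>2" by simp
        then have "2 * a - 1 \<le> a\<^sup>2" by (simp add: power2_eq_square algebra_simps)
        then have "(2 * a - 1)\<^sup>2 \<le> (a\<^sup>2)\<^sup>2" using False by (intro power_mono) auto
        then show ?thesis by (simp add: max_def)
      qed
      show "M_bound x\<^sub>1 = (a\<^sup>2)\<^sup>2 \<or> (M_bound x\<^sub>1 = (1 - 2 * a)\<^sup>2 \<and> a \<le> 1/2)"
        "M_bound x\<^sub>2 = (b\<^sup>2)\<^sup>2 \<or> (M_bound x\<^sub>2 = (1 - 2 * b)\<^sup>2 \<and> b \<le> 1/2)"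
        unfolding M by (rule *)+
    qed
    have mixed: "((1 - 2 * a) * b\<^sup>2)\<^sup>2 \<le> (2 * (a * b) - 1)\<^sup>2" if "a \<le> 1/2" "0 \<le> a" "0 \<le> b" "b \<le> 1" for a b :: real
    proof -
      have "(1 - 2 * a) * b\<^sup>2 \<le> (1 - 2 * a) * b"
        using that by (intro mult_left_mono) (auto simp: power2_eq_square mult_left_le)
      also have "\<dots> \<le> 1 - 2 * (a * b)" using that by (simp add: algebra_simps)
      finally have "((1 - 2 * a) * b\<^sup>2)\<^sup>2 \<le> (1 - 2 * (a * b))\<^sup>2"
        using that by (intro power_mono) auto
      then show ?thesis by (simp add: power2_commute)
    qed
    have both: "((1 - 2 * a) * (1 - 2 * b))\<^sup>2 \<le> (2 * (a * b) - 1)\<^sup>2" if "a \<le> 1/2" "0 \<le> a" "0 \<le> b" "b \<le> 1/2" for a b :: real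
    proof -
      have "a * b \<le> a * (1/2)" "a * b \<le> (1/2) * b" using that by (intro mult_left_mono mult_right_mono; simp)+
      moreover have "a * b \<ge> 0" using that by simp
      ultimately have "3 * (a * b) \<le> a + b" by linarith
      then have "(1 - 2 * a) * (1 - 2 * b) \<le> 1 - 2 * (a * b)" by (simp add: algebra_simps)
      then have "((1 - 2 * a) * (1 - 2 * b))\<^sup>2 \<le> (1 - 2 * (a * b))\<^sup>2"
        using that by (intro power_mono) auto
      then show ?thesis by (simp add: power2_commute)
    qed
    have "y\<^sub>1 * y\<^sub>2 \<le> M_bound x\<^sub>1 * M_bound x\<^sub>2" using 1 y by (intro mult_mono) (auto simp: nn)
    also have "\<dots> \<le> M_bound (x\<^sub>1 * x\<^sub>2)"
      using cases
    proof (elim disjE conjE)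
      assume h: "M_bound x\<^sub>1 = (a\<^sup>2)\<^sup>2" "M_bound x\<^sub>2 = (b\<^sup>2)\<^sup>2"
      have "M_bound x\<^sub>1 * M_bound x\<^sub>2 = (a * b) ^ 4" unfolding h by (simp add: power_mult_distrib)
      then show ?thesis unfolding M(3) by simp
    next
      assume h: "M_bound x\<^sub>1 = (a\<^sup>2)\<^sup>2" "M_bound x\<^sub>2 = (1 - 2 * b)\<^sup>2" "b \<le> 1/2"
      show ?thesis using mixed[of b a] h ab unfolding M(3) h 
        by (simp add: power_mult_distrib mult_ac le_max_iff_disj)
    next
      assume h: "M_bound x\<^sub>1 = (1 - 2 * a)\<^sup>2" "a \<le> 1/2" "M_bound x\<^sub>2 = (b\<^sup>2)\<^sup>2"
      show ?thesis using mixed[of a b] h ab unfolding M(3) h 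
        by (simp add: power_mult_distrib mult_ac le_max_iff_disj)
    next
      assume h: "M_bound x\<^sub>1 = (1 - 2 * a)\<^sup>2" "a \<le> 1/2" "M_bound x\<^sub>2 = (1 - 2 * b)\<^sup>2" "b \<le> 1/2"
      show ?thesis using both[of a b] h ab unfolding M(3) h 
        by (simp add: power_mult_distrib mult_ac le_max_iff_disj)
    qed
    finally show ?thesis .
  next
    case 2
    have "y\<^sub>1 * y\<^sub>2 = (- y\<^sub>1) * (- y\<^sub>2)" by simp
    also have "\<dots> \<le> (1 - 2 * a\<^sup>2) * (1 - 2 * b\<^sup>2)" using 2 yb by (intro mult_mono) auto
    also have "\<dots> = (1 - 2 * (a * b))\<^sup>2 - 2 * (a - b)\<^sup>2" by (simp add: power2_eq_square algebra_simps)
    also have "\<dots> \<le> (2 * (a * b) - 1)\<^sup>2" by (simp add: power2_commute)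
    finally show ?thesis unfolding M(3) by simp
  next
    case 3 then show ?thesis using nn order_trans by blast
  qed
qed

section \<open>Trigonometric inequalities and the bound at split prime powers\<close>

lemma t_cos_le_sin:
  fixes t :: real
  assumes "0 \<le> t" "t \<le> pi"
  shows "t * cos t \<le> sin t"
proof -
  have "sin 0 - 0 * cos 0 \<le> sin t - t * cos t"
  proof (rule DERIV_nonneg_imp_nondecreasing[OF assms(1)])
    fix x assume x: "0 \<le> x" "x \<le> t"
    have "((\<lambda>x. sin x - x * cos x) has_real_derivative x * sin x) (at x)"
      by (auto intro!: derivative_eq_intros)
    moreover have "x * sin x \<ge> 0" using x assms by (simp add: sin_ge_zero)
    ultimately show "\<exists>y. ((\<lambda>x. sin x - x * cos x) has_real_derivative y) (at x) \<and> 0 \<le> y" by blast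
  qed
  then show ?thesis by simp
qed

text \<open>The difference of the two sides has derivative 4 sin t (sin t - t cos t), whose sign is
  given by \<open>t_cos_le_sin\<close>.\<close>

lemma three_sin_cos_le:
  fixes t :: real
  assumes "0 \<le> t" "t \<le> pi"
  shows "3 * sin t * cos t \<le> t * (1 + 2 * (cos t)\<^sup>2)"
proof -
  have "0 * (1 + 2 * (cos 0)\<^sup>2) - 3 * sin 0 * cos 0 \<le> t * (1 + 2 * (cos t)\<^sup>2) - 3 * sin t * cos t"
  proof (rule DERIV_nonneg_imp_nondecreasing[OF assms(1)])
    fix x assume x: "0 \<le> x" "x \<le> t"
    have d: "((\<lambda>x. x * (1 + 2 * (cos x)\<^sup>2) - 3 * sin x * cos x) has_real_derivative
       (1 + 2 * (cos x)\<^sup>2) - 4 * x * cos x * sin x - 3 * (cos x)\<^sup>2 + 3 * (sin x)\<^sup>2) (at x)"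
      by (auto intro!: derivative_eq_intros simp: power2_eq_square algebra_simps)
    have e: "(1 + 2 * (cos x)\<^sup>2) - 4 * x * cos x * sin x - 3 * (cos x)\<^sup>2 + 3 * (sin x)\<^sup>2
       = 4 * sin x * (sin x - x * cos x)"
      using sin_cos_squared_add[of x] by (simp add: power2_eq_square algebra_simps)
    have "4 * sin x * (sin x - x * cos x) \<ge> 0"
      using x assms t_cos_le_sin[of x] by (intro mult_nonneg_nonneg) (auto simp: sin_ge_zero)
    with d show "\<exists>y. ((\<lambda>x. x * (1 + 2 * (cos x)\<^sup>2) - 3 * sin x * cos x) has_real_derivative y) (at x) \<and> 0 \<le> y"
      unfolding e by blast
  qed
  then show ?thesis by simp
qed

text \<open>Up to a positive factor the derivative is the quantity bounded in
  \<open>three_sin_cos_le\<close>. The exponent 3 is what a quartic bound needs: comparing t with N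
  t gives cos(N t) / cos t <= X^3 for X = sin(N t) / (N sin t).\<close>

lemma cube_cos_div_sin_antimono:
  fixes s t :: real
  assumes "0 < s" "s \<le> t" "t < pi"
  shows "t ^ 3 * cos t / sin t ^ 3 \<le> s ^ 3 * cos s / sin s ^ 3"
proof (rule DERIV_nonpos_imp_nonincreasing[OF assms(2)])
  fix x assume x: "s \<le> x" "x \<le> t"
  have sx: "sin x > 0" using x assms by (intro sin_gt_zero) auto
  have d: "((\<lambda>x. x ^ 3 * cos x / sin x ^ 3) has_real_derivative
       ((3 * x\<^sup>2 * cos x - x ^ 3 * sin x) * sin x ^ 3 - x ^ 3 * cos x * (3 * (sin x)\<^sup>2 * cos x)) / (sin x ^ 3 * sin x ^ 3)) (at x)"
    using sx by (auto intro!: derivative_eq_intros simp: numeral_eq_Suc algebra_simps)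
  have e: "(3 * x\<^sup>2 * cos x - x ^ 3 * sin x) * sin x ^ 3 - x ^ 3 * cos x * (3 * (sin x)\<^sup>2 * cos x)
     = x\<^sup>2 * (sin x)\<^sup>2 * (3 * sin x * cos x - x * (1 + 2 * (cos x)\<^sup>2))"
  proof -
    have "x\<^sup>2 * (sin x)\<^sup>2 * (3 * sin x * cos x - x * (1 + 2 * (cos x)\<^sup>2)) = 
       x\<^sup>2 * (sin x)\<^sup>2 * (3 * sin x * cos x - x * ((sin x)\<^sup>2 + 3 * (cos x)\<^sup>2))"
    proof -
      have "1 + 2 * (cos x)\<^sup>2 = (sin x)\<^sup>2 + 3 * (cos x)\<^sup>2"
        using sin_cos_squared_add[of x] by linarith
      then show ?thesis by simp
    qed
    then show ?thesis by (simp add: power2_eq_square power3_eq_cube algebra_simps)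
  qed
  have "x\<^sup>2 * (sin x)\<^sup>2 * (3 * sin x * cos x - x * (1 + 2 * (cos x)\<^sup>2)) \<le> 0"
    using three_sin_cos_le[of x] x assms by (intro mult_nonneg_nonpos) auto
  then have "x\<^sup>2 * (sin x)\<^sup>2 * (3 * sin x * cos x - x * (1 + 2 * (cos x)\<^sup>2)) / (sin x ^ 3 * sin x ^ 3) \<le> 0"
    using sx by (intro divide_nonpos_pos) auto
  with d show "\<exists>y. ((\<lambda>x. x ^ 3 * cos x / sin x ^ 3) has_real_derivative y) (at x) \<and> y \<le> 0"
    unfolding e by blast
qed

lemma sin_ge_cubic:
  fixes t :: real
  assumes "0 \<le> t" "t \<le> 1"
  shows "t - t ^ 3 / 6 \<le> sin t"
proof -
  have "sin 0 - (0 - 0 ^ 3 / 6) \<le> sin t - (t - t ^ 3 / 6)"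
  proof (rule DERIV_nonneg_imp_nondecreasing[OF assms(1)])
    fix x assume x: "0 \<le> x" "x \<le> t"
    have "((\<lambda>x. sin x - (x - x ^ 3 / 6)) has_real_derivative cos x - (1 - x\<^sup>2 / 2)) (at x)"
      by (auto intro!: derivative_eq_intros)
    moreover have "cos x - (1 - x\<^sup>2 / 2) \<ge> 0"
    proof -
      have "(sin (x / 2))\<^sup>2 \<le> (x / 2)\<^sup>2"
        by (metis abs_sin_x_le_abs_x abs_le_square_iff)
      then show ?thesis using cos_double_sin[of "x / 2"] by (simp add: power2_eq_square)
    qed
    ultimately show "\<exists>y. ((\<lambda>x. sin x - (x - x ^ 3 / 6)) has_real_derivative y) (at x) \<and> 0 \<le> y" by blast
  qed
  then show ?thesis by simp
qed

text \<open>Write c = cos t, X = sin(N t) / (N sin t) and Y for the left side, so that Y = X cos(N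
  t) / cos t. For N t < pi/2 the monotonicity applies; for N t between pi/2 and pi, Y <= 0; beyond
  pi, |X| <= 1/3, by explicit polynomials up to N = 5 and by N sin t >= N sin(pi/N) >= 3 from N = 6
  on.\<close>

lemma chebU_upper_bound:
  fixes c :: real and e :: nat
  assumes c: "0 \<le> c" "c \<le> 1"
  defines "N \<equiv> real (e + 1)"
  assumes x: "\<bar>chebU c e / N\<bar> > 1 / 3"
  shows "chebU (2 * c\<^sup>2 - 1) e / N \<le> (chebU c e / N) ^ 4"
proof -
  consider "e = 0" | "c = 1" | "c = 0" "e = 1" | "c = 0" "e \<ge> 2" | "0 < c" "c < 1" "e \<ge> 1"
    using c by linarith
  then show ?thesis
  proof cases
    case 1 then show ?thesis by (simp add: N_def)
  next
    case 2 then show ?thesis by (simp add: N_def chebU_1[simplified])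
  next
    case 3 then show ?thesis using x by simp
  next
    case 4
    \<comment> \<open>At \<open>e = 2\<close> the value |X| = 1/3 is attained while Y = 1, so the
      strict inequality of the hypothesis matters here.\<close>
    have "\<bar>chebU c e\<bar> \<le> 1" using chebU_cos[of "pi / 2" e] 4 abs_sin_le_one by simp
    moreover have "N \<ge> 3" using 4 by (simp add: N_def)
    ultimately have "\<bar>chebU c e / N\<bar> \<le> 1 / 3" by (simp add: divide_simps)
    then show ?thesis using x by simp
  next
    case 5
    define t where "t = arccos c"
    have "arccos c < arccos 0" using 5 by (subst arccos_less_mono) auto
    then have t: "0 < t" "t < pi / 2" "cos t = c"
      using 5 arccos_lt_bounded[of c] by (simp_all add: t_def cos_arccos)
    have st: "sin t > 0" using t by (intro sin_gt_zero) auto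
    have N: "N \<ge> 2" using 5 by (simp add: N_def)
    define X where "X = chebU c e / N"
    define Y where "Y = chebU (2 * c\<^sup>2 - 1) e / N"
    have X: "X = sin (N * t) / (N * sin t)"
      using chebU_cos[of t e, folded N_def] st N t by (simp add: X_def field_simps)
    have "Y * (2 * sin t * c) = 2 * sin (N * t) * cos (N * t) / N"
      using chebU_cos[of "2 * t" e, folded N_def] sin_double[of "N * t"] N 
      unfolding cos_double_cos sin_double[of t] t(3)
      by (simp add: Y_def field_simps)
    then have "Y * c * (N * sin t) = sin (N * t) * cos (N * t)" using N by (simp add: field_simps)
    then have Y: "Y = X * cos (N * t) / c" using 5 st N unfolding X by (simp add: field_simps)
    consider "N * t < pi / 2" | "pi / 2 \<le> N * t" "N * t \<le> pi" | "pi < N * t" by linarith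
    then have "Y \<le> X ^ 4"
    proof cases
      case 1
      have Nt: "0 < N * t" "t \<le> N * t" using N t by auto
      have sN: "sin (N * t) > 0" using 1 Nt by (intro sin_gt_zero) auto
      have "(N * t) ^ 3 * cos (N * t) / sin (N * t) ^ 3 \<le> t ^ 3 * cos t / sin t ^ 3"
        using 1 Nt t by (intro cube_cos_div_sin_antimono) auto
      then have "cos (N * t) / cos t \<le> X ^ 3"
        using sN st t 5 N unfolding X by (simp add: field_simps power_mult_distrib)
      moreover have "X \<ge> 0" using sN st N by (simp add: X)
      ultimately have "X * (cos (N * t) / cos t) \<le> X * X ^ 3" by (rule mult_left_mono)
      then show ?thesis using t by (simp add: Y power_numeral_reduce)
    next
      case 2
      have "X \<ge> 0" using 2 st N sin_ge_zero[of "N * t"] t by (simp add: X)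
      moreover have "cos (N * t) \<le> 0" 
        using 2 cos_monotone_0_pi_le[of "pi / 2" "N * t"] by simp
      ultimately have "Y \<le> 0" using 5 by (simp add: Y mult_nonneg_nonpos divide_nonpos_pos)
      also have "0 \<le> X ^ 4" by simp
      finally show ?thesis .
    next
      case 3
      have "\<bar>X\<bar> \<le> 1 / 3"
      proof -
        have "e = 1 \<or> e = 2 \<or> e = 3 \<or> e = 4 \<or> e \<ge> 5" using 5 by linarith
        then consider "e = 1" | "e = 2" | "e = 3" | "e = 4" | "e \<ge> 5" by blast
        then show ?thesis
        proof cases
          \<comment> \<open>Vacuous, since N t = 2t < pi.\<close>
          case 1 then show ?thesis using 3 t by (simp add: N_def)
        next
          case 2
          have "cos t \<le> cos (pi / 3)" using 3 t 2 by (intro cos_monotone_0_pi_le) (auto simp: N_def)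
          then have "c \<le> 1 / 2" using t by (simp add: cos_60)
          then have "c\<^sup>2 \<le> (1/2)\<^sup>2" using c by (intro power_mono) auto
          moreover have "X = (4 * c\<^sup>2 - 1) / 3" 
            by (simp add: X_def 2 N_def numeral_eq_Suc power2_eq_square)
          moreover have "0 \<le> c\<^sup>2" by simp
          ultimately show ?thesis by (simp add: power2_eq_square abs_le_iff)
        next
          case 3
          have "cos t \<le> cos (pi / 4)" using \<open>pi < N * t\<close> t 3 by (intro cos_monotone_0_pi_le) (auto simp: N_def)
          then have "c \<le> sqrt 2 / 2" using t by (simp add: cos_45)
          then have "c\<^sup>2 \<le> (sqrt 2 / 2)\<^sup>2" using c by (intro power_mono) auto
          then have c2: "c\<^sup>2 \<le> 1 / 2" by (simp add: power_divide)
          have X3: "X = c * (2 * c\<^sup>2 - 1)" 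
            by (simp add: X_def 3 N_def numeral_eq_Suc power2_eq_square field_simps)
          define w where "w = 1 - 2 * c\<^sup>2"
          have w: "0 \<le> w" "w \<le> 1" using c2 by (auto simp: w_def)
          have "X\<^sup>2 = (1 - w) / 2 * w\<^sup>2" unfolding X3 w_def by (simp add: power2_eq_square algebra_simps)
          also have "\<dots> \<le> 1 / 9" 
          proof -
            \<comment> \<open>On [0, 1] the product (1 - w) w^2 has its maximum 4/27 at w = 2/3;
              this expression equals 4 - 27 (1 - w) w^2.\<close>
            have "0 \<le> (3 * w - 2)\<^sup>2 * (3 * w + 1)" using w by simp
            then have "27 * ((1 - w) * w\<^sup>2) \<le> 4" by (simp add: power2_eq_square algebra_simps)
            moreover have "(1 - w) / 2 * w\<^sup>2 = ((1 - w) * w\<^sup>2) / 2" by simp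
            ultimately show ?thesis by linarith
          qed
          finally have "X\<^sup>2 \<le> (1 / 3)\<^sup>2" by (simp add: power2_eq_square)
          then show ?thesis by (metis abs_le_square_iff abs_of_nonneg zero_le_divide_1_iff zero_le_numeral)
        next
          case 4
          have X4: "X = (16 * c ^ 4 - 12 * c\<^sup>2 + 1) / 5"
            by (simp add: X_def 4 N_def numeral_eq_Suc field_simps)
          \<comment> \<open>Completing the square in c^2 shows that even X >= -1/4.\<close>
          have "0 \<le> (8 * c\<^sup>2 - 3)\<^sup>2" by simp
          then have "X \<ge> - (1 / 3)" unfolding X4 by (simp add: power2_eq_square power4_eq_xxxx algebra_simps)
          moreover have "X \<le> 1 / 3"
          proof (rule ccontr)
            assume "\<not> X \<le> 1 / 3"
            then have X13: "X > 1 / 3" by simp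
            then have "0 < X * (N * sin t)" using st N by (intro mult_pos_pos) auto
            then have "sin (N * t) > 0" using st N by (simp add: X)
            \<comment> \<open>X can become positive again only after N t has passed 2 pi, so t > 2
              pi / 5; the weaker t > pi/4 already gives X <= 1/5.\<close>
            have "2 * pi < N * t"
            proof (rule ccontr)
              assume "\<not> 2 * pi < N * t"
              then have "sin (N * t) \<le> 0" using \<open>pi < N * t\<close> sin_le_zero[of "N * t"] 
                by (cases "N * t = 2 * pi") auto
              then show False using \<open>sin (N * t) > 0\<close> by simp
            qed
            then have "2 * pi < 5 * t" using 4 by (simp add: N_def)
            then have "t > pi / 4" using pi_gt_zero by linarith
            then have "cos t \<le> cos (pi / 4)" using t by (intro cos_monotone_0_pi_le) auto
            then have "c \<le> sqrt 2 / 2" using t by (simp add: cos_45)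
            then have "c\<^sup>2 \<le> (sqrt 2 / 2)\<^sup>2" using c by (intro power_mono) auto
            then have c2: "c\<^sup>2 \<le> 1 / 2" by (simp add: power_divide)
            then have "c\<^sup>2 * (4 * c\<^sup>2 - 3) \<le> 0" by (intro mult_nonneg_nonpos) auto
            then have "X \<le> 1 / 5" unfolding X4 by (simp add: power2_eq_square power4_eq_xxxx algebra_simps)
            then show False using X13 by simp
          qed
          ultimately show ?thesis by (simp add: abs_le_iff)
        next
          case 5
          have N6: "N \<ge> 6" using 5 by (simp add: N_def)
          \<comment> \<open>N sin(pi/N) increases with N and equals 3 at N = 6, which is why this
            argument starts there.\<close>
          have "sin (pi / N) \<ge> 3 / N"
          proof (cases "e = 5")
            case True then show ?thesis by (simp add: N_def sin_30)
          next
            case False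
            then have N7: "N \<ge> 7" using 5 by (simp add: N_def)
            have pi: "pi \<ge> 157/50" "pi \<le> 32/10" using pi_approx by auto
            define u where "u = pi / N"
            have "u \<le> pi / 7" unfolding u_def using N7 by (intro divide_left_mono) auto
            then have u: "0 \<le> u" "u \<le> 1/2" using pi N7 by (auto simp: u_def)
            \<comment> \<open>150/157 is 3 divided by the lower bound 157/50 for pi. It lies below 1
              - (1/2)^2 / 6 = 23/24, so the cubic bound for the sine is sharp enough.\<close>
            have "3 / N \<le> u * (150 / 157)" using pi N7 by (simp add: u_def field_simps)
            also have "\<dots> \<le> u - u ^ 3 / 6" 
            proof -
              have "u\<^sup>2 \<le> (1/2)\<^sup>2" using u by (intro power_mono) auto
              then have "u * (150 / 157) \<le> u * (1 - u\<^sup>2 / 6)" using u by (intro mult_left_mono) (auto simp: power2_eq_square)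
              then show ?thesis by (simp add: algebra_simps power2_eq_square power3_eq_cube)
            qed
            also have "\<dots> \<le> sin u" using u by (intro sin_ge_cubic) auto
            finally show ?thesis by (simp add: u_def)
          qed
          also have "sin (pi / N) \<le> sin t"
          proof (rule sin_monotone_2pi_le)
            have "0 \<le> pi / N" using N6 by simp
            then show "- (pi / 2) \<le> pi / N" using pi_gt_zero by linarith
          qed (use 3 t N6 in \<open>auto simp: field_simps\<close>)
          finally have "N * sin t \<ge> 3" using N6 by (simp add: field_simps)
          then have "\<bar>X\<bar> \<le> 1 / (N * sin t)"
            unfolding X using st N by (simp add: abs_mult divide_right_mono)
          also have "\<dots> \<le> 1 / 3" using \<open>N * sin t \<ge> 3\<close> by (intro divide_left_mono) auto
          finally show ?thesis .
        qed
      qed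
      then show ?thesis using x by (simp add: X_def)
    qed
    then show ?thesis by (simp add: X_def Y_def)
  qed
qed

section \<open>Bounds for all integers and passage to limit measures\<close>

definition ratio :: "nat \<Rightarrow> nat \<Rightarrow> real" where
  "ratio k n = hcoeff k n / hcoeff 0 n"

lemma abs_ratio_le_1: "n > 0 \<Longrightarrow> \<bar>ratio k n\<bar> \<le> 1"
  using abs_hcoeff_le[of n k] hcoeff_0_nonneg[of n] by (auto simp: ratio_def abs_mult divide_le_eq_1)

lemma ratio_prime_power_mult:
  assumes "prime p" "\<not> p dvd m"
  shows "ratio k (p ^ e * m) = ratio k (p ^ e) * ratio k m"
  using assms by (simp add: ratio_def hcoeff_prime_power_mult)

text \<open>The variance of \<open>cos 4\<theta>\<close> under the uniform measure on the lattice points is nonnegative.\<close>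

lemma ratio_lower_bound:
  assumes n: "n > 0" "hcoeff 0 n > 0"
  shows "2 * (ratio 1 n)\<^sup>2 - 1 \<le> ratio 2 n"
proof -
  let ?L = "Lambda (int n)"
  define c where "c = (\<lambda>z. Re (xi 1 z))"
  define x where "x = ratio 1 n"
  have c2: "Re (xi 2 z) = 2 * (c z)\<^sup>2 - 1" if "z \<in> ?L" for z
  proof -
    have "z \<noteq> 0" using that n by (auto simp: Lambda_iff)
    then show ?thesis using cos_double_cos[of "4 * Arg z"] by (simp add: c_def xi_eq_cis mult.assoc)
  qed
  have card: "real (card ?L) = 4 * hcoeff 0 n" using n by (simp add: hcoeff_0)
  have s1: "(\<Sum>z\<in>?L. c z) = 4 * hcoeff 0 n * x" using n by (simp add: hcoeff_def c_def x_def ratio_def)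
  have s2: "(\<Sum>z\<in>?L. 2 * (c z)\<^sup>2 - 1) = 4 * hcoeff 0 n * ratio 2 n"
    using n c2 by (simp add: hcoeff_def ratio_def)
  have "0 \<le> (\<Sum>z\<in>?L. 2 * (c z - x)\<^sup>2)" by (intro sum_nonneg) simp
  also have "\<dots> = (\<Sum>z\<in>?L. (2 * (c z)\<^sup>2 - 1) - 4 * x * c z + (2 * x\<^sup>2 + 1))"
    by (intro sum.cong refl) (simp add: power2_eq_square algebra_simps)
  also have "\<dots> = (\<Sum>z\<in>?L. 2 * (c z)\<^sup>2 - 1) - 4 * x * (\<Sum>z\<in>?L. c z) + real (card ?L) * (2 * x\<^sup>2 + 1)"
    by (simp add: sum.distrib sum_subtractf sum_distrib_left ring_distribs)
  also have "\<dots> = 4 * hcoeff 0 n * (ratio 2 n - (2 * x\<^sup>2 - 1))"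
    unfolding s1 s2 card by (simp add: power2_eq_square algebra_simps)
  finally show ?thesis using n by (simp add: x_def zero_le_mult_iff)
qed

text \<open>Replacing c by -c changes the first ratio at most by a sign and leaves the second alone,
  while the fourth power ignores signs.\<close>

lemma chebU_ratio_bound:
  fixes c :: real and e :: nat
  assumes c: "\<bar>c\<bar> \<le> 1" and x: "\<bar>chebU c e / real (e + 1)\<bar> > 1 / 3"
  shows "chebU (2 * c\<^sup>2 - 1) e / real (e + 1) \<le> (chebU c e / real (e + 1)) ^ 4"
proof (cases "c \<ge> 0")
  case True then show ?thesis using chebU_upper_bound[of c e] c x by simp
next
  case False
  have eq: "chebU (- c) e / real (e + 1) = (-1) ^ e * (chebU c e / real (e + 1))"
    by (simp add: chebU_uminus)
  have "\<bar>chebU (- c) e / real (e + 1)\<bar> > 1 / 3" unfolding eq using x by (simp add: abs_mult)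
  then have "chebU (2 * (- c)\<^sup>2 - 1) e / real (e + 1) \<le> (chebU (- c) e / real (e + 1)) ^ 4"
    using False c by (intro chebU_upper_bound) auto
  also have "\<dots> = (chebU c e / real (e + 1)) ^ 4"
    unfolding eq power_mult_distrib by (simp add: mult.commute[of e] power_mult flip: power_mult[of _ e 4])
  finally show ?thesis by simp
qed

text \<open>Only the split case has content. At 2 the ratios are a sign and 1. At an inert prime
  they are 1 for even \<open>e\<close>, and for odd \<open>e\<close> the quotient 0/0 = 0
  contradicts the hypothesis.\<close>

lemma ratio_prime_power_bound:
  assumes p: "prime p" and x: "\<bar>ratio 1 (p ^ e)\<bar> > 1 / 3"
  shows "ratio 2 (p ^ e) \<le> ratio 1 (p ^ e) ^ 4"
proof -
  from p show ?thesis
  proof (cases rule: prime_trichotomy)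
    case two
    then show ?thesis by (simp add: ratio_def hcoeff_two_power flip: power_mult)
  next
    case (split \<phi>)
    have h: "hcoeff k (p ^ e) = chebU (cos (real k * \<phi>)) e" for k
      using hcoeff_split_power[OF split(1,3)] .
    have r: "ratio 1 (p ^ e) = chebU (cos \<phi>) e / real (e + 1)"
      "ratio 2 (p ^ e) = chebU (2 * (cos \<phi>)\<^sup>2 - 1) e / real (e + 1)"
      using h[of 0] h[of 1] h[of 2] by (simp_all add: ratio_def chebU_1 cos_double_cos)
    show ?thesis using chebU_ratio_bound[of "cos \<phi>" e] x unfolding r by simp
  next
    case inert
    then show ?thesis using x hcoeff_inert_power[OF p inert(2,1)] by (auto simp: ratio_def split: if_splits)
  qed
qed

text \<open>One full prime power is split off at a time. Both factors inherit the hypothesis because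
  ratios have modulus at most 1, and \<open>M_bound_mult\<close> combines their bounds.\<close>

lemma ratio_upper_bound:
  assumes "n > 0" "hcoeff 0 n > 0" "\<bar>ratio 1 n\<bar> > 1 / 3"
  shows "ratio 2 n \<le> M_bound (ratio 1 n)"
  using assms
proof (induction n rule: less_induct)
  case (less n)
  show ?case
  proof (cases "n = 1")
    case True then show ?thesis by (simp add: ratio_def M_bound_def)
  next
    case False
    then obtain p where p: "prime p" "p dvd n" using prime_factor_nat by blast
    obtain m where m: "n = p ^ multiplicity p n * m" "\<not> p dvd m"
      using multiplicity_decompose'[of n p] p less.prems(1) not_prime_unit by (metis less_irrefl)
    define e where "e = multiplicity p n"
    have nm: "n = p ^ e * m" using m e_def by simp
    have e: "e > 0" using p less.prems by (simp add: e_def prime_multiplicity_gt_zero_iff)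
    have m0: "m > 0" using nm less.prems by (cases "m = 0") auto
    have "p ^ e > 1" using e p prime_gt_1_nat one_less_power by blast
    then have mn: "m < n" using nm m0 by simp
    have pe: "p ^ e > 0" using p prime_gt_0_nat by simp
    have hm: "hcoeff 0 n = hcoeff 0 (p ^ e) * hcoeff 0 m" 
      unfolding nm by (rule hcoeff_prime_power_mult[OF p(1) m(2)])
    have h0: "hcoeff 0 (p ^ e) > 0" "hcoeff 0 m > 0"
      using hm less.prems(2) hcoeff_0_nonneg[OF pe] hcoeff_0_nonneg[OF m0] 
      by (auto simp: zero_less_mult_iff)
    have r: "ratio k n = ratio k (p ^ e) * ratio k m" for k
      unfolding nm by (rule ratio_prime_power_mult[OF p(1) m(2)])
    have b: "\<bar>ratio 1 (p ^ e)\<bar> \<le> 1" "\<bar>ratio 1 m\<bar> \<le> 1" using abs_ratio_le_1 pe m0 by auto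
    have "\<bar>ratio 1 (p ^ e)\<bar> * \<bar>ratio 1 m\<bar> > 1 / 3" using less.prems(3) r[of 1] by (simp add: abs_mult)
    moreover have "\<bar>ratio 1 (p ^ e)\<bar> * \<bar>ratio 1 m\<bar> \<le> \<bar>ratio 1 (p ^ e)\<bar>" 
      "\<bar>ratio 1 (p ^ e)\<bar> * \<bar>ratio 1 m\<bar> \<le> \<bar>ratio 1 m\<bar>"
      using b by (simp_all add: mult_left_le mult_left_le_one_le)
    ultimately have x: "\<bar>ratio 1 (p ^ e)\<bar> > 1 / 3" "\<bar>ratio 1 m\<bar> > 1 / 3" by linarith+
    have "ratio 2 (p ^ e) \<le> M_bound (ratio 1 (p ^ e))"
      using ratio_prime_power_bound[OF p(1) x(1)] by (simp add: M_bound_def)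
    then show ?thesis unfolding r
      using less.IH[OF mn m0 h0(2) x(2)] b ratio_lower_bound[OF pe h0(1)] ratio_lower_bound[OF m0 h0(2)]
      by (intro M_bound_mult) auto
  qed
qed

text \<open>The condition on the modulus is open, so it holds eventually along an approximating
  sequence; the inequalities are closed and survive the limit.\<close>

lemma attainable_bounds:
  assumes a: "attainable \<mu>" and n4: "norm (fourier \<mu> 4) > 1 / 3"
  shows "fourier \<mu> 4 \<in> \<real> \<and> fourier \<mu> 8 \<in> \<real> \<and>
            2 * (Re (fourier \<mu> 4))\<^sup>2 - 1 \<le> Re (fourier \<mu> 8) \<and>
            Re (fourier \<mu> 8) \<le> M_bound (Re (fourier \<mu> 4))"
proof -
  obtain n where n: "\<And>j. n j \<in> two_squares" and w: "circle_weak_conv (\<lambda>j. mu (n j)) \<mu>"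
    and cp: "circle_prob \<mu>" using a by (auto simp: attainable_def)
  define m where "m = (\<lambda>j. nat (n j))"
  have nm: "n j = int (m j)" for j using two_squares_pos[OF n, of j] by (simp add: m_def)
  have m0: "m j > 0" for j using two_squares_pos[OF n, of j] by (simp add: m_def)
  have h0: "hcoeff 0 (m j) > 0" for j using two_squares_iff_hcoeff[OF m0] n[of j] nm by metis
  have f: "fourier (mu (n j)) (4 * int k) = of_real (ratio k (m j))" for j k
    using fourier_mu[of "m j" k] n[of j] unfolding nm ratio_def by simp
  have lim: "(\<lambda>j. of_real (ratio k (m j))) \<longlonglongrightarrow> fourier \<mu> (4 * int k)" for k
    using circle_weak_conv_fourier[OF w cp circle_prob_mu[OF n], of "4 * int k"] unfolding f .
  have re: "fourier \<mu> (4 * int k) \<in> \<real>" for k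
    using closed_sequentially[OF closed_complex_Reals _ lim, of k] by simp
  define x y where "x = Re (fourier \<mu> 4)" and "y = Re (fourier \<mu> 8)"
  have X: "(\<lambda>j. ratio 1 (m j)) \<longlonglongrightarrow> x" and Y: "(\<lambda>j. ratio 2 (m j)) \<longlonglongrightarrow> y"
    using tendsto_Re[OF lim[of 1]] tendsto_Re[OF lim[of 2]] by (simp_all add: x_def y_def)
  have "fourier \<mu> 4 = of_real x" using re[of 1] by (simp add: x_def of_real_Re)
  then have x3: "\<bar>x\<bar> > 1 / 3" using n4 by simp
  have "(\<lambda>j. \<bar>ratio 1 (m j)\<bar>) \<longlonglongrightarrow> \<bar>x\<bar>" by (intro tendsto_intros X)
  then have ev: "eventually (\<lambda>j. \<bar>ratio 1 (m j)\<bar> > 1 / 3) sequentially"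
    using x3 by (rule order_tendstoD)
  have "2 * x\<^sup>2 - 1 \<le> y"
    using ratio_lower_bound[OF m0 h0]
    by (intro tendsto_le[OF _ Y, of "\<lambda>j. 2 * (ratio 1 (m j))\<^sup>2 - 1"] tendsto_intros X) (auto intro: always_eventually)
  moreover have "y \<le> M_bound x"
  proof (rule tendsto_le[OF _ _ Y])
    show "(\<lambda>j. M_bound (ratio 1 (m j))) \<longlonglongrightarrow> M_bound x"
      unfolding M_bound_def by (intro tendsto_intros X)
    show "eventually (\<lambda>j. ratio 2 (m j) \<le> M_bound (ratio 1 (m j))) sequentially"
      using ev by eventually_elim (use ratio_upper_bound[OF m0 h0] in auto)
  qed simp
  ultimately show ?thesis using re[of 1] re[of 2] by (simp add: x_def y_def)
qed

section \<open>The Hecke L-series near 1\<close>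

lemma infsum_diff_banach:
  fixes f g :: "'a \<Rightarrow> 'b :: banach"
  assumes "f summable_on A" "g summable_on A"
  shows "(\<lambda>x. f x - g x) summable_on A" "(\<Sum>\<^sub>\<infinity>x\<in>A. f x - g x) = infsum f A - infsum g A"
  using infsum_add[OF assms(1) summable_on_uminus[THEN iffD2, OF assms(2)]]
    summable_on_add[OF assms(1) summable_on_uminus[THEN iffD2, OF assms(2)]]
  by (simp_all add: infsum_uminus)

lemma summable_on_int_powr:
  fixes q :: real
  assumes "q > 1"
  shows "(\<lambda>a::int. (1 + \<bar>of_int a\<bar>) powr (- q)) summable_on UNIV"
proof -
  have "summable (\<lambda>n. real n powr (- q))" using assms by (simp add: summable_real_powr_iff)
  then have "summable (\<lambda>n. real (Suc n) powr (- q))" by (subst summable_Suc_iff)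
  then have s: "(\<lambda>n. real (Suc n) powr (- q)) summable_on UNIV"
    by (rule summable_nonneg_imp_summable_on) simp
  let ?f = "\<lambda>a::int. (1 + \<bar>of_int a\<bar>) powr (- q)"
  have "?f summable_on range int" "?f summable_on range (\<lambda>n. - int n)"
    using s by (auto simp: summable_on_reindex inj_on_def o_def add.commute)
  then have "?f summable_on (range int \<union> range (\<lambda>n. - int n))"
    by (rule summable_on_union)
  also have "range int \<union> range (\<lambda>n. - int n) = UNIV"
  proof (intro set_eqI iffI UNIV_I)
    fix a :: int
    show "a \<in> range int \<union> range (\<lambda>n. - int n)" by (cases a rule: int_cases2) auto
  qed
  finally show ?thesis .
qed

lemma gauss_norm_ge_1:
  assumes "z \<in> gauss" "z \<noteq> 0"
  shows "1 \<le> cmod z"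
proof -
  obtain a b where z: "z = of_int a + \<i> * of_int b" using assms(1) by (auto elim: gaussE)
  have "a \<noteq> 0 \<or> b \<noteq> 0" using assms(2) z by auto
  then have "\<bar>real_of_int a\<bar> \<ge> 1 \<or> \<bar>real_of_int b\<bar> \<ge> 1" by linarith
  moreover have "\<bar>real_of_int a\<bar> \<le> cmod z" "\<bar>real_of_int b\<bar> \<le> cmod z"
    using abs_Re_le_cmod[of z] abs_Im_le_cmod[of z] z by auto
  ultimately show ?thesis by linarith
qed

text \<open>For nonzero z = a + ib both 1 + |a| and 1 + |b| are at most 2|z|, so |z|^(-r) is at most
  2^r times a product of one-variable terms with exponent r/2 > 1.\<close>

lemma summable_on_gauss_powr:
  fixes r :: real
  assumes "r > 2"
  shows "(\<lambda>z. cmod z powr (- r)) summable_on gauss"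
proof -
  let ?g = "\<lambda>a::int. (1 + \<bar>of_int a\<bar>) powr (- (r / 2))"
  define f where "f = (\<lambda>(a::int, b::int). of_int a + \<i> * of_int b :: complex)"
  have g: "?g summable_on UNIV" using assms by (intro summable_on_int_powr) simp
  have "(\<lambda>(a, b). ?g a * ?g b) summable_on (UNIV \<times> UNIV)"
  proof (rule summable_on_SigmaI)
    fix a :: int
    show "((\<lambda>b. case (a, b) of (a, b) \<Rightarrow> ?g a * ?g b) has_sum (?g a * infsum ?g UNIV)) UNIV"
      using g by (simp add: has_sum_cmult_right)
    show "(\<lambda>a. ?g a * infsum ?g UNIV) summable_on UNIV"
      using g by (rule summable_on_cmult_left)
  qed auto
  then have "(\<lambda>p. 2 powr r * (case p of (a, b) \<Rightarrow> ?g a * ?g b)) summable_on UNIV"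
    by (intro summable_on_cmult_right) simp
  then have "(\<lambda>p. cmod (f p) powr (- r)) summable_on UNIV"
  proof (rule summable_on_comparison_test)
    fix p :: "int \<times> int"
    obtain a b where p: "p = (a, b)" by force
    show "cmod (f p) powr (- r) \<le> 2 powr r * (case p of (a, b) \<Rightarrow> ?g a * ?g b)"
    proof (cases "f p = 0")
      case True then show ?thesis by (auto simp: split_beta)
    next
      case False
      have n1: "1 \<le> cmod (f p)" using False by (intro gauss_norm_ge_1) (auto simp: f_def gaussI split_beta)
      have ab: "\<bar>real_of_int a\<bar> \<le> cmod (f p)" "\<bar>real_of_int b\<bar> \<le> cmod (f p)"
        using abs_Re_le_cmod[of "f p"] abs_Im_le_cmod[of "f p"] by (auto simp: f_def p)
      have *: "(2 * cmod (f p)) powr (- (r / 2)) \<le> ?g a" if "\<bar>real_of_int a\<bar> \<le> cmod (f p)" for a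
        using that n1 assms by (intro powr_mono2') auto
      have "cmod (f p) powr (- r) = 2 powr r * ((2 * cmod (f p)) powr (- (r / 2)) * (2 * cmod (f p)) powr (- (r / 2)))"
      proof -
        have "(2 * cmod (f p)) powr (- (r / 2)) * (2 * cmod (f p)) powr (- (r / 2)) = (2 * cmod (f p)) powr (- r)"
          by (simp flip: powr_add)
        also have "\<dots> = 2 powr (- r) * cmod (f p) powr (- r)" by (simp add: powr_mult)
        finally show ?thesis by (simp add: powr_minus)
      qed
      also have "\<dots> \<le> 2 powr r * (?g a * ?g b)"
        using * ab by (intro mult_left_mono mult_mono) auto
      finally show ?thesis by (simp add: p)
    qed
  qed auto
  then have "(\<lambda>z. cmod z powr (- r)) summable_on range f"
    by (subst summable_on_reindex) (auto simp: inj_on_def f_def complex_eq_iff o_def)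
  also have "range f = gauss" by (auto simp: f_def gauss_def)
  finally show ?thesis .
qed

text \<open>Since \<open>0 powr a = 0\<close>, the origin does not contribute.\<close>

definition lat :: "nat \<Rightarrow> real \<Rightarrow> complex \<Rightarrow> complex" where
  "lat k s z = xi k z * of_real (cmod z powr (- (2 * s)))"

lemma lat_0 [simp]: "lat k s 0 = 0"
  by (simp add: lat_def)

lemma norm_lat: "cmod (lat k s z) = cmod z powr (- (2 * s))"
  by (cases "z = 0") (auto simp: lat_def norm_mult norm_xi)

lemma lat_mult: "lat k s (z * w) = lat k s z * lat k s w"
  by (simp add: lat_def xi_mult norm_mult powr_mult)

lemma lat_unit:
  assumes "u \<in> {1, -1, \<i>, -\<i>}"
  shows "lat k s u = 1"
  using assms by (auto simp: lat_def xi_def power_mult sgn_eq)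

lemma lat_abs_summable: "s > 1 \<Longrightarrow> (\<lambda>z. cmod (lat k s z)) summable_on gauss"
  using summable_on_gauss_powr[of "2 * s"] by (simp add: norm_lat)

lemma lat_summable: "s > 1 \<Longrightarrow> lat k s summable_on gauss"
  by (rule abs_summable_summable[OF lat_abs_summable])

definition Lser :: "nat \<Rightarrow> real \<Rightarrow> complex" where
  "Lser k s = infsum (lat k s) gauss"

text \<open>Zero and the units form a complete residue system modulo \<open>2 + \<i>\<close>, which
  has norm 5. Two of them differ by at most 2 in modulus, less than |2 + i|, so they are
  incongruent.\<close>

lemma gauss_residues:
  "bij_betw (\<lambda>(r, z). (2 + \<i>) * z + r) ({0, 1, -1, \<i>, -\<i>} \<times> gauss) gauss"
proof (rule bij_betwI')
  let ?R = "{0, 1, -1, \<i>, -\<i>}"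
  fix x y assume x: "x \<in> ?R \<times> gauss" and y: "y \<in> ?R \<times> gauss"
  obtain r z where xr: "x = (r, z)" by force
  obtain q w where yq: "y = (q, w)" by force
  have rq: "r \<in> ?R" "q \<in> ?R" "z \<in> gauss" "w \<in> gauss" using x y xr yq by auto
  have "z = w \<and> r = q" if eq: "(2 + \<i>) * z + r = (2 + \<i>) * w + q"
  proof -
    have "(2 + \<i>) * (z - w) = q - r" using eq by (simp add: algebra_simps)
    then have "cmod (2 + \<i>) * cmod (z - w) = cmod (q - r)" by (metis norm_mult)
    moreover have "cmod (q - r) \<le> cmod q + cmod r" by (rule norm_triangle_ineq4)
    moreover have "cmod q \<le> 1" "cmod r \<le> 1" using rq by auto
    moreover have "cmod (2 + \<i>) > 2" by (auto simp: cmod_def intro!: real_less_rsqrt)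
    moreover have "cmod (2 + \<i>) * 1 \<le> cmod (2 + \<i>) * cmod (z - w)" if "cmod (z - w) \<ge> 1"
      using that by (intro mult_left_mono) auto
    ultimately have "\<not> 1 \<le> cmod (z - w)" by linarith
    then have "z - w = 0" using gauss_norm_ge_1[of "z - w"] gauss_closed(3)[of z w] rq by blast
    then show ?thesis using eq by simp
  qed
  then show "((case x of (r, z) \<Rightarrow> (2 + \<i>) * z + r) = (case y of (r, z) \<Rightarrow> (2 + \<i>) * z + r)) = (x = y)"
    by (auto simp: xr yq)
next
  fix x assume "x \<in> {0, 1, -1, \<i>, -\<i>} \<times> gauss"
  then show "(case x of (r, z) \<Rightarrow> (2 + \<i>) * z + r) \<in> gauss"
    by (auto simp: gauss_iff)
next
  fix z assume "z \<in> gauss"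
  then obtain a b where z: "z = of_int a + \<i> * of_int b" by (auto elim: gaussE)
  have main: "\<exists>x\<in>{0, 1, -1, \<i>, -\<i>} \<times> gauss. z = (case x of (r, z) \<Rightarrow> (2 + \<i>) * z + r)"
    if r: "r \<in> {0, 1, -1, \<i>, -\<i>}" "r = of_int c + \<i> * of_int d" "(a - 2 * b) - (c - 2 * d) = 5 * q" for c d q :: int and r
  proof -
    define w where "w = of_int (b - d + 2 * q) + \<i> * of_int (- q)"
    have "a = 2 * (b - d + 2 * q) + q + c" using r(3) by simp
    then have "z = (2 + \<i>) * w + r" by (simp add: z r(2) w_def complex_eq_iff)
    moreover have "w \<in> gauss" unfolding w_def by (rule gaussI)
    ultimately show ?thesis using r(1) by (intro bexI[of _ "(r, w)"]) simp_all
  qed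
  \<comment> \<open>Modulo 2 + i the unit i equals -2, so the class of a + ib is a - 2b modulo 5;
    the units 1, -i, i, -1 have the residues 1, 2, 3, 4.\<close>
  define q where "q = (a - 2 * b) div 5"
  have "(a - 2 * b) mod 5 \<in> {0, 1, 2, 3, 4}" 
    using pos_mod_bound[of 5 "a - 2 * b"] pos_mod_sign[of 5 "a - 2 * b"] by auto
  moreover have "a - 2 * b = 5 * q + (a - 2 * b) mod 5" by (simp add: q_def)
  ultimately consider "a - 2 * b = 5 * q" | "a - 2 * b = 5 * q + 1" | "a - 2 * b = 5 * q + 2" 
    | "a - 2 * b = 5 * q + 3" | "a - 2 * b = 5 * q + 4" by force
  then show "\<exists>x\<in>{0, 1, -1, \<i>, -\<i>} \<times> gauss. z = (case x of (r, z) \<Rightarrow> (2 + \<i>) * z + r)"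
  proof cases
    case 1 then show ?thesis by (intro main[of 0 0 0 q]) auto
  next
    case 2 then show ?thesis by (intro main[of 1 1 0 q]) auto
  next
    case 3 then show ?thesis by (intro main[of "-\<i>" 0 "-1" q]) auto
  next
    case 4 then show ?thesis by (intro main[of "\<i>" 0 1 "q + 1"]) auto
  next
    case 5 then show ?thesis by (intro main[of "-1" "-1" 0 "q + 1"]) auto
  qed
qed

lemma lat_shift_summable:
  assumes "s > 1" "r \<in> gauss"
  shows "(\<lambda>z. lat k s ((2 + \<i>) * z + r)) summable_on gauss"
proof -
  have nz: "2 + \<i> \<noteq> 0" by (simp add: complex_eq_iff)
  have "lat k s summable_on (\<lambda>z. (2 + \<i>) * z + r) ` gauss"
    using assms by (intro summable_on_subset_banach[OF lat_summable[OF assms(1)]])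
      (auto simp: gauss_iff)
  then show ?thesis using nz by (subst (asm) summable_on_reindex) (auto simp: inj_on_def o_def)
qed

lemma unit_gauss: "u \<in> {0, 1, -1, \<i>, -\<i>} \<Longrightarrow> u \<in> gauss"
  by (auto simp: gauss_iff)

text \<open>The unit factors out of its class,
  \<open>(2 + \<i>) * z + u = u * ((2 + \<i>) * (z / u) + 1)\<close>, and \<open>lat\<close> ignores
  units.\<close>

lemma lat_shift_unit:
  assumes s: "s > 1" and u: "u \<in> {1, -1, \<i>, -\<i>}"
  shows "(\<Sum>\<^sub>\<infinity>z\<in>gauss. lat k s ((2 + \<i>) * z + u)) = (\<Sum>\<^sub>\<infinity>z\<in>gauss. lat k s ((2 + \<i>) * z + 1))"
proof (rule infsum_reindex_bij_witness[of _ "\<lambda>z. u * z" "\<lambda>z. z / u"])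
  fix z assume z: "z \<in> gauss"
  show "z / u \<in> gauss" "u * z \<in> gauss" using u z by (auto simp: gauss_iff)
  have "lat k s ((2 + \<i>) * z + u) = lat k s (u * ((2 + \<i>) * (z / u) + 1))"
    using u by (auto simp: algebra_simps)
  also have "\<dots> = lat k s ((2 + \<i>) * (z / u) + 1)" by (simp add: lat_mult lat_unit[OF u])
  finally show "lat k s ((2 + \<i>) * (z / u) + 1) = lat k s ((2 + \<i>) * z + u)" ..
qed (use u in auto)

text \<open>A difference over a bounded shift decays one power of |z| faster than its terms; this
  gives convergence at s = 1.\<close>

definition Ldiff :: "nat \<Rightarrow> real \<Rightarrow> complex \<Rightarrow> complex" where
  "Ldiff k s z = lat k s ((2 + \<i>) * z + 1) - lat k s ((2 + \<i>) * z)"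

lemma norm_two_plus_i: "cmod (2 + \<i>) = sqrt 5"
  by (simp add: cmod_def)

lemma lat_two_plus_i: "lat k s (2 + \<i>) = xi k (2 + \<i>) * of_real (5 powr (- s))"
proof -
  have "cmod (2 + \<i>) = 5 powr (1 / 2)" unfolding norm_two_plus_i by (simp add: powr_half_sqrt)
  then show ?thesis by (simp add: lat_def powr_powr)
qed

text \<open>Splitting the lattice into the five residue classes modulo \<open>2 + \<i>\<close> yields the
  continuation of the series to the left of \<open>s = 1\<close>.\<close>

lemma Lser_functional:
  assumes s: "s > 1"
  shows "Lser k s * (1 - xi k (2 + \<i>) * of_real (5 powr (1 - s))) = 4 * infsum (Ldiff k s) gauss"
proof -
  let ?R = "{0, 1, -1, \<i>, -\<i>}"
  let ?S = "\<lambda>r. \<Sum>\<^sub>\<infinity>z\<in>gauss. lat k s ((2 + \<i>) * z + r)"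
  have "(lat k s has_sum Lser k s) gauss" using lat_summable[OF s] by (simp add: Lser_def)
  then have "((\<lambda>p. lat k s (case p of (r, z) \<Rightarrow> (2 + \<i>) * z + r)) has_sum Lser k s) (?R \<times> gauss)"
    by (subst has_sum_reindex_bij_betw[OF gauss_residues])
  then have "(?S has_sum Lser k s) ?R"
    by (rule has_sum_SigmaD) (use lat_shift_summable[OF s unit_gauss] in auto)
  then have "Lser k s = sum ?S ?R"
    using has_sum_finite[of ?R ?S] has_sum_unique by blast
  also have "\<dots> = ?S 0 + ?S 1 + ?S (-1) + ?S \<i> + ?S (- \<i>)"
    by (simp add: complex_eq_iff)
  also have "\<dots> = ?S 0 + 4 * ?S 1"
    using lat_shift_unit[OF s, of "-1" k] lat_shift_unit[OF s, of \<i> k] lat_shift_unit[OF s, of "-\<i>" k] by simp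
  \<comment> \<open>The class of 0 is 2 + i times the whole lattice, so \<open>?S 0\<close> is
    \<open>Lser k s\<close> times a factor of modulus 5^(-s); five copies of it produce the
    5^(1-s).\<close>
  also have "\<dots> = 5 * ?S 0 + 4 * (?S 1 - ?S 0)" by simp
  also have "?S 1 - ?S 0 = infsum (Ldiff k s) gauss"
    unfolding Ldiff_def using lat_shift_summable[OF s unit_gauss, of 1 k] lat_shift_summable[OF s unit_gauss, of 0 k]
    by (subst infsum_diff_banach) auto
  also have "?S 0 = lat k s (2 + \<i>) * Lser k s"
    unfolding Lser_def using lat_summable[OF s] by (simp add: lat_mult infsum_cmult_right)
  finally have "Lser k s = 5 * (lat k s (2 + \<i>) * Lser k s) + 4 * infsum (Ldiff k s) gauss" .
  then have "Lser k s - Lser k s * (5 * (xi k (2 + \<i>) * of_real (5 powr (- s)))) = 4 * infsum (Ldiff k s) gauss"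
    unfolding lat_two_plus_i by algebra
  moreover have "5 powr (1 - s) = 5 * 5 powr (- s)" by (simp add: powr_diff powr_minus divide_inverse)
  ultimately show ?thesis by (simp add: right_diff_distrib mult_ac)
qed

section \<open>Lipschitz estimates in the variable s\<close>

lemma ln_le_two_sqrt:
  fixes r :: real
  assumes "r \<ge> 1"
  shows "ln r \<le> 2 * r powr (1 / 2)"
proof -
  have "ln r = 2 * ln (r powr (1 / 2))" using assms by (simp add: ln_powr)
  also have "\<dots> \<le> 2 * r powr (1 / 2)" using assms ln_le_minus_one[of "r powr (1 / 2)"] by simp
  finally show ?thesis .
qed

text \<open>Differentiation in s produces ln r, which is paid for with half a power of r: the
  exponent -2 becomes -3/2.\<close>

lemma powr_exponent_lipschitz:
  fixes r s t :: real
  assumes r: "r \<ge> 1" and st: "1 \<le> s" "1 \<le> t"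
  shows "\<bar>r powr (- (2 * s)) - r powr (- (2 * t))\<bar> \<le> 4 * r powr (- (3 / 2)) * \<bar>s - t\<bar>"
proof -
  have "norm (r powr (- (2 * s)) - r powr (- (2 * t))) \<le> 4 * r powr (- (3 / 2)) * norm (s - t)"
  proof (rule field_differentiable_bound[of "{1..}"])
    fix x :: real assume x: "x \<in> {1..}"
    have "((\<lambda>x. exp (- (2 * x) * ln r)) has_field_derivative (- 2 * ln r * exp (- (2 * x) * ln r))) (at x within {1..})"
      by (auto intro!: derivative_eq_intros)
    then show "((\<lambda>x. r powr (- (2 * x))) has_field_derivative (- 2 * ln r * r powr (- (2 * x)))) (at x within {1..})"
      using r by (simp add: powr_def)
    have "norm (- 2 * ln r * r powr (- (2 * x))) = 2 * ln r * r powr (- (2 * x))"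
      using r by (simp add: abs_mult)
    also have "\<dots> \<le> 2 * (2 * r powr (1 / 2)) * r powr (- 2)"
      using r x ln_le_two_sqrt[OF r] by (intro mult_mono powr_mono) auto
    also have "\<dots> = 4 * (r powr (1 / 2) * r powr (- 2))" by simp
    also have "\<dots> = 4 * r powr (- (3 / 2))" by (simp flip: powr_add)
    finally show "norm (- 2 * ln r * r powr (- (2 * x))) \<le> 4 * r powr (- (3 / 2))" .
  qed (use st in auto)
  then show ?thesis by simp
qed

text \<open>A mixed derivative bound: up to sign, the left side is the r-derivative of the
  difference in \<open>powr_exponent_lipschitz\<close>. The exponent 5/2 exceeds 2, the threshold of
  summability over the lattice.\<close>

lemma powr_exponent_deriv_lipschitz:
  fixes r s t :: real
  assumes r: "r \<ge> 1" and st: "s \<in> {1..2}" "t \<in> {1..2}"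
  shows "\<bar>2 * s * r powr (- (2 * s) - 1) - 2 * t * r powr (- (2 * t) - 1)\<bar> 
    \<le> 18 * r powr (- (5 / 2)) * \<bar>s - t\<bar>"
proof -
  have "norm (2 * s * r powr (- (2 * s) - 1) - 2 * t * r powr (- (2 * t) - 1)) \<le> 18 * r powr (- (5 / 2)) * norm (s - t)"
  proof (rule field_differentiable_bound[of "{1..2}"])
    fix x :: real assume x: "x \<in> {1..2}"
    let ?p = "r powr (- (2 * x) - 1)"
    have "((\<lambda>x. 2 * x * exp ((- (2 * x) - 1) * ln r)) has_field_derivative 
        ((2 - 4 * x * ln r) * exp ((- (2 * x) - 1) * ln r))) (at x within {1..2})"
      by (auto intro!: derivative_eq_intros simp: algebra_simps)
    then show "((\<lambda>x. 2 * x * r powr (- (2 * x) - 1)) has_field_derivative (2 - 4 * x * ln r) * ?p) (at x within {1..2})"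
      using r by (simp add: powr_def)
    have "0 \<le> x * ln r" using r x by simp
    moreover have "x * ln r \<le> 2 * (2 * r powr (1 / 2))"
      using r x ln_le_two_sqrt[OF r] by (intro mult_mono) auto
    moreover have "r powr (1 / 2) \<ge> 1" using r by (simp add: ge_one_powr_ge_zero)
    \<comment> \<open>18 = 2 + 4 * 4, since x <= 2 and ln r is at most twice the root of r.\<close>
    ultimately have "\<bar>2 - 4 * x * ln r\<bar> \<le> 18 * r powr (1 / 2)" by linarith
    moreover have "?p \<le> r powr (- 3)" using r x by (intro powr_mono) auto
    ultimately have "norm ((2 - 4 * x * ln r) * ?p) \<le> 18 * r powr (1 / 2) * r powr (- 3)"
      unfolding norm_mult by (intro mult_mono) auto
    also have "\<dots> = 18 * (r powr (1 / 2) * r powr (- 3))" by simp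
    also have "\<dots> = 18 * r powr (- (5 / 2))" by (simp flip: powr_add)
    finally show "norm ((2 - 4 * x * ln r) * ?p) \<le> 18 * r powr (- (5 / 2))" .
  qed (use st in auto)
  then show ?thesis by simp
qed

lemma powr_diff_lipschitz:
  fixes u v m s t :: real
  assumes m: "1 \<le> m" "m \<le> u" "m \<le> v" and uv: "\<bar>u - v\<bar> \<le> 1" and st: "s \<in> {1..2}" "t \<in> {1..2}"
  shows "\<bar>(u powr (- (2 * s)) - u powr (- (2 * t))) - (v powr (- (2 * s)) - v powr (- (2 * t)))\<bar>
     \<le> 18 * m powr (- (5 / 2)) * \<bar>s - t\<bar>"
proof -
  let ?h = "\<lambda>r. r powr (- (2 * s)) - r powr (- (2 * t))"
  have "norm (?h u - ?h v) \<le> (18 * m powr (- (5 / 2)) * \<bar>s - t\<bar>) * norm (u - v)"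
  proof (rule field_differentiable_bound[of "{m..}"])
    fix r assume r: "r \<in> {m..}"
    let ?d = "2 * s * r powr (- (2 * s) - 1) - 2 * t * r powr (- (2 * t) - 1)"
    show "(?h has_field_derivative - ?d) (at r within {m..})"
      using r m by (auto intro!: derivative_eq_intros)
    have "norm (- ?d) \<le> 18 * r powr (- (5 / 2)) * \<bar>s - t\<bar>"
      using powr_exponent_deriv_lipschitz[of r s t] r m st by simp
    also have "\<dots> \<le> 18 * m powr (- (5 / 2)) * \<bar>s - t\<bar>"
      using r m by (intro mult_right_mono mult_left_mono powr_mono2') auto
    finally show "norm (- ?d) \<le> 18 * m powr (- (5 / 2)) * \<bar>s - t\<bar>" .
  qed (use m in auto)
  also have "\<dots> \<le> (18 * m powr (- (5 / 2)) * \<bar>s - t\<bar>) * 1"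
    using uv by (intro mult_left_mono) auto
  finally show ?thesis by simp
qed

lemma norm_power_diff_unit:
  fixes a b :: complex
  assumes "cmod a \<le> 1" "cmod b \<le> 1"
  shows "cmod (a ^ n - b ^ n) \<le> real n * cmod (a - b)"
  using norm_power_diff[OF assms] by simp

lemma sgn_diff_bound:
  fixes z w :: complex
  assumes "z \<noteq> 0" "w \<noteq> 0"
  shows "cmod (sgn w - sgn z) \<le> 2 * cmod (w - z) / cmod z"
proof -
  have "sgn w - sgn z = (sgn w * of_real (cmod z - cmod w) + (w - z)) / of_real (cmod z)"
    using assms by (simp add: sgn_eq field_simps)
  then have "cmod (sgn w - sgn z) = cmod (sgn w * of_real (cmod z - cmod w) + (w - z)) / cmod z"
    by (simp add: norm_divide)
  also have "\<dots> \<le> (cmod (sgn w * of_real (cmod z - cmod w)) + cmod (w - z)) / cmod z"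
    by (intro divide_right_mono norm_triangle_ineq) auto
  also have "cmod (sgn w * of_real (cmod z - cmod w)) = \<bar>cmod w - cmod z\<bar>"
    using assms by (simp add: norm_mult norm_sgn abs_minus_commute del: of_real_diff)
  also have "(\<bar>cmod w - cmod z\<bar> + cmod (w - z)) / cmod z \<le> (cmod (w - z) + cmod (w - z)) / cmod z"
    using norm_triangle_ineq3[of w z] by (intro divide_right_mono) auto
  finally show ?thesis by simp
qed

lemma xi_diff_bound:
  assumes "z \<noteq> 0" "w \<noteq> 0"
  shows "cmod (xi k w - xi k z) \<le> 8 * real k * cmod (w - z) / cmod z"
proof -
  have "cmod (xi k w - xi k z) \<le> real (4 * k) * cmod (sgn w - sgn z)"
    unfolding xi_def using assms by (intro norm_power_diff_unit) (auto simp: norm_sgn)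
  also have "\<dots> \<le> real (4 * k) * (2 * cmod (w - z) / cmod z)"
    by (intro mult_left_mono sgn_diff_bound assms) auto
  finally show ?thesis by (simp add: mult_ac)
qed

text \<open>A discrete product rule: the variation of \<open>xi\<close>, of order 1/|z|, meets a
  radial term of order |z|^(-3/2), and the mixed difference of the radial part is of order
  |z|^(-5/2).\<close>

lemma Ldiff_lipschitz:
  assumes z: "z \<in> gauss" "z \<noteq> 0" and st: "s \<in> {1..2}" "t \<in> {1..2}"
  shows "cmod (Ldiff k s z - Ldiff k t z) \<le> (16 * real k + 18) * cmod z powr (- (5 / 2)) * \<bar>s - t\<bar>"
proof -
  define a b m where "a = (2 + \<i>) * z" and "b = (2 + \<i>) * z + 1" and "m = cmod z"
  have m: "m \<ge> 1" using gauss_norm_ge_1[OF z] by (simp add: m_def)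
  have "sqrt 5 \<ge> 2" by (rule real_le_rsqrt) simp
  then have a2: "cmod a \<ge> 2 * m" unfolding a_def norm_mult norm_two_plus_i m_def by (intro mult_right_mono) auto
  have ab: "cmod (b - a) = 1" by (simp add: a_def b_def)
  have "cmod a \<le> cmod b + 1" using norm_triangle_ineq4[of b "b - a"] ab by simp
  then have b2: "cmod b \<ge> m" using a2 m by linarith
  have nz: "a \<noteq> 0" "b \<noteq> 0" using a2 b2 m by auto
  define h where "h = (\<lambda>r. r powr (- (2 * s)) - r powr (- (2 * t)))"
  have "Ldiff k s z - Ldiff k t z = (xi k b - xi k a) * of_real (h (cmod b)) + xi k a * of_real (h (cmod b) - h (cmod a))"
    by (simp add: Ldiff_def lat_def a_def b_def h_def algebra_simps)
  then have "cmod (Ldiff k s z - Ldiff k t z) \<le> cmod (xi k b - xi k a) * \<bar>h (cmod b)\<bar> + \<bar>h (cmod b) - h (cmod a)\<bar>"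
    using norm_triangle_ineq[of "(xi k b - xi k a) * of_real (h (cmod b))" "xi k a * of_real (h (cmod b) - h (cmod a))"]
    by (simp add: norm_mult norm_xi nz flip: of_real_diff)
  also have "\<bar>h (cmod b) - h (cmod a)\<bar> \<le> 18 * m powr (- (5 / 2)) * \<bar>s - t\<bar>"
    unfolding h_def using m a2 b2 st ab norm_triangle_ineq3[of b a]
    by (intro powr_diff_lipschitz) auto
  also have "cmod (xi k b - xi k a) * \<bar>h (cmod b)\<bar> \<le> (4 * real k / m) * (4 * m powr (- (3 / 2)) * \<bar>s - t\<bar>)"
  proof (rule mult_mono)
    have "cmod (xi k b - xi k a) \<le> 8 * real k / cmod a" using xi_diff_bound[OF nz, of k] ab by simp
    also have "\<dots> \<le> 8 * real k / (2 * m)" using a2 m nz by (intro divide_left_mono mult_pos_pos) auto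
    finally show "cmod (xi k b - xi k a) \<le> 4 * real k / m" by simp
    have "\<bar>h (cmod b)\<bar> \<le> 4 * cmod b powr (- (3 / 2)) * \<bar>s - t\<bar>"
      unfolding h_def using b2 m st by (intro powr_exponent_lipschitz) auto
    also have "\<dots> \<le> 4 * m powr (- (3 / 2)) * \<bar>s - t\<bar>"
      using b2 m by (intro mult_right_mono mult_left_mono powr_mono2') auto
    finally show "\<bar>h (cmod b)\<bar> \<le> 4 * m powr (- (3 / 2)) * \<bar>s - t\<bar>" .
  qed (use m in auto)
  also have "(4 * real k / m) * (4 * m powr (- (3 / 2)) * \<bar>s - t\<bar>) = 16 * real k * (m powr (- (3 / 2)) / m) * \<bar>s - t\<bar>"
    by simp
  also have "m powr (- (3 / 2)) / m = m powr (- (5 / 2))"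
    using m powr_diff[of m "- (3 / 2)" 1] by simp
  finally show ?thesis by (simp add: m_def algebra_simps)
qed

text \<open>The value does not depend on s, so the origin, which \<open>Ldiff_lipschitz\<close>
  excludes, drops out of differences in s.\<close>

lemma Ldiff_0: "Ldiff k s 0 = 1"
  by (simp add: Ldiff_def lat_unit)

lemma Ldiff_diff_summable:
  assumes st: "s \<in> {1..2}" "t \<in> {1..2}"
  shows "(\<lambda>z. cmod (Ldiff k s z - Ldiff k t z)) summable_on gauss"
    and "(\<Sum>\<^sub>\<infinity>z\<in>gauss. cmod (Ldiff k s z - Ldiff k t z))
       \<le> (16 * real k + 18) * (\<Sum>\<^sub>\<infinity>z\<in>gauss. cmod z powr (- (5 / 2))) * \<bar>s - t\<bar>"
proof -
  let ?g = "\<lambda>z. (16 * real k + 18) * cmod z powr (- (5 / 2)) * \<bar>s - t\<bar>"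
  have s: "(\<lambda>z. cmod z powr (- (5 / 2))) summable_on gauss" by (rule summable_on_gauss_powr) simp
  then have g: "?g summable_on gauss"
    by (intro summable_on_cmult_left summable_on_cmult_right)
  have le: "cmod (Ldiff k s z - Ldiff k t z) \<le> ?g z" if "z \<in> gauss" for z
    using Ldiff_lipschitz[OF that _ st] by (cases "z = 0") (auto simp: Ldiff_0)
  show 1: "(\<lambda>z. cmod (Ldiff k s z - Ldiff k t z)) summable_on gauss"
    using le by (intro summable_on_comparison_test[OF g]) auto
  have "(\<Sum>\<^sub>\<infinity>z\<in>gauss. cmod (Ldiff k s z - Ldiff k t z)) \<le> infsum ?g gauss"
    using le by (intro infsum_mono 1 g) auto
  also have "\<dots> = (16 * real k + 18) * (\<Sum>\<^sub>\<infinity>z\<in>gauss. cmod z powr (- (5 / 2))) * \<bar>s - t\<bar>"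
    using s by (subst infsum_cmult_left infsum_cmult_right; (intro summable_on_cmult_right)?; simp)+
  finally show "(\<Sum>\<^sub>\<infinity>z\<in>gauss. cmod (Ldiff k s z - Ldiff k t z))
       \<le> (16 * real k + 18) * (\<Sum>\<^sub>\<infinity>z\<in>gauss. cmod z powr (- (5 / 2))) * \<bar>s - t\<bar>" .
qed

text \<open>At s = 1 the two halves of \<open>Ldiff\<close> diverge separately. Summability is taken
  from s = 2, where both converge, and carried over by the summable differences in s.\<close>

lemma Ldiff_summable:
  assumes "s \<in> {1..2}"
  shows "Ldiff k s summable_on gauss"
proof -
  have "Ldiff k 2 summable_on gauss"
    unfolding Ldiff_def using lat_shift_summable[of 2 1 k] lat_shift_summable[of 2 0 k]
    by (intro infsum_diff_banach) (auto simp: unit_gauss)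
  moreover have "(\<lambda>z. Ldiff k s z - Ldiff k 2 z) summable_on gauss"
    by (rule abs_summable_summable[OF Ldiff_diff_summable(1)[OF assms]]) simp
  ultimately have "(\<lambda>z. Ldiff k 2 z + (Ldiff k s z - Ldiff k 2 z)) summable_on gauss"
    by (rule summable_on_add)
  then show ?thesis by simp
qed

text \<open>The numerator of \<open>Lser\<close> in \<open>Lser_mult_eq\<close>; its series still
  converges at s = 1.\<close>

definition Lnum :: "nat \<Rightarrow> real \<Rightarrow> complex" where
  "Lnum k s = 4 * infsum (Ldiff k s) gauss"

lemma Lnum_lipschitz:
  obtains C where "\<And>s t. s \<in> {1..2} \<Longrightarrow> t \<in> {1..2} \<Longrightarrow> cmod (Lnum k s - Lnum k t) \<le> C * \<bar>s - t\<bar>"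
proof
  fix s t :: real assume st: "s \<in> {1..2}" "t \<in> {1..2}"
  have "cmod (Lnum k s - Lnum k t) = 4 * cmod (infsum (Ldiff k s) gauss - infsum (Ldiff k t) gauss)"
    unfolding Lnum_def right_diff_distrib[symmetric] norm_mult by simp
  also have "infsum (Ldiff k s) gauss - infsum (Ldiff k t) gauss = (\<Sum>\<^sub>\<infinity>z\<in>gauss. Ldiff k s z - Ldiff k t z)"
    using infsum_diff_banach[OF Ldiff_summable[OF st(1)] Ldiff_summable[OF st(2)]] by simp
  also have "cmod \<dots> \<le> (\<Sum>\<^sub>\<infinity>z\<in>gauss. cmod (Ldiff k s z - Ldiff k t z))"
    by (rule norm_infsum_bound[OF Ldiff_diff_summable(1)[OF st]])
  also have "\<dots> \<le> (16 * real k + 18) * (\<Sum>\<^sub>\<infinity>z\<in>gauss. cmod z powr (- (5 / 2))) * \<bar>s - t\<bar>"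
    by (rule Ldiff_diff_summable(2)[OF st])
  finally show "cmod (Lnum k s - Lnum k t) \<le> (4 * ((16 * real k + 18) * (\<Sum>\<^sub>\<infinity>z\<in>gauss. cmod z powr (- (5 / 2))))) * \<bar>s - t\<bar>"
    by simp
qed

text \<open>In the residue field \<open>\<int>[\<i>] / (2 - \<i>)\<close> the element \<open>2 + \<i>\<close> is a unit while \<open>5\<close> vanishes,
  so no power of \<open>2 + \<i>\<close> is a power of \<open>5\<close>.\<close>

lemma two_plus_i_power:
  obtains x y :: int where "(2 + \<i>) ^ n = of_int x + \<i> * of_int y" "5 dvd x + 2 * y - (-1) ^ n"
proof -
  \<comment> \<open>Reduction modulo 2 - i sends i to 2, hence x + iy to x + 2y, and 2 + i to 4 = -1
    modulo 5.\<close>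
  have "\<exists>x y :: int. (2 + \<i>) ^ n = of_int x + \<i> * of_int y \<and> 5 dvd x + 2 * y - (-1) ^ n"
  proof (induction n)
    case 0 show ?case by (intro exI[of _ 1] exI[of _ 0]) simp
  next
    case (Suc n)
    then obtain x y q :: int where xy: "(2 + \<i>) ^ n = of_int x + \<i> * of_int y" "x + 2 * y - (-1) ^ n = 5 * q"
      by (auto elim!: dvdE)
    have "(2 + \<i>) ^ Suc n = of_int (2 * x - y) + \<i> * of_int (x + 2 * y)"
      by (simp add: xy(1) complex_eq_iff)
    moreover have "(2 * x - y) + 2 * (x + 2 * y) - (-1) ^ Suc n = 5 * (x + y - q)"
      using xy(2) by simp
    ultimately show ?case by (metis dvd_triv_left)
  qed
  then show ?thesis using that by blast
qed

text \<open>Keeps the denominator of \<open>Lser\<close> away from 0 at s = 1, and so rules out a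
  pole there for k >= 1.\<close>

lemma xi_two_plus_i_neq_1:
  assumes k: "k \<ge> 1"
  shows "xi k (2 + \<i>) \<noteq> 1"
proof
  assume eq: "xi k (2 + \<i>) = 1"
  have nz: "complex_of_real (cmod (2 + \<i>)) \<noteq> 0" by (simp add: norm_two_plus_i)
  have "(2 + \<i>) ^ (4 * k) = complex_of_real (cmod (2 + \<i>)) ^ (4 * k)"
    using eq nz by (simp add: xi_def sgn_eq power_divide)
  also have "\<dots> = of_real (sqrt 5 ^ (4 * k))" by (simp add: norm_two_plus_i)
  also have "sqrt 5 ^ (4 * k) = (sqrt 5 ^ 2) ^ (2 * k)"
    using power_mult[of "sqrt 5" 2 "2 * k"] by (simp only: mult.assoc[symmetric]) simp
  also have "\<dots> = of_int (5 ^ (2 * k))" by simp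
  finally have eq': "(2 + \<i>) ^ (4 * k) = of_real (of_int (5 ^ (2 * k)))" .
  obtain x y :: int where xy: "(2 + \<i>) ^ (4 * k) = of_int x + \<i> * of_int y" "5 dvd x + 2 * y - (-1) ^ (4 * k)"
    by (rule two_plus_i_power)
  have e: "of_int x + \<i> * of_int y = complex_of_real (of_int (5 ^ (2 * k)))" using xy(1) eq' by simp
  have "Re (of_int x + \<i> * of_int y) = of_int (5 ^ (2 * k))" "Im (of_int x + \<i> * of_int y) = 0"
    unfolding e by (simp_all only: Re_complex_of_real Im_complex_of_real)
  then have "real_of_int x = of_int (5 ^ (2 * k))" "real_of_int y = of_int 0" by simp_all
  then have "x = 5 ^ (2 * k)" "y = 0" by (simp_all only: of_int_eq_iff)
  then have "5 dvd (5 :: int) ^ (2 * k) - 1" using xy(2) by (simp add: power_mult)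
  moreover have "5 dvd (5 :: int) ^ (2 * k)" using k by (simp add: dvd_power)
  ultimately have "5 dvd (1 :: int)" using dvd_diff[of 5 "5 ^ (2 * k)" "5 ^ (2 * k) - 1 :: int"] by simp
  then show False by simp
qed

section \<open>Behaviour of the L-series as s decreases to 1\<close>

lemma eventually_at_right_1_2: "eventually (\<lambda>s::real. s \<in> {1<..<2}) (at_right 1)"
  by (rule eventually_at_right_real) simp

lemma Lser_mult_eq:
  "s > 1 \<Longrightarrow> Lser k s * (1 - xi k (2 + \<i>) * of_real (5 powr (1 - s))) = Lnum k s"
  unfolding Lnum_def by (rule Lser_functional)

lemma Lfactor_lower:
  assumes "k \<ge> 1"
  obtains d where "d > 0" "eventually (\<lambda>s. d \<le> cmod (1 - xi k (2 + \<i>) * of_real (5 powr (1 - s)))) (at_right 1)"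
proof
  let ?d = "cmod (1 - xi k (2 + \<i>))"
  show "?d / 2 > 0" using xi_two_plus_i_neq_1[OF assms] by simp
  have "((\<lambda>s. cmod (1 - xi k (2 + \<i>) * of_real (5 powr (1 - s)))) \<longlongrightarrow> cmod (1 - xi k (2 + \<i>) * of_real (5 powr (1 - 1)))) (at_right 1)"
    by (intro tendsto_intros) auto
  then have "eventually (\<lambda>s. cmod (1 - xi k (2 + \<i>) * of_real (5 powr (1 - s))) > ?d / 2) (at_right 1)"
    using xi_two_plus_i_neq_1[OF assms] by (intro order_tendstoD(1)) auto
  then show "eventually (\<lambda>s. ?d / 2 \<le> cmod (1 - xi k (2 + \<i>) * of_real (5 powr (1 - s)))) (at_right 1)"
    by eventually_elim simp
qed

lemma Lnum_bounded:
  obtains C where "C \<ge> 0" "\<And>s. s \<in> {1..2} \<Longrightarrow> cmod (Lnum k s) \<le> C"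
proof -
  obtain C where C: "\<And>s t. s \<in> {1..2} \<Longrightarrow> t \<in> {1..2} \<Longrightarrow> cmod (Lnum k s - Lnum k t) \<le> C * \<bar>s - t\<bar>"
    using Lnum_lipschitz by blast
  have C0: "C \<ge> 0" using order_trans[OF norm_ge_zero C[of 1 2]] by simp
  have "cmod (Lnum k s) \<le> C + cmod (Lnum k 1)" if "s \<in> {1..2}" for s
  proof -
    have "cmod (Lnum k s) \<le> cmod (Lnum k s - Lnum k 1) + cmod (Lnum k 1)"
      by (metis diff_add_cancel norm_triangle_ineq)
    moreover have "C * \<bar>s - 1\<bar> \<le> C * 1" using that C0 by (intro mult_left_mono) auto
    ultimately show ?thesis using C[OF that, of 1] by simp
  qed
  then show ?thesis using that[of "C + cmod (Lnum k 1)"] C0 by simp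
qed

lemma Lser_bounded:
  assumes "k \<ge> 1"
  obtains C where "eventually (\<lambda>s. cmod (Lser k s) \<le> C) (at_right 1)"
proof -
  obtain d where d: "d > 0" "eventually (\<lambda>s. d \<le> cmod (1 - xi k (2 + \<i>) * of_real (5 powr (1 - s)))) (at_right 1)"
    using Lfactor_lower[OF assms] by blast
  obtain C where C: "C \<ge> 0" "\<And>s. s \<in> {1..2} \<Longrightarrow> cmod (Lnum k s) \<le> C" using Lnum_bounded by blast
  have "eventually (\<lambda>s. cmod (Lser k s) \<le> C / d) (at_right 1)"
    using d(2) eventually_at_right_1_2
  proof eventually_elim
    case (elim s)
    have "cmod (Lser k s) * d \<le> cmod (Lser k s) * cmod (1 - xi k (2 + \<i>) * of_real (5 powr (1 - s)))"
      using elim by (intro mult_left_mono) auto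
    also have "\<dots> = cmod (Lnum k s)" using Lser_mult_eq[of s k] elim by (simp flip: norm_mult)
    also have "\<dots> \<le> C" using C(2)[of s] elim by simp
    finally show ?case using d(1) by (simp add: field_simps)
  qed
  then show ?thesis using that by blast
qed

text \<open>A Lipschitz numerator that is nonzero at 1 stays away from 0 nearby, and one that
  vanishes at 1 is of order s - 1; nothing in between can occur.\<close>

lemma Lser_dichotomy:
  assumes "k \<ge> 1"
  shows "(\<exists>c>0. eventually (\<lambda>s. c \<le> cmod (Lser k s)) (at_right 1)) \<or>
         (\<exists>C. eventually (\<lambda>s. cmod (Lser k s) \<le> C * (s - 1)) (at_right 1))"
proof -
  obtain C where C: "\<And>s t. s \<in> {1..2} \<Longrightarrow> t \<in> {1..2} \<Longrightarrow> cmod (Lnum k s - Lnum k t) \<le> C * \<bar>s - t\<bar>"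
    using Lnum_lipschitz by blast
  show ?thesis
  proof (cases "Lnum k 1 = 0")
    case True
    obtain d where d: "d > 0" "eventually (\<lambda>s. d \<le> cmod (1 - xi k (2 + \<i>) * of_real (5 powr (1 - s)))) (at_right 1)"
      using Lfactor_lower[OF assms] by blast
    have "eventually (\<lambda>s. cmod (Lser k s) \<le> C / d * (s - 1)) (at_right 1)"
      using d(2) eventually_at_right_1_2
    proof eventually_elim
      case (elim s)
      have "cmod (Lser k s) * d \<le> cmod (Lser k s) * cmod (1 - xi k (2 + \<i>) * of_real (5 powr (1 - s)))"
        using elim by (intro mult_left_mono) auto
      also have "\<dots> = cmod (Lnum k s)" using Lser_mult_eq[of s k] elim by (simp flip: norm_mult)
      also have "\<dots> \<le> C * (s - 1)" using C[of s 1] elim True by simp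
      finally show ?case using d(1) by (simp add: field_simps)
    qed
    then show ?thesis by blast
  next
    case False
    define e where "e = cmod (Lnum k 1)"
    have e: "e > 0" using False by (simp add: e_def)
    have "((\<lambda>s. C * \<bar>s - 1\<bar>) \<longlongrightarrow> C * \<bar>1 - 1\<bar>) (at_right 1)" by (intro tendsto_intros)
    then have "eventually (\<lambda>s. C * \<bar>s - 1\<bar> < e / 2) (at_right 1)"
      using e by (intro order_tendstoD(2)) auto
    then have "eventually (\<lambda>s. e / 4 \<le> cmod (Lser k s)) (at_right 1)"
      using eventually_at_right_1_2
    proof eventually_elim
      case (elim s)
      have "e \<le> cmod (Lnum k s - Lnum k 1) + cmod (Lnum k s)"
        unfolding e_def using norm_triangle_ineq4[of "Lnum k s - Lnum k 1" "Lnum k s"] by simp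
      then have "e / 2 \<le> cmod (Lnum k s)" using C[of s 1] elim by simp
      also have "\<dots> = cmod (Lser k s) * cmod (1 - xi k (2 + \<i>) * of_real (5 powr (1 - s)))"
        using Lser_mult_eq[of s k] elim by (simp flip: norm_mult)
      also have "\<dots> \<le> cmod (Lser k s) * 2"
      proof (rule mult_left_mono)
        have "cmod (xi k (2 + \<i>)) = 1" by (rule norm_xi) (simp add: complex_eq_iff)
        moreover have "5 powr (1 - s) \<le> (1 :: real)" using elim powr_mono[of "1 - s" 0 5] by simp
        ultimately show "cmod (1 - xi k (2 + \<i>) * of_real (5 powr (1 - s))) \<le> 2"
          using norm_triangle_ineq4[of 1 "xi k (2 + \<i>) * of_real (5 powr (1 - s))"] by (simp add: norm_mult)
      qed simp
      finally show ?case by simp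
    qed
    then show ?thesis using e by (intro disjI1 exI[of _ "e / 4"]) simp
  qed
qed

lemma xi_0 [simp]: "xi 0 z = 1"
  by (simp add: xi_def)

text \<open>For k = 0 the denominator is 1 - 5^(1-s), which is at least (s - 1)/2 on (1, 2). The 1
  added to the constant keeps it positive, because its logarithm is taken later.\<close>

lemma Lser_0_upper:
  obtains C where "C > 0" "eventually (\<lambda>s. cmod (Lser 0 s) \<le> C / (s - 1)) (at_right 1)"
proof -
  obtain C where C: "C \<ge> 0" "\<And>s. s \<in> {1..2} \<Longrightarrow> cmod (Lnum 0 s) \<le> C" using Lnum_bounded by blast
  have "eventually (\<lambda>s. cmod (Lser 0 s) \<le> (2 * C + 1) / (s - 1)) (at_right 1)"
    using eventually_at_right_1_2
  proof eventually_elim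
    case (elim s)
    define u where "u = s - 1"
    have u: "0 < u" "u < 1" using elim by (auto simp: u_def)
    have "ln 5 \<ge> (1 :: real)" using exp_le ln_ge_iff[of 5 1] by simp
    then have "1 + u \<le> 1 + u * ln 5" using u by simp
    also have "\<dots> \<le> exp (u * ln 5)" by (rule exp_ge_add_one_self)
    finally have "1 + u \<le> 5 powr u" by (simp add: powr_def mult.commute)
    then have "5 powr (- u) \<le> 1 / (1 + u)" using u by (simp add: powr_minus field_simps)
    also have "1 / (1 + u) \<le> 1 - u / 2" 
    proof -
      have "0 \<le> u * (1 - u)" using u by simp
      then show ?thesis using u by (simp add: field_simps)
    qed
    finally have "5 powr (- u) \<le> 1 - u / 2" .
    moreover have "- u = 1 - s" by (simp add: u_def)
    ultimately have l: "u / 2 \<le> 1 - 5 powr (1 - s)" by simp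
    have "cmod (Lser 0 s) * (u / 2) \<le> cmod (Lser 0 s) * cmod (1 - xi 0 (2 + \<i>) * of_real (5 powr (1 - s)))"
    proof (rule mult_left_mono)
      have "cmod (1 - xi 0 (2 + \<i>) * of_real (5 powr (1 - s))) = \<bar>1 - 5 powr (1 - s)\<bar>"
        by (metis norm_of_real of_real_1 of_real_diff xi_0 mult_1)
      then show "u / 2 \<le> cmod (1 - xi 0 (2 + \<i>) * of_real (5 powr (1 - s)))"
        using l abs_ge_self[of "1 - 5 powr (1 - s)"] by linarith
    qed simp
    also have "\<dots> = cmod (Lnum 0 s)" using Lser_mult_eq[of s 0] elim by (simp flip: norm_mult)
    also have "\<dots> \<le> C" using C(2)[of s] elim by simp
    finally have "cmod (Lser 0 s) * u \<le> 2 * C + 1" by simp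
    then show ?case using u by (simp add: u_def[symmetric] field_simps)
  qed
  then show ?thesis using that[of "2 * C + 1"] C(1) by simp
qed

text \<open>On the triangle 1 <= b <= a the row of a contributes at least 1/(2a), and the harmonic
  series diverges.\<close>

lemma not_summable_on_gauss: "\<not> (\<lambda>z. cmod z powr (- 2)) summable_on gauss"
proof
  assume s: "(\<lambda>z. cmod z powr (- 2)) summable_on gauss"
  define f where "f = (\<lambda>(a::nat, b::nat). of_nat a + \<i> * of_nat b :: complex)"
  let ?A = "Sigma {1..} (\<lambda>a. {1..a})"
  have "inj_on f ?A" by (auto simp: inj_on_def f_def complex_eq_iff)
  moreover have "f ` ?A \<subseteq> gauss" by (auto simp: f_def gauss_iff)
  ultimately have "(\<lambda>p. cmod (f p) powr (- 2)) summable_on ?A"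
    using summable_on_subset_banach[OF s] summable_on_reindex[of f ?A "\<lambda>z. cmod z powr (- 2)"] by (auto simp: o_def)
  then have "(\<lambda>a. \<Sum>\<^sub>\<infinity>b\<in>{1..a}. cmod (f (a, b)) powr (- 2)) summable_on {1..}"
    by (intro summable_on_Sigma_banach) (simp add: case_prod_beta')
  then have "(\<lambda>a. 1 / 2 * (1 / real a)) summable_on {1..}"
  proof (rule summable_on_comparison_test)
    fix a :: nat assume a: "a \<in> {1..}"
    have "1 / 2 * (1 / real a) = (\<Sum>b\<in>{1..a}. 1 / (2 * (real a)\<^sup>2))"
      using a by (simp add: power2_eq_square field_simps)
    also have "\<dots> \<le> (\<Sum>b\<in>{1..a}. cmod (f (a, b)) powr (- 2))"
    proof (rule sum_mono)
      fix b assume b: "b \<in> {1..a}"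
      have "(cmod (f (a, b)))\<^sup>2 = (real a)\<^sup>2 + (real b)\<^sup>2" by (simp add: f_def cmod_power2)
      moreover have "(real b)\<^sup>2 \<le> (real a)\<^sup>2" using b by (intro power_mono) auto
      moreover have "(real a)\<^sup>2 > 0" using a by simp
      moreover have "cmod (f (a, b)) powr (- 2) = 1 / (cmod (f (a, b)))\<^sup>2"
        by (simp add: powr_minus divide_inverse powr_numeral)
      ultimately show "1 / (2 * (real a)\<^sup>2) \<le> cmod (f (a, b)) powr (- 2)"
        by (simp add: frac_le add_pos_nonneg)
    qed
    finally show "1 / 2 * (1 / real a) \<le> (\<Sum>\<^sub>\<infinity>b\<in>{1..a}. cmod (f (a, b)) powr (- 2))" by simp
  qed auto
  then have "(\<lambda>a. 2 * (1 / 2 * (1 / real a))) summable_on {1..}" by (rule summable_on_cmult_right)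
  then have "(\<lambda>a. 1 / real a) summable_on {1..}" by simp
  moreover have "(\<lambda>a. 1 / real a) summable_on {0}" by simp
  ultimately have "(\<lambda>a. 1 / real a) summable_on ({1..} \<union> {0})" by (intro summable_on_union)
  moreover have "{1..} \<union> {0} = (UNIV :: nat set)" by auto
  ultimately have "summable (\<lambda>a. 1 / real a)" using summable_on_imp_summable by metis
  then show False using not_summable_harmonic[where 'a = real] by (simp add: inverse_eq_divide)
qed

lemma Lser_0_eq:
  assumes "s > 1"
  shows "Lser 0 s = of_real (\<Sum>\<^sub>\<infinity>z\<in>gauss. cmod z powr (- (2 * s)))"
proof -
  have "(\<lambda>z. cmod z powr (- (2 * s))) summable_on gauss"
    using assms by (intro summable_on_gauss_powr) simp
  then have "((\<lambda>z. complex_of_real (cmod z powr (- (2 * s)))) has_sum of_real (\<Sum>\<^sub>\<infinity>z\<in>gauss. cmod z powr (- (2 * s)))) gauss"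
    unfolding has_sum_of_real_iff by simp
  then show ?thesis unfolding Lser_def lat_def xi_0 mult_1_left by (rule infsumI)
qed

text \<open>At s = 1 some finite partial sum exceeds any given bound. That sum is continuous in s,
  and by positivity it stays below the full series.\<close>

lemma Lser_0_at_top: "filterlim (\<lambda>s. cmod (Lser 0 s)) at_top (at_right 1)"
  unfolding filterlim_at_top
proof
  fix B :: real
  have "\<exists>F. finite F \<and> F \<subseteq> gauss \<and> (\<Sum>z\<in>F. cmod z powr (- 2)) > B"
  proof (rule ccontr)
    assume "\<not> ?thesis"
    then have "\<And>F. finite F \<Longrightarrow> F \<subseteq> gauss \<Longrightarrow> (\<Sum>z\<in>F. cmod z powr (- 2)) \<le> B" by (meson not_le)
    then have "(\<lambda>z. cmod z powr (- 2)) summable_on gauss"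
      by (intro nonneg_bdd_above_summable_on bdd_aboveI[of _ B]) auto
    then show False using not_summable_on_gauss by blast
  qed
  then obtain F where F: "finite F" "F \<subseteq> gauss" "(\<Sum>z\<in>F. cmod z powr (- 2)) > B" by blast
  have "((\<lambda>s. \<Sum>z\<in>F. cmod z powr (- (2 * s))) \<longlongrightarrow> (\<Sum>z\<in>F. cmod z powr (- (2 * 1)))) (at_right 1)"
  proof (rule tendsto_sum)
    fix z
    show "((\<lambda>s. cmod z powr (- (2 * s))) \<longlongrightarrow> cmod z powr (- (2 * 1))) (at_right 1)"
    proof (cases "z = 0")
      case False
      have "((\<lambda>s. 2 * s) \<longlongrightarrow> 2 * (1 :: real)) (at_right 1)" by (rule tendsto_mult_left[OF tendsto_ident_at])
      then show ?thesis using False by (intro tendsto_powr tendsto_minus tendsto_const) auto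
    qed simp
  qed
  then have "eventually (\<lambda>s. (\<Sum>z\<in>F. cmod z powr (- (2 * s))) > B) (at_right 1)"
    using F(3) by (intro order_tendstoD(1)) auto
  then show "eventually (\<lambda>s. B \<le> cmod (Lser 0 s)) (at_right 1)"
    using eventually_at_right_1_2
  proof eventually_elim
    case (elim s)
    have "(\<Sum>z\<in>F. cmod z powr (- (2 * s))) \<le> (\<Sum>\<^sub>\<infinity>z\<in>gauss. cmod z powr (- (2 * s)))"
      using elim F by (intro finite_sum_le_infsum summable_on_gauss_powr) auto
    also have "\<dots> \<le> cmod (Lser 0 s)" using Lser_0_eq[of s] elim by simp
    finally show ?case using elim by simp
  qed
qed

section \<open>Euler product and equidistribution of Gaussian primes\<close>

definition dterm :: "nat \<Rightarrow> real \<Rightarrow> nat \<Rightarrow> real" where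
  "dterm k s n = hcoeff k n * real n powr (- s)"

text \<open>Division by the number of units gives a Dirichlet series with leading coefficient 1, the
  one that has an Euler product.\<close>

definition Lreal :: "nat \<Rightarrow> real \<Rightarrow> real" where
  "Lreal k s = Re (Lser k s) / 4"

lemma dterm_1 [simp]: "dterm k s (Suc 0) = 1"
  by (simp add: dterm_def)

lemma Lser_has_sum:
  assumes s: "s > 1"
  shows "((\<lambda>n. complex_of_real (4 * dterm k s n)) has_sum Lser k s) {1..}"
proof -
  have "(lat k s has_sum Lser k s) gauss" using lat_summable[OF s] by (simp add: Lser_def)
  then have "(lat k s has_sum Lser k s) (gauss - {0})"
    by (subst has_sum_cong_neutral[where g = "lat k s" and T = gauss]) auto
  moreover have "bij_betw snd (Sigma {1::nat..} (\<lambda>n. Lambda (int n))) (gauss - {0})"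
  proof (rule bij_betwI')
    fix x y assume "x \<in> Sigma {1::nat..} (\<lambda>n. Lambda (int n))" "y \<in> Sigma {1::nat..} (\<lambda>n. Lambda (int n))"
    then show "(snd x = snd y) = (x = y)"
      by (cases x; cases y) (auto simp: Lambda_iff)
  next
    fix x assume "x \<in> Sigma {1::nat..} (\<lambda>n. Lambda (int n))"
    then show "snd x \<in> gauss - {0}" by (auto simp: Lambda_iff)
  next
    fix z assume z: "z \<in> gauss - {0}"
    then obtain a b where ab: "z = of_int a + \<i> * of_int b" by (auto elim: gaussE)
    have n: "(cmod z)\<^sup>2 = of_int (a\<^sup>2 + b\<^sup>2)" unfolding cmod_power2 by (simp add: ab)
    have "a\<^sup>2 + b\<^sup>2 > 0" using z ab by (auto simp: sum_power2_gt_zero_iff)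
    then have "(nat (a\<^sup>2 + b\<^sup>2), z) \<in> Sigma {1..} (\<lambda>n. Lambda (int n))"
      using z n by (auto simp: Lambda_iff)
    then show "\<exists>x\<in>Sigma {1..} (\<lambda>n. Lambda (int n)). z = snd x" by (rule rev_bexI) simp
  qed
  ultimately have "((\<lambda>x. lat k s (snd x)) has_sum Lser k s) (Sigma {1::nat..} (\<lambda>n. Lambda (int n)))"
    using has_sum_reindex_bij_betw by fastforce
  then show ?thesis
  proof (rule has_sum_SigmaD)
    fix n :: nat assume n: "n \<in> {1..}"
    have "cmod z powr (- (2 * s)) = real n powr (- s)" if "z \<in> Lambda (int n)" for z
    proof -
      have "cmod z = real n powr (1 / 2)" using Lambda_memD(2)[OF that] by (simp add: powr_half_sqrt)
      then show ?thesis by (simp add: powr_powr)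
    qed
    then have "(\<Sum>z\<in>Lambda (int n). lat k s z) = (\<Sum>z\<in>Lambda (int n). xi k z) * of_real (real n powr (- s))"
      by (simp add: lat_def sum_distrib_right)
    also have "\<dots> = of_real (4 * dterm k s n)"
      unfolding sum_xi_Lambda by (simp add: dterm_def)
    finally show "((\<lambda>y. lat k s (snd (n, y))) has_sum of_real (4 * dterm k s n)) (Lambda (int n))"
      by (intro has_sum_finiteI finite_Lambda) simp
  qed
qed

lemma dterm_has_sum: "s > 1 \<Longrightarrow> (dterm k s has_sum Lreal k s) {1..}"
proof -
  assume s: "s > 1"
  have "((\<lambda>n. 1 / 4 * (4 * dterm k s n)) has_sum (1 / 4 * Re (Lser k s))) {1..}"
    using has_sum_Re[OF Lser_has_sum[OF s, of k]] by (intro has_sum_cmult_right) simp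
  then show ?thesis by (simp add: Lreal_def)
qed

lemma Lser_eq_Lreal:
  assumes "s > 1"
  shows "Lser k s = of_real (4 * Lreal k s)"
proof -
  have "((\<lambda>n. 4 * dterm k s n) has_sum 4 * Lreal k s) {1..}"
    by (rule has_sum_cmult_right[OF dterm_has_sum[OF assms]])
  then have "((\<lambda>n. complex_of_real (4 * dterm k s n)) has_sum of_real (4 * Lreal k s)) {1..}"
    unfolding has_sum_of_real_iff .
  then show ?thesis using Lser_has_sum[OF assms] has_sum_unique by blast
qed

lemma dterm_summable: "s > 1 \<Longrightarrow> A \<subseteq> {1..} \<Longrightarrow> dterm k s summable_on A"
  using dterm_has_sum has_sum_imp_summable summable_on_subset_banach by metis

lemma dterm_prime_power_mult:
  assumes "prime p" "\<not> p dvd m"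
  shows "dterm k s (p ^ e * m) = dterm k s (p ^ e) * dterm k s m"
  using hcoeff_prime_power_mult[OF assms, of k e] by (simp add: dterm_def powr_mult)

lemma dterm_prime_power:
  assumes "prime p"
  shows "dterm k s (p ^ e) = hcoeff k (p ^ e) * (real p powr (- s)) ^ e"
proof -
  have "real p > 0" using prime_gt_0_nat[OF assms] by simp
  then show ?thesis by (simp add: dterm_def powr_power mult.commute flip: powr_realpow[of "real p"] powr_powr)
     (simp add: powr_powr powr_realpow[symmetric] mult.commute)
qed

section \<open>The Euler product\<close>

definition euler_den :: "nat \<Rightarrow> real \<Rightarrow> nat \<Rightarrow> real" where
  "euler_den k s p = 1 - hcoeff k p * real p powr (- s) + heckeB p * (real p powr (- s))\<^sup>2"

text \<open>With t = p^(-s) <= 1/2 the factor at a split prime is at least (1 - t)^2. The bound is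
  uniform in p, k and s, and so are the error terms of the logarithms.\<close>

lemma euler_den_lower:
  assumes p: "prime p" and s: "s > 1"
  shows "1 / 4 \<le> euler_den k s p"
    and "\<bar>hcoeff k p\<bar> \<le> 2" and "\<bar>heckeB p\<bar> \<le> 1" and "0 < real p powr (- s)" "real p powr (- s) \<le> 1 / 2"
proof -
  define t where "t = real p powr (- s)"
  have p2: "real p \<ge> 2" using prime_ge_2_nat[OF p] by simp
  show t0: "0 < real p powr (- s)" using p2 by simp
  have "real p powr (- s) \<le> real p powr (- 1)" using p2 s by (intro powr_mono) auto
  also have "\<dots> \<le> 1 / 2" using p2 by (simp add: powr_minus_divide)
  finally show t2: "real p powr (- s) \<le> 1 / 2" .
  have t: "0 < t" "t \<le> 1 / 2" using t0 t2 by (auto simp: t_def)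
  have "(1 / 2)\<^sup>2 \<le> (1 - t)\<^sup>2" using t by (intro power_mono) auto
  then have q: "1 / 4 \<le> (1 - t)\<^sup>2" by (simp add: power2_eq_square)
  from p show "1 / 4 \<le> euler_den k s p"
  proof (cases rule: prime_trichotomy)
    case two
    have "(-1) ^ k * t \<le> t" using t by (cases "even k") auto
    moreover have "euler_den k s p = 1 - (-1) ^ k * t"
      unfolding euler_den_def t_def[symmetric] two(2,3) by simp
    ultimately show ?thesis using t by linarith
  next
    case (split \<phi>)
    have "cos (real k * \<phi>) * t \<le> 1 * t" using t by (intro mult_right_mono) auto
    then have "(1 - t)\<^sup>2 \<le> euler_den k s p"
      using split by (simp add: euler_den_def t_def[symmetric] power2_eq_square algebra_simps)
    then show ?thesis using q by linarith
  next
    case inert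
    have "t * t \<le> (1 / 2) * (1 / 2)" using t by (intro mult_mono) auto
    then show ?thesis using inert by (simp add: euler_den_def t_def[symmetric] power2_eq_square)
  qed
  from p show "\<bar>hcoeff k p\<bar> \<le> 2" by (cases rule: prime_trichotomy) (auto simp: power_abs abs_mult)
  show "\<bar>heckeB p\<bar> \<le> 1" by (simp add: heckeB_def)
qed

text \<open>Summing the prime power recursion from e = 2 on gives a linear equation for the sum W,
  which is then solved.\<close>

lemma euler_factor:
  assumes p: "prime p" and s: "s > 1"
  shows "((\<lambda>e. dterm k s (p ^ e)) has_sum (1 / euler_den k s p)) UNIV"
proof -
  define t where "t = real p powr (- s)"
  define f where "f = (\<lambda>e. dterm k s (p ^ e))"
  have inj: "inj (\<lambda>e. p ^ e)" using prime_gt_1_nat[OF p] by (auto simp: inj_on_def)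
  have "dterm k s summable_on range (\<lambda>e. p ^ e)"
    using prime_gt_0_nat[OF p] by (intro dterm_summable s) auto
  then have fs: "f summable_on UNIV" unfolding f_def
    by (subst (asm) summable_on_reindex[OF inj]) (simp add: o_def)
  then have sm: "summable f" by (rule summable_on_imp_summable)
  have fe: "f e = hcoeff k (p ^ e) * t ^ e" for e unfolding f_def t_def by (rule dterm_prime_power[OF p])
  have rec: "f (Suc (Suc e)) = hcoeff k p * t * f (Suc e) - heckeB p * t\<^sup>2 * f e" for e
    unfolding fe hcoeff_prime_power_rec[OF p] by (simp add: algebra_simps power2_eq_square)
  define W where "W = suminf f"
  have sm1: "summable (\<lambda>e. f (Suc e))" using sm by (subst summable_Suc_iff)
  have W1: "(\<Sum>e. f (Suc e)) = W - 1" using suminf_split_head[OF sm] by (simp add: W_def f_def)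
  have "(\<Sum>e. f (Suc (Suc e))) = W - 1 - hcoeff k p * t"
    using suminf_split_head[OF sm1] W1 fe[of 1] by simp
  moreover have "(\<Sum>e. f (Suc (Suc e))) = hcoeff k p * t * (W - 1) - heckeB p * t\<^sup>2 * W"
    unfolding rec using sm sm1 by (subst suminf_diff[symmetric]) (auto simp: suminf_mult W1 W_def)
  ultimately have "W * euler_den k s p = 1"
    unfolding euler_den_def t_def[symmetric] by (simp add: algebra_simps)
  then have "W = 1 / euler_den k s p"
    using euler_den_lower(1)[OF p s, of k] by (simp add: field_simps)
  moreover have "(f has_sum W) UNIV"
    using fs sm by (metis W_def has_sum_imp_sums has_sum_infsum sums_unique)
  ultimately show ?thesis by (simp add: f_def)
qed

definition smooth :: "nat set \<Rightarrow> nat set" where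
  "smooth T = {n. n \<ge> 1 \<and> (\<forall>p. prime p \<longrightarrow> p dvd n \<longrightarrow> p \<in> T)}"

lemma smooth_empty: "smooth {} = {1}"
  unfolding smooth_def using prime_factor_nat by (auto intro: ccontr)

lemma bij_betw_smooth_insert:
  assumes p: "prime p" "p \<notin> T" and T: "\<And>q. q \<in> T \<Longrightarrow> prime q"
  shows "bij_betw (\<lambda>(m, e). p ^ e * m) (smooth T \<times> UNIV) (smooth (insert p T))"
proof (rule bij_betwI')
  have nd: "\<not> p dvd m" if "m \<in> smooth T" for m using that p by (auto simp: smooth_def)
  fix x y assume xy: "x \<in> smooth T \<times> (UNIV :: nat set)" "y \<in> smooth T \<times> (UNIV :: nat set)"
  obtain m e n f where x: "x = (m, e)" "y = (n, f)" by (metis surj_pair)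
  have mn: "m \<in> smooth T" "n \<in> smooth T" using xy x by auto
  have "e = f \<and> m = n" if eq: "p ^ e * m = p ^ f * n"
  proof -
    have "m > 0" "n > 0" using mn by (auto simp: smooth_def)
    then have "multiplicity p (p ^ e * m) = e" "multiplicity p (p ^ f * n) = f"
      using nd[OF mn(1)] nd[OF mn(2)] p prime_gt_0_nat[OF p(1)]
      by (auto simp: prime_elem_multiplicity_mult_distrib not_dvd_imp_multiplicity_0)
    then have "e = f" using eq by simp
    then show ?thesis using eq prime_gt_0_nat[OF p(1)] by simp
  qed
  then show "((case x of (m, e) \<Rightarrow> p ^ e * m) = (case y of (m, e) \<Rightarrow> p ^ e * m)) = (x = y)"
    by (auto simp: x)
next
  fix x assume "x \<in> smooth T \<times> (UNIV :: nat set)"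
  then show "(case x of (m, e) \<Rightarrow> p ^ e * m) \<in> smooth (insert p T)"
    using p prime_gt_0_nat[OF p(1)]
    by (auto simp: smooth_def prime_dvd_mult_iff) (metis p(1) prime_dvd_power primes_dvd_imp_eq)
next
  fix n assume n: "n \<in> smooth (insert p T)"
  have "n \<noteq> 0" "\<not> is_unit p" using n p by (auto simp: smooth_def)
  then obtain m where m: "n = p ^ multiplicity p n * m" "\<not> p dvd m"
    using multiplicity_decompose'[of n p] by metis
  have "m \<in> smooth T"
    unfolding smooth_def
  proof (intro CollectI conjI allI impI)
    show "m \<ge> 1" using m \<open>n \<noteq> 0\<close> by (cases m) auto
    fix q assume q: "prime q" "q dvd m"
    have "q dvd n" using q m(1) by (metis dvd_mult)
    then have "q \<in> insert p T" using n q by (auto simp: smooth_def)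
    then show "q \<in> T" using q m(2) by auto
  qed
  then show "\<exists>x\<in>smooth T \<times> UNIV. n = (case x of (m, e) \<Rightarrow> p ^ e * m)"
    using m(1) by (intro bexI[of _ "(m, multiplicity p n)"]) auto
qed

lemma euler_product_smooth:
  assumes s: "s > 1" and "finite T" "\<And>q. q \<in> T \<Longrightarrow> prime q"
  shows "(dterm k s has_sum (\<Prod>p\<in>T. 1 / euler_den k s p)) (smooth T)"
  using assms(2,3)
proof (induction T rule: finite_induct)
  case empty
  show ?case by (auto simp: smooth_empty intro!: has_sum_finiteI)
next
  case (insert p T)
  have p: "prime p" and T: "\<And>q. q \<in> T \<Longrightarrow> prime q" using insert.prems by auto
  have IH: "(dterm k s has_sum (\<Prod>p\<in>T. 1 / euler_den k s p)) (smooth T)" using insert.IH T by blast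
  have bij: "bij_betw (\<lambda>(m, e). p ^ e * m) (smooth T \<times> UNIV) (smooth (insert p T))"
    by (rule bij_betw_smooth_insert[OF p insert.hyps(2)]) (rule T)
  let ?f = "\<lambda>x. dterm k s (case x of (m, e) \<Rightarrow> p ^ e * m)"
  have sub: "smooth (insert p T) \<subseteq> {1..}" by (auto simp: smooth_def)
  have "(?f has_sum (1 / euler_den k s p * (\<Prod>p\<in>T. 1 / euler_den k s p))) (smooth T \<times> UNIV)"
  proof (rule has_sum_SigmaI)
    fix m assume m: "m \<in> smooth T"
    have nd: "\<not> p dvd m" using m p insert.hyps(2) by (auto simp: smooth_def)
    have "((\<lambda>e. dterm k s (p ^ e) * dterm k s m) has_sum (1 / euler_den k s p * dterm k s m)) UNIV"
      by (rule has_sum_cmult_left[OF euler_factor[OF p s]])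
    then show "((\<lambda>e. ?f (m, e)) has_sum (1 / euler_den k s p * dterm k s m)) UNIV"
      by (simp add: dterm_prime_power_mult[OF p nd])
  next
    show "((\<lambda>m. 1 / euler_den k s p * dterm k s m) has_sum (1 / euler_den k s p * (\<Prod>p\<in>T. 1 / euler_den k s p))) (smooth T)"
      by (rule has_sum_cmult_right[OF IH])
  next
    show "?f summable_on smooth T \<times> UNIV"
      by (subst summable_on_reindex_bij_betw[OF bij]) (rule dterm_summable[OF s sub])
  qed
  then have "(dterm k s has_sum (1 / euler_den k s p * (\<Prod>p\<in>T. 1 / euler_den k s p))) (smooth (insert p T))"
    by (subst (asm) has_sum_reindex_bij_betw[OF bij])
  then show ?case using insert.hyps by simp
qed

text \<open>The product over T is the sum over the T-smooth numbers. Once T contains all prime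
  divisors of a finite set X0 beyond which partial sums stay near the limit, the smooth numbers
  contain X0, and the product is near the limit too.\<close>

lemma euler_product_limit:
  assumes s: "s > 1"
  shows "((\<lambda>T. \<Prod>p\<in>T. 1 / euler_den k s p) \<longlongrightarrow> Lreal k s) (finite_subsets_at_top {p. prime p})"
  unfolding tendsto_iff
proof (intro allI impI)
  fix e :: real assume e: "e > 0"
  have "(sum (dterm k s) \<longlongrightarrow> Lreal k s) (finite_subsets_at_top {1..})"
    using dterm_has_sum[OF s, of k] by (simp add: has_sum_def)
  then have "eventually (\<lambda>X. dist (sum (dterm k s) X) (Lreal k s) < e / 2) (finite_subsets_at_top {1..})"
    using half_gt_zero[OF e] unfolding tendsto_iff by blast
  then obtain X0 where X0: "finite X0" "X0 \<subseteq> {1..}"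
    and close: "\<And>X. finite X \<Longrightarrow> X0 \<subseteq> X \<Longrightarrow> X \<subseteq> {1..} \<Longrightarrow> dist (sum (dterm k s) X) (Lreal k s) < e / 2"
    by (auto simp: eventually_finite_subsets_at_top)
  define T0 where "T0 = (\<Union>n\<in>X0. {p. prime p \<and> p dvd n})"
  have "finite {p. prime p \<and> p dvd n}" if "n \<in> X0" for n
  proof (rule finite_subset)
    have "n > 0" using that X0 by auto
    then show "finite {d. d dvd n}" by simp
  qed auto
  then have T0: "finite T0" "T0 \<subseteq> {p. prime p}" using X0 by (auto simp: T0_def)
  show "eventually (\<lambda>T. dist (\<Prod>p\<in>T. 1 / euler_den k s p) (Lreal k s) < e) (finite_subsets_at_top {p. prime p})"
    unfolding eventually_finite_subsets_at_top
  proof (intro exI[of _ T0] conjI T0 allI impI)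
    fix T assume T: "finite T \<and> T0 \<subseteq> T \<and> T \<subseteq> {p. prime p}"
    have X0T: "X0 \<subseteq> smooth T" using X0 T by (auto simp: smooth_def T0_def)
    have "(sum (dterm k s) \<longlongrightarrow> (\<Prod>p\<in>T. 1 / euler_den k s p)) (finite_subsets_at_top (smooth T))"
      using euler_product_smooth[OF s, of T k] T by (auto simp: has_sum_def)
    moreover have "eventually (\<lambda>X. dist (Lreal k s) (sum (dterm k s) X) \<le> e / 2) (finite_subsets_at_top (smooth T))"
      unfolding eventually_finite_subsets_at_top
    proof (intro exI[of _ X0] conjI X0 X0T allI impI)
      fix X assume X: "finite X \<and> X0 \<subseteq> X \<and> X \<subseteq> smooth T"
      have "X \<subseteq> {1..}" using X by (auto simp: smooth_def)
      then show "dist (Lreal k s) (sum (dterm k s) X) \<le> e / 2" using close[of X] X by (simp add: dist_commute)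
    qed
    ultimately have "dist (Lreal k s) (\<Prod>p\<in>T. 1 / euler_den k s p) \<le> e / 2"
      by (rule Lim_dist_ubound[OF finite_subsets_at_top_neq_bot])
    then show "dist (\<Prod>p\<in>T. 1 / euler_den k s p) (Lreal k s) < e" using e by (simp add: dist_commute)
  qed
qed

section \<open>Sums over primes and nonvanishing at s = 1\<close>

definition Psum :: "nat \<Rightarrow> real \<Rightarrow> real" where
  "Psum k s = (\<Sum>\<^sub>\<infinity>p\<in>{p. prime p}. dterm k s p)"

lemma Psum_has_sum: "s > 1 \<Longrightarrow> (dterm k s has_sum Psum k s) {p. prime p}"
  unfolding Psum_def by (intro has_sum_infsum dterm_summable) (auto dest: prime_gt_0_nat)

lemma ln_euler_factor:
  assumes p: "prime p" and s: "s > 1"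
  shows "\<bar>ln (1 / euler_den k s p) - dterm k s p\<bar> \<le> 26 * real p powr (- 2)"
proof -
  define t where "t = real p powr (- s)"
  define A where "A = hcoeff k p"
  define u where "u = A * t - heckeB p * t\<^sup>2"
  note b = euler_den_lower(1,2)[OF p s, of k] euler_den_lower(3-)[OF p s]
  have t: "0 < t" "t \<le> 1 / 2" using b by (auto simp: t_def)
  have D: "euler_den k s p = 1 - u" by (simp add: euler_den_def u_def A_def t_def)
  have u4: "1 / 4 \<le> 1 - u" using b D by simp
  have "\<bar>u - A * t\<bar> = \<bar>heckeB p\<bar> * t\<^sup>2" by (simp add: u_def abs_mult)
  also have "\<dots> \<le> 1 * t\<^sup>2" using b by (intro mult_right_mono) auto
  finally have u1: "\<bar>u - A * t\<bar> \<le> t\<^sup>2" by simp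
  have "\<bar>A * t\<bar> \<le> 2 * t" using b t by (auto simp: abs_mult A_def intro!: mult_right_mono)
  moreover have "t\<^sup>2 \<le> (1 / 2) * t" unfolding power2_eq_square using t by (intro mult_right_mono) auto
  ultimately have "\<bar>u\<bar> \<le> 5 / 2 * t" using u1 by linarith
  then have "\<bar>u\<bar>\<^sup>2 \<le> (5 / 2 * t)\<^sup>2" by (intro power_mono) auto
  then have u2: "u\<^sup>2 \<le> 25 / 4 * t\<^sup>2" by (simp add: power_mult_distrib power2_eq_square)
  have "ln (1 - u) \<le> - u" using ln_le_minus_one[of "1 - u"] u4 by simp
  then have lo: "u \<le> ln (1 / (1 - u))" using u4 by (simp add: ln_div)
  have "ln (1 / (1 - u)) \<le> 1 / (1 - u) - 1" using u4 by (intro ln_le_minus_one) simp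
  also have "\<dots> = u + u\<^sup>2 / (1 - u)" using u4 by (simp add: field_simps power2_eq_square)
  also have "u\<^sup>2 / (1 - u) \<le> u\<^sup>2 / (1 / 4)" using u4 by (intro divide_left_mono) auto
  finally have hi: "ln (1 / (1 - u)) \<le> u + 4 * u\<^sup>2" by simp
  \<comment> \<open>26 = 1 + 4 * (25/4): u differs from A t by at most t^2, and the logarithm from u
    by at most 4 u^2.\<close>
  have "\<bar>ln (1 / (1 - u)) - A * t\<bar> \<le> 26 * t\<^sup>2" using lo hi u1 u2 by linarith
  also have "t\<^sup>2 = real p powr (- (2 * s))" by (simp add: t_def power2_eq_square flip: powr_add)
  also have "26 * real p powr (- (2 * s)) \<le> 26 * real p powr (- 2)"
    using s prime_ge_1_nat[OF p] by (intro mult_left_mono powr_mono) auto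
  finally show ?thesis by (simp add: D A_def t_def dterm_def)
qed

text \<open>The error is at most 26 times the sum of n^(-2), whatever k and s are. The exponential
  form also yields the positivity of \<open>Lreal\<close>, so that logarithms are available
  afterwards.\<close>

lemma ln_Lreal_approx:
  obtains C where "\<And>k s. s > 1 \<Longrightarrow> exp (Psum k s - C) \<le> Lreal k s \<and> Lreal k s \<le> exp (Psum k s + C)"
proof
  define C where "C = 26 * (\<Sum>n. real n powr (- 2))"
  fix k :: nat and s :: real assume s: "s > 1"
  have sm: "summable (\<lambda>n. real n powr (- 2))" by (simp add: summable_real_powr_iff)
  let ?F = "finite_subsets_at_top {p :: nat. prime p}"
  have bounds: "exp (sum (dterm k s) T - C) \<le> (\<Prod>p\<in>T. 1 / euler_den k s p) \<and> 
     (\<Prod>p\<in>T. 1 / euler_den k s p) \<le> exp (sum (dterm k s) T + C)" if T: "finite T" "T \<subseteq> {p. prime p}" for T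
  proof -
    have pos: "1 / euler_den k s p > 0" if "p \<in> T" for p
      using euler_den_lower(1)[of p s k] T that s by (auto intro: less_le_trans[of 0 "1/4"])
    have "(\<Prod>p\<in>T. 1 / euler_den k s p) = (\<Prod>p\<in>T. exp (ln (1 / euler_den k s p)))"
      using pos by (intro prod.cong) auto
    also have "\<dots> = exp (\<Sum>p\<in>T. ln (1 / euler_den k s p))" using T by (simp add: exp_sum)
    finally have e: "(\<Prod>p\<in>T. 1 / euler_den k s p) = exp (\<Sum>p\<in>T. ln (1 / euler_den k s p))" .
    have "\<bar>(\<Sum>p\<in>T. ln (1 / euler_den k s p)) - sum (dterm k s) T\<bar> \<le> (\<Sum>p\<in>T. \<bar>ln (1 / euler_den k s p) - dterm k s p\<bar>)"
      unfolding sum_subtractf[symmetric] by (rule sum_abs)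
    also have "\<dots> \<le> (\<Sum>p\<in>T. 26 * real p powr (- 2))"
      using T s by (intro sum_mono ln_euler_factor) auto
    also have "\<dots> = 26 * (\<Sum>p\<in>T. real p powr (- 2))" by (simp add: sum_distrib_left)
    also have "\<dots> \<le> C" unfolding C_def using T by (intro mult_left_mono sum_le_suminf sm) auto
    finally show ?thesis unfolding e exp_le_cancel_iff by linarith
  qed
  have ev: "eventually (\<lambda>T. finite T \<and> T \<subseteq> {p :: nat. prime p}) ?F"
    by (intro eventually_finite_subsets_at_top_weakI) auto
  have lim: "(sum (dterm k s) \<longlongrightarrow> Psum k s) ?F"
    using Psum_has_sum[OF s, of k] by (simp add: has_sum_def)
  have "exp (Psum k s - C) \<le> Lreal k s"
  proof (rule tendsto_le)
    show "((\<lambda>T. exp (sum (dterm k s) T - C)) \<longlongrightarrow> exp (Psum k s - C)) ?F" by (intro tendsto_intros lim)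
    show "((\<lambda>T. \<Prod>p\<in>T. 1 / euler_den k s p) \<longlongrightarrow> Lreal k s) ?F" by (rule euler_product_limit[OF s])
    show "eventually (\<lambda>T. exp (sum (dterm k s) T - C) \<le> (\<Prod>p\<in>T. 1 / euler_den k s p)) ?F"
      using ev by eventually_elim (use bounds in blast)
  qed simp
  moreover have "Lreal k s \<le> exp (Psum k s + C)"
  proof (rule tendsto_le)
    show "((\<lambda>T. exp (sum (dterm k s) T + C)) \<longlongrightarrow> exp (Psum k s + C)) ?F" by (intro tendsto_intros lim)
    show "((\<lambda>T. \<Prod>p\<in>T. 1 / euler_den k s p) \<longlongrightarrow> Lreal k s) ?F" by (rule euler_product_limit[OF s])
    show "eventually (\<lambda>T. (\<Prod>p\<in>T. 1 / euler_den k s p) \<le> exp (sum (dterm k s) T + C)) ?F"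
      using ev by eventually_elim (use bounds in blast)
  qed simp
  ultimately show "exp (Psum k s - C) \<le> Lreal k s \<and> Lreal k s \<le> exp (Psum k s + C)" by simp
qed

lemma has_sum_sum:
  fixes f :: "'i \<Rightarrow> 'a \<Rightarrow> 'b :: topological_comm_monoid_add"
  assumes "finite I" "\<And>i. i \<in> I \<Longrightarrow> (f i has_sum S i) A"
  shows "((\<lambda>x. \<Sum>i\<in>I. f i x) has_sum (\<Sum>i\<in>I. S i)) A"
  using assms by (induction I rule: finite_induct) (auto intro: has_sum_add)

lemma Lreal_pos: "s > 1 \<Longrightarrow> Lreal k s > 0"
proof -
  assume s: "s > 1"
  obtain C where C: "\<And>k s. s > 1 \<Longrightarrow> exp (Psum k s - C) \<le> Lreal k s \<and> Lreal k s \<le> exp (Psum k s + C)"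
    using ln_Lreal_approx by blast
  have "0 < exp (Psum k s - C)" by simp
  also have "\<dots> \<le> Lreal k s" using C[OF s] by blast
  finally show ?thesis .
qed

lemma Psum_ln_approx:
  obtains C where "\<And>k s. s > 1 \<Longrightarrow> \<bar>Psum k s - ln (cmod (Lser k s))\<bar> \<le> C"
proof -
  obtain C where C: "\<And>k s. s > 1 \<Longrightarrow> exp (Psum k s - C) \<le> Lreal k s \<and> Lreal k s \<le> exp (Psum k s + C)"
    using ln_Lreal_approx by blast
  have "\<bar>Psum k s - ln (cmod (Lser k s))\<bar> \<le> C + ln 4" if s: "s > 1" for k s
  proof -
    have pos: "Lreal k s > 0" by (rule Lreal_pos[OF s])
    have "cmod (Lser k s) = \<bar>4 * Lreal k s\<bar>" unfolding Lser_eq_Lreal[OF s] norm_of_real ..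
    then have "cmod (Lser k s) = 4 * Lreal k s" using pos by simp
    then have e: "ln (cmod (Lser k s)) = ln 4 + ln (Lreal k s)" using pos by (simp add: ln_mult)
    have "Psum k s - C \<le> ln (Lreal k s)" using C[OF s, of k] pos by (simp add: ln_ge_iff)
    moreover have "ln (Lreal k s) \<le> Psum k s + C"
    proof -
      have "ln (Lreal k s) \<le> ln (exp (Psum k s + C))" using C[OF s, of k] pos by (subst ln_le_cancel_iff) auto
      then show ?thesis by simp
    qed
    moreover have "ln 4 \<ge> (0 :: real)" by simp
    ultimately show ?thesis unfolding e by linarith
  qed
  then show ?thesis using that by blast
qed

lemma Psum_0_at_top: "filterlim (Psum 0) at_top (at_right 1)"
proof -
  obtain C where C: "\<And>k s. s > 1 \<Longrightarrow> \<bar>Psum k s - ln (cmod (Lser k s))\<bar> \<le> C"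
    using Psum_ln_approx by blast
  have "filterlim (\<lambda>s. ln (cmod (Lser 0 s))) at_top (at_right 1)"
    by (rule filterlim_compose[OF ln_at_top Lser_0_at_top])
  then have "filterlim (\<lambda>s. - C + ln (cmod (Lser 0 s))) at_top (at_right 1)"
    by (intro filterlim_tendsto_add_at_top[of _ "- C"]) auto
  then show ?thesis
  proof (rule filterlim_at_top_mono)
    show "eventually (\<lambda>s. - C + ln (cmod (Lser 0 s)) \<le> Psum 0 s) (at_right 1)"
      using eventually_at_right_1_2
    proof eventually_elim
      case (elim s)
      then show ?case using C[of s 0] by (simp add: abs_le_iff)
    qed
  qed
qed

lemma Psum_upper:
  assumes k: "k \<ge> 1"
  obtains B where "eventually (\<lambda>s. Psum k s \<le> B) (at_right 1)"
proof -
  obtain C where C: "\<And>k s. s > 1 \<Longrightarrow> \<bar>Psum k s - ln (cmod (Lser k s))\<bar> \<le> C"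
    using Psum_ln_approx by blast
  obtain D where D: "eventually (\<lambda>s. cmod (Lser k s) \<le> D) (at_right 1)"
    using Lser_bounded[OF k] by blast
  have "eventually (\<lambda>s. Psum k s \<le> C + ln D) (at_right 1)"
    using D eventually_at_right_1_2
  proof eventually_elim
    case (elim s)
    have "cmod (Lser k s) > 0" using Lreal_pos[of s k] Lser_eq_Lreal[of s k] elim by simp
    then have "ln (cmod (Lser k s)) \<le> ln D" using elim by (intro ln_mono) auto
    then show ?case using C[of s k] elim by (simp add: abs_le_iff)
  qed
  then show ?thesis using that by blast
qed

text \<open>At a split prime this is 1 - cos 2x <= 4 (1 + cos x), equivalent to (1 + cos x)^2 >= 0:
  a cosine close to -1 doubles to one close to 1.\<close>

lemma hcoeff_double_le:
  assumes p: "prime p"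
  shows "hcoeff 0 p - hcoeff (2 * k) p \<le> 4 * (hcoeff 0 p + hcoeff k p)"
  using p
proof (cases rule: prime_trichotomy)
  case two then show ?thesis by (cases "even k") auto
next
  case (split \<phi>)
  define c where "c = cos (real k * \<phi>)"
  have "cos (real (2 * k) * \<phi>) = 2 * c\<^sup>2 - 1"
    unfolding c_def using cos_double_cos[of "real k * \<phi>"] by (simp add: mult.assoc)
  then have h: "hcoeff 0 p = 2" "hcoeff k p = 2 * c" "hcoeff (2 * k) p = 2 * (2 * c\<^sup>2 - 1)"
    unfolding split(3) c_def by simp_all
  have "0 \<le> (1 + c)\<^sup>2" by simp
  then show ?thesis unfolding h by (simp add: power2_eq_square algebra_simps)
qed auto

text \<open>If L_k is of order s - 1, its ln(s - 1) cancels that of the pole of L_0, and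
  \<open>Psum 0 + Psum k\<close> is bounded above. By \<open>hcoeff_double_le\<close> so is
  \<open>Psum 0 - Psum (2 * k)\<close>, hence \<open>Psum 0\<close> itself by
  \<open>Psum_upper\<close>, against its divergence.\<close>

lemma Psum_lower:
  assumes k: "k \<ge> 1"
  obtains B where "eventually (\<lambda>s. B \<le> Psum k s) (at_right 1)"
proof -
  obtain C where C: "\<And>k s. s > 1 \<Longrightarrow> \<bar>Psum k s - ln (cmod (Lser k s))\<bar> \<le> C"
    using Psum_ln_approx by blast
  have Lpos: "cmod (Lser k s) > 0" if "s > 1" for k s
    using Lreal_pos[of s k] Lser_eq_Lreal[of s k] that by simp
  from Lser_dichotomy[OF k] show ?thesis
  proof (elim disjE exE conjE)
    fix c :: real assume c: "c > 0" "eventually (\<lambda>s. c \<le> cmod (Lser k s)) (at_right 1)"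
    have "eventually (\<lambda>s. ln c - C \<le> Psum k s) (at_right 1)"
      using c(2) eventually_at_right_1_2
    proof eventually_elim
      case (elim s)
      have "ln c \<le> ln (cmod (Lser k s))" using elim c by (intro ln_mono) auto
      then show ?case using C[of s k] elim by (simp add: abs_le_iff)
    qed
    then show ?thesis using that by blast
  next
    fix D assume D: "eventually (\<lambda>s. cmod (Lser k s) \<le> D * (s - 1)) (at_right 1)"
    obtain E where E: "E > 0" "eventually (\<lambda>s. cmod (Lser 0 s) \<le> E / (s - 1)) (at_right 1)"
      using Lser_0_upper by blast
    obtain B where B: "eventually (\<lambda>s. Psum (2 * k) s \<le> B) (at_right 1)"
      using Psum_upper[of "2 * k"] k by auto
    define R where "R = B + 4 * (2 * C + ln D + ln E)"
    have "eventually (\<lambda>s. Psum 0 s > R) (at_right 1)"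
      using Psum_0_at_top by (simp add: filterlim_at_top_dense)
    then have "eventually (\<lambda>s. False) (at_right (1::real))"
      using B D E(2) eventually_at_right_1_2
    proof eventually_elim
      case (elim s)
      have s: "s > 1" using elim by simp
      have D0: "D > 0" using Lpos[OF s, of k] elim s by (smt (verit) mult_nonpos_nonneg)
      have "ln (cmod (Lser k s)) \<le> ln (D * (s - 1))" using elim Lpos[OF s, of k] by (intro ln_mono) auto
      also have "\<dots> = ln D + ln (s - 1)" using D0 s by (simp add: ln_mult)
      finally have 1: "ln (cmod (Lser k s)) \<le> ln D + ln (s - 1)" .
      have "ln (cmod (Lser 0 s)) \<le> ln (E / (s - 1))" using elim Lpos[OF s, of 0] by (intro ln_mono) auto
      also have "\<dots> = ln E - ln (s - 1)" using E s by (simp add: ln_div)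
      finally have 2: "ln (cmod (Lser 0 s)) \<le> ln E - ln (s - 1)" .
      have 3: "Psum 0 s + Psum k s \<le> 2 * C + ln D + ln E"
        using 1 2 C[OF s, of k] C[OF s, of 0] by (simp add: abs_le_iff)
      have "((\<lambda>p. dterm 0 s p - dterm (2 * k) s p) has_sum (Psum 0 s - Psum (2 * k) s)) {p. prime p}"
        using has_sum_add[OF Psum_has_sum[OF s, of 0] has_sum_uminusI[OF Psum_has_sum[OF s, of "2 * k"]]] by simp
      moreover have "((\<lambda>p. 4 * (dterm 0 s p + dterm k s p)) has_sum (4 * (Psum 0 s + Psum k s))) {p. prime p}"
        by (intro has_sum_cmult_right has_sum_add Psum_has_sum s)
      ultimately have "Psum 0 s - Psum (2 * k) s \<le> 4 * (Psum 0 s + Psum k s)"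
      proof (rule has_sum_mono)
        fix p assume "p \<in> {p :: nat. prime p}"
        then have "(hcoeff 0 p - hcoeff (2 * k) p) * real p powr (- s) \<le> (4 * (hcoeff 0 p + hcoeff k p)) * real p powr (- s)"
          using hcoeff_double_le[of p k] by (intro mult_right_mono) auto
        then show "dterm 0 s p - dterm (2 * k) s p \<le> 4 * (dterm 0 s p + dterm k s p)"
          by (simp add: dterm_def algebra_simps)
      qed
      also have "\<dots> \<le> 4 * (2 * C + ln D + ln E)" using 3 by simp
      finally have "Psum 0 s \<le> R" using elim(2) by (simp add: R_def)
      then show False using elim(1) by simp
    qed
    then show ?thesis by (simp add: trivial_limit_at_right_real)
  qed
qed

lemma Psum_bounded:
  assumes "k \<ge> 1"
  shows "\<exists>B. eventually (\<lambda>s. \<bar>Psum k s\<bar> \<le> B) (at_right 1)"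
proof -
  obtain A B where "eventually (\<lambda>s. Psum k s \<le> A) (at_right 1)" "eventually (\<lambda>s. B \<le> Psum k s) (at_right 1)"
    using Psum_upper[OF assms] Psum_lower[OF assms] by metis
  then have "eventually (\<lambda>s. \<bar>Psum k s\<bar> \<le> \<bar>A\<bar> + \<bar>B\<bar>) (at_right 1)"
    by eventually_elim auto
  then show ?thesis by blast
qed

section \<open>Fejer kernel and density of the angles\<close>

definition ndiff :: "nat \<Rightarrow> nat \<Rightarrow> nat" where
  "ndiff i j = (i - j) + (j - i)"

lemma cos_ndiff: "cos (real (ndiff i j) * x) = cos (real i * x - real j * x)"
proof (cases "i \<le> j")
  case True
  then have "real (ndiff i j) * x = - (real i * x - real j * x)" by (simp add: ndiff_def of_nat_diff algebra_simps)
  then show ?thesis by (simp only: cos_minus)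
qed (simp add: ndiff_def of_nat_diff algebra_simps)

lemma fejer_sum: "(\<Sum>i<m. \<Sum>j<m. cos (real i * x - real j * x)) = (cmod (\<Sum>j<m. cis (real j * x)))\<^sup>2"
proof -
  let ?S = "\<Sum>j<m. cis (real j * x)"
  have "of_real ((cmod ?S)\<^sup>2) = ?S * cnj ?S" by (rule complex_norm_square)
  also have "\<dots> = (\<Sum>i<m. \<Sum>j<m. cis (real i * x - real j * x))"
    by (simp add: sum_product cis_cnj cis_mult)
  finally have "Re (of_real ((cmod ?S)\<^sup>2)) = Re (\<Sum>i<m. \<Sum>j<m. cis (real i * x - real j * x))" by (rule arg_cong)
  then show ?thesis by simp
qed

lemma norm_sum_cis_le:
  assumes "d > 0" "d \<le> cmod (cis x - 1)"
  shows "cmod (\<Sum>j<m. cis (real j * x)) \<le> 2 / d"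
proof -
  have "(cis x - 1) * (\<Sum>j<m. cis x ^ j) = cis x ^ m - 1" by (rule power_diff_1_eq[symmetric])
  then have "cmod (cis x - 1) * cmod (\<Sum>j<m. cis x ^ j) = cmod (cis x ^ m - 1)" by (metis norm_mult)
  also have "\<dots> \<le> 2" using norm_triangle_ineq4[of "cis x ^ m" 1] by (simp add: norm_power)
  finally have "cmod (cis x - 1) * cmod (\<Sum>j<m. cis x ^ j) \<le> 2" .
  moreover have "d * cmod (\<Sum>j<m. cis x ^ j) \<le> cmod (cis x - 1) * cmod (\<Sum>j<m. cis x ^ j)"
    using assms by (intro mult_right_mono) auto
  ultimately have "d * cmod (\<Sum>j<m. cis x ^ j) \<le> 2" by linarith
  then show ?thesis using assms(1) by (simp add: Complex.DeMoivre field_simps)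
qed

text \<open>The product formula for cosines yields two kernels, centred at a and -a, as only the
  cosine of the angle is available. Away from the peaks each geometric sum is at most 2/d,
  independently of m.\<close>

lemma fejer_small:
  assumes d: "d > 0" "d \<le> \<bar>cos x - cos a\<bar>"
  shows "(\<Sum>i<m. \<Sum>j<m. cos (real (ndiff i j) * a) * (2 * cos (real (ndiff i j) * x))) \<le> 8 / d\<^sup>2"
proof -
  \<comment> \<open>A rotation turns |cis y - 1| into |cis x - cis b| with b = a or -a, whose real
    part is cos x - cos a.\<close>
  have c: "d \<le> cmod (cis y - 1)" if y: "y = x - a \<or> y = x + a" for y
  proof -
    obtain b where b: "y = x - b" "cos b = cos a" 
    proof (cases "y = x - a")
      case False
      then have "y = x - (- a)" using y by simp
      then show ?thesis by (rule that) simp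
    qed blast
    have "cis y - 1 = cis (- b) * (cis x - cis b)" unfolding b(1)
      by (simp add: algebra_simps cis_mult)
    then have "cmod (cis y - 1) = cmod (cis x - cis b)" by (simp add: norm_mult)
    also have "\<dots> \<ge> \<bar>Re (cis x - cis b)\<bar>" by (rule abs_Re_le_cmod)
    finally show ?thesis using d b by simp
  qed
  have "(\<Sum>i<m. \<Sum>j<m. cos (real (ndiff i j) * a) * (2 * cos (real (ndiff i j) * x)))
      = (\<Sum>i<m. \<Sum>j<m. cos (real i * (x - a) - real j * (x - a)) + cos (real i * (x + a) - real j * (x + a)))"
  proof (intro sum.cong refl)
    fix i j
    let ?n = "real (ndiff i j)"
    have "cos (?n * a) * (2 * cos (?n * x)) = cos (?n * (x - a)) + cos (?n * (x + a))"
      by (simp add: right_diff_distrib distrib_left cos_diff cos_add)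
    then show "cos (?n * a) * (2 * cos (?n * x)) = cos (real i * (x - a) - real j * (x - a)) + cos (real i * (x + a) - real j * (x + a))"
      by (simp only: cos_ndiff)
  qed
  also have "\<dots> = (cmod (\<Sum>j<m. cis (real j * (x - a))))\<^sup>2 + (cmod (\<Sum>j<m. cis (real j * (x + a))))\<^sup>2"
    by (simp only: sum.distrib fejer_sum)
  also have "\<dots> \<le> (2 / d)\<^sup>2 + (2 / d)\<^sup>2"
    using c d by (intro add_mono power_mono norm_sum_cis_le) auto
  also have "\<dots> = 8 / d\<^sup>2" by (simp add: power_divide)
  finally show ?thesis .
qed

text \<open>If the set were finite, the Fejer weight of all but finitely many primes would be at
  most half the diagonal term, so \<open>Psum 0\<close> would be bounded near 1. Infinitude, rather
  than mere existence, later permits coprime choices for one and the same angle.\<close>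

lemma split_primes_dense:
  assumes c: "\<bar>c\<bar> \<le> 1" and d: "d > 0"
  shows "infinite {p. split_prime p \<and> \<bar>hcoeff 1 p / 2 - c\<bar> < d}"
proof
  assume fin: "finite {p. split_prime p \<and> \<bar>hcoeff 1 p / 2 - c\<bar> < d}"
  \<comment> \<open>2 joins the exceptional set because \<open>fejer_small\<close> covers split
    primes only; inert primes contribute 0.\<close>
  define E where "E = insert 2 {p. split_prime p \<and> \<bar>hcoeff 1 p / 2 - c\<bar> < d}"
  have E: "finite E" "E \<subseteq> {p. prime p}" using fin by (auto simp: E_def split_prime_def)
  define a where "a = arccos c"
  have a: "cos a = c" unfolding a_def using c by (intro cos_arccos) auto
  \<comment> \<open>At a split prime \<open>hcoeff 0 p = 2\<close>, so this m puts the bound of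
    \<open>fejer_small\<close> below \<open>real m / 2 * hcoeff 0 p\<close>.\<close>
  obtain m :: nat where m: "real m > 8 / d\<^sup>2" using reals_Archimedean2 by blast
  have m0: "m > 0" using m d by (metis gr0I not_less of_nat_0 zero_le_divide_iff zero_le_numeral zero_le_power2)
  define K where "K = (\<lambda>f :: nat \<Rightarrow> real. \<Sum>i<m. \<Sum>j<m. cos (real (ndiff i j) * a) * f (ndiff i j))"
  have K_small: "K (\<lambda>k. hcoeff k p) \<le> real m / 2 * hcoeff 0 p" if p: "prime p" "p \<notin> E" for p
    using p(1)
  proof (cases rule: prime_trichotomy)
    case two then show ?thesis using p(2) by (simp add: E_def)
  next
    case (split x)
    have "d \<le> \<bar>cos x - cos a\<bar>" using p(2) split a by (auto simp: E_def not_less)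
    then have "K (\<lambda>k. hcoeff k p) \<le> 8 / d\<^sup>2"
      unfolding K_def split(3) by (rule fejer_small[OF d])
    then show ?thesis using m split(3)[of 0] by simp
  qed (simp add: K_def)
  have K_any: "K (\<lambda>k. hcoeff k p) \<le> 2 * (real m)\<^sup>2" if p: "prime p" for p
  proof -
    have "K (\<lambda>k. hcoeff k p) \<le> (\<Sum>i<m. \<Sum>j<m. 2)"
      unfolding K_def
    proof (intro sum_mono)
      fix i j
      have "\<bar>hcoeff (ndiff i j) p\<bar> \<le> 2" using euler_den_lower(2)[OF p, of 2 "ndiff i j"] by simp
      then have "\<bar>cos (real (ndiff i j) * a)\<bar> * \<bar>hcoeff (ndiff i j) p\<bar> \<le> 1 * 2" by (intro mult_mono) auto
      then show "cos (real (ndiff i j) * a) * hcoeff (ndiff i j) p \<le> 2" by (simp add: abs_mult[symmetric] abs_le_iff)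
    qed
    then show ?thesis by (simp add: power2_eq_square)
  qed
  have le: "K (\<lambda>k. Psum k s) \<le> real m / 2 * Psum 0 s + real (card E) * (2 * (real m)\<^sup>2)" if s: "s > 1" for s
  proof (rule has_sum_mono)
    show "((\<lambda>p. K (\<lambda>k. dterm k s p)) has_sum K (\<lambda>k. Psum k s)) {p. prime p}"
      unfolding K_def by (intro has_sum_sum has_sum_cmult_right Psum_has_sum s finite_lessThan)
    have "((\<lambda>p. if p \<in> E then 2 * (real m)\<^sup>2 else 0) has_sum (\<Sum>p\<in>E. if p \<in> E then 2 * (real m)\<^sup>2 else 0)) {p. prime p}"
      using E by (intro has_sum_finite_neutralI) auto
    then have "((\<lambda>p. if p \<in> E then 2 * (real m)\<^sup>2 else 0) has_sum (real (card E) * (2 * (real m)\<^sup>2))) {p. prime p}"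
      by simp
    then show "((\<lambda>p. real m / 2 * dterm 0 s p + (if p \<in> E then 2 * (real m)\<^sup>2 else 0)) has_sum
        (real m / 2 * Psum 0 s + real (card E) * (2 * (real m)\<^sup>2))) {p. prime p}"
      by (intro has_sum_add has_sum_cmult_right Psum_has_sum s)
    fix p assume "p \<in> {p :: nat. prime p}"
    then have p: "prime p" by simp
    let ?t = "real p powr (- s)"
    have t: "0 \<le> ?t" "?t \<le> 1" using euler_den_lower(4,5)[OF p s] by auto
    have Kd: "K (\<lambda>k. dterm k s p) = K (\<lambda>k. hcoeff k p) * ?t"
      by (simp add: K_def dterm_def sum_distrib_right mult.assoc)
    show "K (\<lambda>k. dterm k s p) \<le> real m / 2 * dterm 0 s p + (if p \<in> E then 2 * (real m)\<^sup>2 else 0)"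
    proof (cases "p \<in> E")
      case True
      have "K (\<lambda>k. hcoeff k p) * ?t \<le> 2 * (real m)\<^sup>2 * 1"
        using K_any[OF p] t by (meson mult_mono mult_left_mono mult_right_mono order_trans zero_le_mult_iff zero_le_numeral zero_le_power2)
      moreover have "dterm 0 s p \<ge> 0" using hcoeff_0_nonneg[of p] p prime_gt_0_nat[OF p] by (simp add: dterm_def)
      ultimately show ?thesis using True Kd by (simp add: add_increasing)
    next
      case False
      have "K (\<lambda>k. hcoeff k p) * ?t \<le> real m / 2 * hcoeff 0 p * ?t"
        using K_small[OF p False] t by (intro mult_right_mono) auto
      then show ?thesis using False Kd by (simp add: dterm_def)
    qed
  qed
  have "\<exists>B. eventually (\<lambda>s. \<forall>k\<in>{1..m}. \<bar>Psum k s\<bar> \<le> B) (at_right 1)"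
  proof -
    obtain B where B: "\<And>k. k \<ge> 1 \<Longrightarrow> eventually (\<lambda>s. \<bar>Psum k s\<bar> \<le> B k) (at_right 1)"
      using Psum_bounded by metis
    have "eventually (\<lambda>s. \<forall>k\<in>{1..m}. \<bar>Psum k s\<bar> \<le> B k) (at_right 1)"
      by (intro eventually_ball_finite ballI B) auto
    moreover have "B k \<le> (\<Sum>k\<in>{1..m}. \<bar>B k\<bar>)" if "k \<in> {1..m}" for k
      using member_le_sum[OF that, of "\<lambda>k. \<bar>B k\<bar>"] by simp
    ultimately have "eventually (\<lambda>s. \<forall>k\<in>{1..m}. \<bar>Psum k s\<bar> \<le> (\<Sum>k\<in>{1..m}. \<bar>B k\<bar>)) (at_right 1)"
      by (elim eventually_mono) (meson order_trans)
    then show ?thesis by blast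
  qed
  then obtain B where B: "eventually (\<lambda>s. \<forall>k\<in>{1..m}. \<bar>Psum k s\<bar> \<le> B) (at_right 1)" by blast
  define R where "R = 2 / real m * ((real m)\<^sup>2 * \<bar>B\<bar> + real (card E) * (2 * (real m)\<^sup>2))"
  have "eventually (\<lambda>s. Psum 0 s > R) (at_right 1)" "eventually (\<lambda>s. Psum 0 s > 0) (at_right 1)"
    using Psum_0_at_top by (simp_all add: filterlim_at_top_dense)
  then have "eventually (\<lambda>s. False) (at_right (1::real))"
    using B eventually_at_right_1_2
  proof eventually_elim
    case (elim s)
    \<comment> \<open>The diagonal has index 0 and weight 1, giving m times \<open>Psum 0\<close>;
      off the diagonal the index lies in {1..m}, where B bounds every \<open>Psum\<close>.\<close>
    have "(\<Sum>i<m. \<Sum>j<m. (if i = j then Psum 0 s else 0) - \<bar>B\<bar>) \<le> K (\<lambda>k. Psum k s)"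
      unfolding K_def
    proof (intro sum_mono)
      fix i j assume ij: "i \<in> {..<m}" "j \<in> {..<m}"
      show "(if i = j then Psum 0 s else 0) - \<bar>B\<bar> \<le> cos (real (ndiff i j) * a) * Psum (ndiff i j) s"
      proof (cases "i = j")
        case True then show ?thesis by (simp add: ndiff_def)
      next
        case False
        then have "ndiff i j \<in> {1..m}" using ij by (auto simp: ndiff_def)
        then have "\<bar>cos (real (ndiff i j) * a)\<bar> * \<bar>Psum (ndiff i j) s\<bar> \<le> 1 * B"
          using elim by (intro mult_mono) auto
        then have "\<bar>cos (real (ndiff i j) * a) * Psum (ndiff i j) s\<bar> \<le> \<bar>B\<bar>" by (simp add: abs_mult)
        then show ?thesis using False by (simp add: abs_le_iff)
      qed
    qed
    also have "K (\<lambda>k. Psum k s) \<le> real m / 2 * Psum 0 s + real (card E) * (2 * (real m)\<^sup>2)"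
      using le[of s] elim by simp
    also have "(\<Sum>i<m. \<Sum>j<m. (if i = j then Psum 0 s else 0) - \<bar>B\<bar>) = real m * Psum 0 s - (real m)\<^sup>2 * \<bar>B\<bar>"
      by (simp add: sum_subtractf power2_eq_square algebra_simps)
    finally have "real m / 2 * Psum 0 s \<le> (real m)\<^sup>2 * \<bar>B\<bar> + real (card E) * (2 * (real m)\<^sup>2)" by simp
    then have "2 / real m * (real m / 2 * Psum 0 s) \<le> R"
      unfolding R_def by (intro mult_left_mono) auto
    then show False using elim m0 by simp
  qed
  then show False by (simp add: trivial_limit_at_right_real)
qed

section \<open>The attainable region\<close>

text \<open>Each cosine is approximated by a fresh prime beyond the product built so far, which
  makes the ratios multiply and lets \<open>cs\<close> contain repetitions.\<close>

lemma exists_near_cos_product: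
  assumes "\<forall>c\<in>set cs. \<bar>c\<bar> \<le> 1" and "e > 0"
  shows "\<exists>n>0. hcoeff 0 n > 0 \<and> \<bar>ratio 1 n - prod_list cs\<bar> < e \<and>
     \<bar>ratio 2 n - prod_list (map (\<lambda>c. 2 * c\<^sup>2 - 1) cs)\<bar> < e"
  using assms
proof (induction cs arbitrary: e)
  case Nil
  then show ?case by (intro exI[of _ 1]) (simp add: ratio_def)
next
  case (Cons c cs)
  let ?P = "prod_list cs" and ?Q = "prod_list (map (\<lambda>c. 2 * c\<^sup>2 - 1) cs)"
  have c: "\<bar>c\<bar> \<le> 1" and cs: "\<forall>c\<in>set cs. \<bar>c\<bar> \<le> 1" using Cons.prems by auto
  \<comment> \<open>The map c to 2c^2 - 1 has Lipschitz constant 4 on [-1, 1], so an error e/8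
    becomes e/2 in the second coordinate and leaves room for the remaining factors.\<close>
  obtain m where m: "m > 0" "hcoeff 0 m > 0" "\<bar>ratio 1 m - ?P\<bar> < e / 8" "\<bar>ratio 2 m - ?Q\<bar> < e / 8"
    using Cons.IH[OF cs, of "e / 8"] Cons.prems(2) by auto
  have "infinite ({p. split_prime p \<and> \<bar>hcoeff 1 p / 2 - c\<bar> < e / 8} - {..m})"
    using split_primes_dense[OF c, of "e / 8"] Cons.prems(2) by (intro Diff_infinite_finite) auto
  then obtain p where p: "split_prime p" "\<bar>hcoeff 1 p / 2 - c\<bar> < e / 8" "p > m"
    using infinite_imp_nonempty by (metis (no_types, lifting) Diff_iff all_not_in_conv atMost_iff mem_Collect_eq not_less)
  have pr: "prime p" using p(1) by (simp add: split_prime_def)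
  have nd: "\<not> p dvd m" using p(3) m(1) by (auto dest: dvd_imp_le)
  obtain x where x: "\<And>k. hcoeff k p = 2 * cos (real k * x)" using hcoeff_split_prime[OF p(1)] by metis
  define d where "d = cos x"
  have d1: "\<bar>d\<bar> \<le> 1" by (simp add: d_def)
  have r: "ratio k (p * m) = ratio k p * ratio k m" for k
    using ratio_prime_power_mult[OF pr nd, of k 1] by simp
  have rp: "ratio 1 p = d" "ratio 2 p = 2 * d\<^sup>2 - 1"
    using x[of 0] x[of 1] x[of 2] by (simp_all add: ratio_def d_def cos_double_cos)
  have dc: "\<bar>d - c\<bar> < e / 8" using p(2) x[of 1] by (simp add: d_def)
  have prod: "\<bar>u * v - w * z\<bar> \<le> \<bar>u - w\<bar> + \<bar>v - z\<bar>" if "\<bar>v\<bar> \<le> 1" "\<bar>w\<bar> \<le> 1" for u v w z :: real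
  proof -
    have "u * v - w * z = (u - w) * v + w * (v - z)" by (simp add: algebra_simps)
    then have "\<bar>u * v - w * z\<bar> \<le> \<bar>u - w\<bar> * \<bar>v\<bar> + \<bar>w\<bar> * \<bar>v - z\<bar>"
      using abs_triangle_ineq[of "(u - w) * v" "w * (v - z)"] by (simp add: abs_mult)
    also have "\<dots> \<le> \<bar>u - w\<bar> * 1 + 1 * \<bar>v - z\<bar>" using that by (intro add_mono mult_left_mono mult_right_mono) auto
    finally show ?thesis by simp
  qed
  have n: "p * m > 0" using m(1) p(3) by simp
  have h0: "hcoeff 0 (p * m) > 0"
    using hcoeff_prime_power_mult[OF pr nd, of 0 1] x[of 0] m(2) by simp
  have r1: "\<bar>ratio 1 m\<bar> \<le> 1" "\<bar>ratio 2 m\<bar> \<le> 1" using abs_ratio_le_1[OF m(1)] by auto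
  have "\<bar>ratio 1 (p * m) - c * ?P\<bar> < e"
    unfolding r rp using prod[OF r1(1) c, of d ?P] dc m(3) by linarith
  moreover have "\<bar>ratio 2 (p * m) - (2 * c\<^sup>2 - 1) * ?Q\<bar> < e"
  proof -
    have "c\<^sup>2 \<le> 1" using c by (simp add: abs_square_le_1)
    then have c2: "\<bar>2 * c\<^sup>2 - 1\<bar> \<le> 1" using zero_le_power2[of c] by (simp add: abs_le_iff)
    have "(2 * d\<^sup>2 - 1) - (2 * c\<^sup>2 - 1) = 2 * ((d - c) * (d + c))" by (simp add: power2_eq_square algebra_simps)
    then have "\<bar>(2 * d\<^sup>2 - 1) - (2 * c\<^sup>2 - 1)\<bar> = 2 * (\<bar>d - c\<bar> * \<bar>d + c\<bar>)" by (simp add: abs_mult)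
    also have "\<dots> \<le> 2 * (\<bar>d - c\<bar> * 2)" using d1 c by (intro mult_left_mono) auto
    finally have "\<bar>(2 * d\<^sup>2 - 1) - (2 * c\<^sup>2 - 1)\<bar> \<le> e / 2" using dc by simp
    then show ?thesis unfolding r rp using prod[OF r1(2) c2, of "2 * d\<^sup>2 - 1" ?Q] m(4) Cons.prems(2) by linarith
  qed
  ultimately show ?case using n h0 by (intro exI[of _ "p * m"]) simp
qed

text \<open>Membership in the closure of the points realised by integers; exact equality is out of
  reach since prime angles are only dense.\<close>

definition reachable :: "real \<Rightarrow> real \<Rightarrow> bool" where
  "reachable x y \<longleftrightarrow> (\<forall>e>0. \<exists>n>0. hcoeff 0 n > 0 \<and> \<bar>ratio 1 n - x\<bar> < e \<and> \<bar>ratio 2 n - y\<bar> < e)"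

lemma reachable_prod_list:
  assumes "\<And>c. c \<in> set cs \<Longrightarrow> \<bar>c\<bar> \<le> 1"
  shows "reachable (prod_list cs) (prod_list (map (\<lambda>c. 2 * c\<^sup>2 - 1) cs))"
  unfolding reachable_def using exists_near_cos_product[of cs] assms by blast

lemma reachable_closed:
  assumes "\<And>e. e > 0 \<Longrightarrow> \<exists>y'. reachable x y' \<and> \<bar>y' - y\<bar> < e"
  shows "reachable x y"
  unfolding reachable_def
proof (intro allI impI)
  fix e :: real assume e: "e > 0"
  then obtain y' where y': "reachable x y'" "\<bar>y' - y\<bar> < e / 2" using assms[of "e / 2"] by auto
  then obtain n where "n > 0" "hcoeff 0 n > 0" "\<bar>ratio 1 n - x\<bar> < e / 2" "\<bar>ratio 2 n - y'\<bar> < e / 2"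
    unfolding reachable_def using e half_gt_zero by blast
  moreover have "\<bar>ratio 2 n - y\<bar> < e" using calculation(4) y'(2) by linarith
  ultimately show "\<exists>n>0. hcoeff 0 n > 0 \<and> \<bar>ratio 1 n - x\<bar> < e \<and> \<bar>ratio 2 n - y\<bar> < e"
    using e by (intro exI[of _ n]) auto
qed

text \<open>Doubling n turns the lattice points by pi/4, which negates the first ratio and fixes the
  second.\<close>

lemma reachable_uminus:
  assumes "reachable x y"
  shows "reachable (- x) y"
  unfolding reachable_def
proof (intro allI impI)
  fix e :: real assume e: "e > 0"
  then obtain n where n: "n > 0" "hcoeff 0 n > 0" "\<bar>ratio 1 n - x\<bar> < e" "\<bar>ratio 2 n - y\<bar> < e"
    using assms unfolding reachable_def by blast
  have "ratio 1 (2 * n) = - ratio 1 n" "ratio 2 (2 * n) = ratio 2 n" "hcoeff 0 (2 * n) = hcoeff 0 n"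
    by (simp_all add: ratio_def hcoeff_2_mult)
  then show "\<exists>n>0. hcoeff 0 n > 0 \<and> \<bar>ratio 1 n - - x\<bar> < e \<and> \<bar>ratio 2 n - y\<bar> < e"
    using n by (intro exI[of _ "2 * n"]) (auto simp: abs_if split: if_splits)
qed

text \<open>The path from \<open>g = 1\<close> to \<open>g = x powr (1 / (m + 1))\<close> in the products \<open>x = (x / g ^ m) * g ^ m\<close>
  sweeps the whole interval of second coordinates.\<close>

lemma reachable_path:
  assumes x: "0 < x" "x \<le> 1" and y: "2 * x\<^sup>2 - 1 \<le> y" "y \<le> (2 * (x powr (1 / real (m + 1)))\<^sup>2 - 1) ^ (m + 1)"
  shows "reachable x y"
proof -
  define h where "h = x powr (1 / real (m + 1))"
  define f where "f = (\<lambda>g. (2 * (x / g ^ m)\<^sup>2 - 1) * (2 * g\<^sup>2 - 1) ^ m)"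
  have h: "0 < h" "h \<le> 1" using x powr_mono2[of "1 / real (m + 1)" x 1] by (auto simp: h_def)
  have "h ^ (m + 1) = h powr real (m + 1)" using h by (simp only: powr_realpow)
  also have "\<dots> = x" using x by (simp add: h_def powr_powr)
  finally have hm: "h ^ (m + 1) = x" .
  then have "x / h ^ m = h" using h by (simp add: field_simps)
  then have fh: "f h = (2 * h\<^sup>2 - 1) ^ (m + 1)" by (simp add: f_def)
  have "\<exists>g\<ge>h. g \<le> 1 \<and> f g = y"
  proof (rule IVT2')
    show "f 1 \<le> y" using y by (simp add: f_def)
    show "y \<le> f h" using y unfolding fh by (simp add: h_def)
    show "continuous_on {h..1} f" unfolding f_def using h by (auto intro!: continuous_intros)
  qed (use h in auto)
  then obtain g where g: "h \<le> g" "g \<le> 1" "f g = y" by blast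
  have g0: "g > 0" using g h by linarith
  \<comment> \<open>The quotient of x by g^m has to be a cosine again, hence at most 1.\<close>
  have "x \<le> h ^ m" using hm h by (simp add: mult_left_le_one_le flip: hm)
  also have "\<dots> \<le> g ^ m" using g h by (intro power_mono) auto
  finally have xg: "\<bar>x / g ^ m\<bar> \<le> 1" using x g0 by (simp add: field_simps)
  have "reachable (prod_list ((x / g ^ m) # replicate m g)) (prod_list (map (\<lambda>c. 2 * c\<^sup>2 - 1) ((x / g ^ m) # replicate m g)))"
    using xg g g0 by (intro reachable_prod_list) (auto split: if_splits)
  moreover have "prod_list ((x / g ^ m) # replicate m g) = x" using g0 by (simp add: prod_list_replicate)
  moreover have "prod_list (map (\<lambda>c. 2 * c\<^sup>2 - 1) ((x / g ^ m) # replicate m g)) = y"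
    using g(3) by (simp add: f_def prod_list_replicate)
  ultimately show ?thesis by simp
qed

text \<open>With u = ln x / (m + 1) the base is 2 exp(2u) - 1 = 1 + 4u + O(u^2), so the power tends
  to exp(4 ln x).\<close>

lemma quartic_limit:
  assumes "0 < x"
  shows "(\<lambda>m. (2 * (x powr (1 / real (m + 1)))\<^sup>2 - 1) ^ (m + 1)) \<longlonglongrightarrow> x ^ 4"
proof -
  have lim: "(\<lambda>m. (2 * (exp (ln x / real (m + 1)))\<^sup>2 - 1) ^ (m + 1)) \<longlonglongrightarrow> exp (4 * ln x)"
    by real_asymp
  have "exp (4 * ln x) = x ^ 4" using assms exp_of_nat_mult[of 4 "ln x"] by simp
  moreover have "x powr (1 / real (m + 1)) = exp (ln x / real (m + 1))" for m
    using assms by (simp add: powr_def)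
  ultimately show ?thesis using lim by (simp only:)
qed

text \<open>Two factors reach up to (2x - 1)^2, sufficiently many reach anything below x^4, and the
  edge x^4 follows by closedness. The paths need x > 0, so x = 0 is separate.\<close>

lemma reachable_region_nonneg:
  assumes x: "0 \<le> x" "x \<le> 1" and y: "2 * x\<^sup>2 - 1 \<le> y" "y \<le> M_bound x"
  shows "reachable x y"
proof -
  consider "x = 0" | "x > 0" "y \<le> (2 * x - 1)\<^sup>2" | "x > 0" "y < x ^ 4" | "x > 0" "y = x ^ 4"
    using x y by (fastforce simp: M_bound_def max_def split: if_splits)
  then show ?thesis
  proof cases
    case 1
    \<comment> \<open>The cosine 0 kills the first coordinate and contributes -1 to the second,
      which becomes 1 - 2c^2 = y.\<close>
    define c where "c = sqrt ((1 - y) / 2)"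
    have y1: "-1 \<le> y" "y \<le> 1" using y 1 by (auto simp: M_bound_def)
    have c: "0 \<le> c" "c \<le> 1" "c\<^sup>2 = (1 - y) / 2" using y1 by (auto simp: c_def)
    have "reachable (prod_list [0, c]) (prod_list (map (\<lambda>c. 2 * c\<^sup>2 - 1) [0, c]))"
      using c by (intro reachable_prod_list) auto
    then show ?thesis using 1 c by (simp add: field_simps)
  next
    case 2
    have "(x powr (1 / real (1 + 1)))\<^sup>2 = x" using 2 by (simp add: powr_half_sqrt)
    then have "y \<le> (2 * (x powr (1 / real (1 + 1)))\<^sup>2 - 1) ^ (1 + 1)" using 2 by (simp add: power2_eq_square)
    then show ?thesis using 2 x y by (intro reachable_path[of x y 1]) auto
  next
    case 3
    have "eventually (\<lambda>m. y < (2 * (x powr (1 / real (m + 1)))\<^sup>2 - 1) ^ (m + 1)) sequentially"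
      using quartic_limit[OF 3(1)] 3(2) by (rule order_tendstoD)
    then obtain m where "y < (2 * (x powr (1 / real (m + 1)))\<^sup>2 - 1) ^ (m + 1)"
      by (auto simp: eventually_sequentially)
    then show ?thesis using 3 x y by (intro reachable_path[of x y m]) auto
  next
    case 4
    show ?thesis
    proof (rule reachable_closed)
      fix e :: real assume e: "e > 0"
      define y' where "y' = max (2 * x\<^sup>2 - 1) (y - e / 2)"
      show "\<exists>y'. reachable x y' \<and> \<bar>y' - y\<bar> < e"
      proof (cases "y' < x ^ 4")
        case True
        then obtain m where m: "y' < (2 * (x powr (1 / real (m + 1)))\<^sup>2 - 1) ^ (m + 1)"
          using order_tendstoD(1)[OF quartic_limit[OF 4(1)], of y'] by (auto simp: eventually_sequentially)
        have "reachable x y'" using m 4 x by (intro reachable_path[of x y' m]) (auto simp: y'_def)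
        moreover have "\<bar>y' - y\<bar> < e" using y e by (auto simp: y'_def max_def abs_if)
        ultimately show ?thesis by blast
      next
        case False
        \<comment> \<open>Here the interval degenerates: x^4 - 2x^2 + 1 is the square of x^2 - 1, so
          x = 1, and a single cosine gives the point.\<close>
        then have "x ^ 4 \<le> 2 * x\<^sup>2 - 1" using 4 e by (auto simp: y'_def max_def split: if_splits)
        then have "y = 2 * x\<^sup>2 - 1" using 4 y by simp
        moreover have "reachable (prod_list [x]) (prod_list (map (\<lambda>c. 2 * c\<^sup>2 - 1) [x]))"
          using x by (intro reachable_prod_list) auto
        ultimately show ?thesis using e by (intro exI[of _ y]) simp
      qed
    qed
  qed
qed

lemma reachable_region:
  assumes x: "\<bar>x\<bar> \<le> 1" and y: "2 * x\<^sup>2 - 1 \<le> y" "y \<le> M_bound x"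
  shows "reachable x y"
proof (cases "x \<ge> 0")
  case False
  have "reachable (- (- x)) y"
    using assms False by (intro reachable_uminus reachable_region_nonneg) (auto simp: M_bound_def)
  then show ?thesis by simp
qed (use assms reachable_region_nonneg in auto)

lemma reachable_imp_attainable:
  assumes "reachable x y"
  shows "\<exists>\<mu>. attainable \<mu> \<and> fourier \<mu> 4 = of_real x \<and> fourier \<mu> 8 = of_real y"
proof -
  have "\<forall>j. \<exists>n>0. hcoeff 0 n > 0 \<and> \<bar>ratio 1 n - x\<bar> < inverse (real (Suc j)) \<and> \<bar>ratio 2 n - y\<bar> < inverse (real (Suc j))"
    using assms unfolding reachable_def by (metis inverse_positive_iff_positive of_nat_0_less_iff zero_less_Suc)
  then obtain n where n: "\<And>j. n j > 0" "\<And>j. hcoeff 0 (n j) > 0"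
    and l: "\<And>j. \<bar>ratio 1 (n j) - x\<bar> < inverse (real (Suc j))" "\<And>j. \<bar>ratio 2 (n j) - y\<bar> < inverse (real (Suc j))"
    by metis
  have ts: "int (n j) \<in> two_squares" for j using n two_squares_iff_hcoeff by blast
  have lim: "f \<longlonglongrightarrow> l" if "\<And>j. \<bar>f j - l\<bar> < inverse (real (Suc j))" for f l
  proof (rule LIM_zero_cancel, rule Lim_null_comparison[OF _ LIMSEQ_inverse_real_of_nat])
    show "eventually (\<lambda>j. norm (f j - l) \<le> inverse (real (Suc j))) sequentially"
      using that by (intro always_eventually allI) (simp add: less_imp_le)
  qed
  have X: "(\<lambda>j. ratio 1 (n j)) \<longlonglongrightarrow> x" and Y: "(\<lambda>j. ratio 2 (n j)) \<longlonglongrightarrow> y"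
    using l by (auto intro: lim)
  have f: "fourier (mu (int (n j))) (4 * int k) = of_real (ratio k (n j))" for j k
    using fourier_mu[OF ts[of j], of k] by (simp add: ratio_def)
  show ?thesis
  proof (rule attainable_if_fourier_limit[of "\<lambda>j. int (n j)"])
    show "(\<lambda>j. fourier (mu (int (n j))) 4) \<longlonglongrightarrow> of_real x" using tendsto_of_real[OF X] f[of _ 1] by simp
    show "(\<lambda>j. fourier (mu (int (n j))) 8) \<longlonglongrightarrow> of_real y" using tendsto_of_real[OF Y] f[of _ 2] by simp
  qed (rule ts)
qed

theorem theorem1p3:
  shows "(\<forall>\<mu> :: complex measure. attainable \<mu> \<and> norm (fourier \<mu> 4) > 1 / 3 \<longrightarrow>
            fourier \<mu> 4 \<in> \<real> \<and> fourier \<mu> 8 \<in> \<real> \<and>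
            2 * (Re (fourier \<mu> 4))\<^sup>2 - 1 \<le> Re (fourier \<mu> 8) \<and>
            Re (fourier \<mu> 8) \<le> M_bound (Re (fourier \<mu> 4)))
       \<and> (\<forall>x y :: real. \<bar>x\<bar> \<le> 1 \<and> 2 * x\<^sup>2 - 1 \<le> y \<and> y \<le> M_bound x \<longrightarrow>
            (\<exists>\<mu> :: complex measure. attainable \<mu> \<and>
               fourier \<mu> 4 = of_real x \<and> fourier \<mu> 8 = of_real y))"
  using attainable_bounds reachable_imp_attainable[OF reachable_region] by blast

end
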